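(* Let $\lambda$ be a generic normalized additively alternating $n\times n$ complex matrix, $q=\operatorname{EExp}(\lambda)$, $b$ its biresidue matrix, and $I\subseteq\{0,\dots,n-2\}$ such that $\{i,i+1\}$ is a smoothable edge of $b$ for every $i\in I$. For every choice of nonzero constants $\gamma_i\in\mathbb{C}$, $i\in I$, the algebra $\mathsf{A}_q$ admits a flat filtered deformation to a quadratic $\mathbb{C}[\varepsilon]$-algebra $\mathbb{C}\langle x_0,\dots,x_{n-1}\rangle[\varepsilon]/J_{q,I}$ whose two-sided ideal $J_{q,I}$ is generated by elements $$r_{ab}(\varepsilon)=-x_bx_a+q_{ba}x_ax_b+\sum_{m=1}^N\varepsilon^m\Big(\sum_{\substack{-e_a-e_b+e_k+e_\ell\in\Theta_m\\k\le\ell}}C^{k\ell}_{ba}x_kx_\ell\Big),\qquad a<b,$$ for some $N\ge1$ and constants $C^{k\ell}_{ba}\in\mathbb{C}$ with $C^{k\ell}_{ba}=\gamma_i$ whenever $-e_a-e_b+e_k+e_\ell=\boldsymbol\theta_i$. Specializing $\varepsilon$ to any value in $\mathbb{C}^\times$ gives a quadratic $\mathbb{C}$-algebra $\mathsf{A}_{q,I}$ that is, up to a filtered automorphism of $\mathsf V^*=\operatorname{span}(x_0,\dots,x_{n-1})$, independent of the nonzero constants $\gamma_i$ and of $\varepsilon$. Moreover, if no $\Theta_m$ with $m\ge1$ contains a weight of the form $e_a-e_b$, then the constants $C^{k\ell}_{ba}$ are uniquely determined by the $\gamma_i$, $i\in I$.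
   Context: Multiplicatively alternating $q$: nonzero entries, $q_{ii}=1$, $q_{ji}=q_{ij}^{-1}$; $\mathsf{A}_q=\mathbb{C}\langle x_0,\dots,x_{n-1}\rangle/(x_ix_j-q_{ij}x_jx_i)$. Additively alternating $\lambda$: $\lambda_{ji}=-\lambda_{ij}$; normalized: rows sum to zero; $\operatorname{EExp}(\lambda)=(e^{\lambda_{ij}})$. $e_a$ are the standard basis vectors of $\mathbb{Z}^n$; $x_a$ has torus weight $e_a$. A weight $\mathbf w\in\mathbb{Z}^n$ is relevant if $w_i\ge-1$ and $\sum w_i=0$; $q$-Hochschild-contributing if $w_i\ge-1$ for all $i$ and $\prod_jq_{ij}^{w_j}=1$ whenever $w_i\ge0$; $\lambda$-Poisson-contributing if $w_i\ge-1$ for all $i$ and $\sum_j\lambda_{ij}w_j=0$ whenever $w_i\ge0$. $\lambda$ is generic if rank $\lambda=n-1$ and every relevant $\operatorname{EExp}(\lambda)$-Hochschild-contributing weight is $\lambda$-Poisson-contributing. Biresidue matrix: the unique normalized alternating $b$ with $b|_\Delta=(\lambda|_\Delta)^{-1}$, $\Delta=\{z\in\mathbb{C}^n:\sum z_i=0\}$. An edge $\{i,j\}$ is smoothable if $b_{ij}\ne0$ and $(b_{jk}+b_{ki})/b_{ij}\in\mathbb{Z}_{\ge0}$ for $k\ne i,j$; its smoothable weight has entries $-1$ at $i,j$ and $(b_{jk}+b_{ki})/b_{ij}$ at $k\ne i,j$. $\boldsymbol\theta_i$ is the smoothable weight of $\{i,i+1\}$; $\Theta_m=\{\boldsymbol\theta_{i_1}+\dots+\boldsymbol\theta_{i_m}:i_1,\dots,i_m\in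 I\}$. The filtration $\mathcal F_a$ of $\mathbb{C}\langle x_0,\dots,x_{n-1}\rangle$ is spanned by words whose weight lies in $\Theta_m+\mathbb{Z}_{\ge0}^n$ for some $m\ge a$; "flat filtered deformation" means the quotient is a free $\mathbb{C}[\varepsilon]$-module reducing to $\mathsf{A}_q$ at $\varepsilon=0$, with deformed relations compatible with this filtration as displayed. *)

theory Defs
  imports "Jordan_Normal_Form.DL_Rank" "HOL-Computational_Algebra.Polynomial"
          "HOL-Library.Function_Algebras"
begin

definition add_alt :: "nat \<Rightarrow> (nat \<Rightarrow> nat \<Rightarrow> complex) \<Rightarrow> bool" where
  "add_alt n lam \<longleftrightarrow> (\<forall>i<n. \<forall>j<n. lam j i = - lam i j)"

definition normalized :: "nat \<Rightarrow> (nat \<Rightarrow> nat \<Rightarrow> complex) \<Rightarrow> bool" where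
  "normalized n lam \<longleftrightarrow> (\<forall>i<n. (\<Sum>j<n. lam i j) = 0)"

definition EExp :: "(nat \<Rightarrow> nat \<Rightarrow> complex) \<Rightarrow> nat \<Rightarrow> nat \<Rightarrow> complex" where
  "EExp lam = (\<lambda>i j. exp (lam i j))"

definition mat_rank :: "nat \<Rightarrow> (nat \<Rightarrow> nat \<Rightarrow> complex) \<Rightarrow> nat" where
  "mat_rank n lam = vec_space.rank n (mat n n (\<lambda>(i,j). lam i j))"

text \<open>Weights in Z^n are functions nat => int (entries at indices \<ge> n are ignored/zero).\<close>

definition relevant :: "nat \<Rightarrow> (nat \<Rightarrow> int) \<Rightarrow> bool" where
  "relevant n w \<longleftrightarrow> (\<forall>i<n. w i \<ge> -1) \<and> (\<Sum>i<n. w i) = 0"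

definition hochschild_contrib :: "nat \<Rightarrow> (nat \<Rightarrow> nat \<Rightarrow> complex) \<Rightarrow> (nat \<Rightarrow> int) \<Rightarrow> bool" where
  "hochschild_contrib n q w \<longleftrightarrow> (\<forall>i<n. w i \<ge> -1) \<and>
     (\<forall>i<n. w i \<ge> 0 \<longrightarrow> (\<Prod>j<n. q i j powi w j) = 1)"

definition poisson_contrib :: "nat \<Rightarrow> (nat \<Rightarrow> nat \<Rightarrow> complex) \<Rightarrow> (nat \<Rightarrow> int) \<Rightarrow> bool" where
  "poisson_contrib n lam w \<longleftrightarrow> (\<forall>i<n. w i \<ge> -1) \<and>
     (\<forall>i<n. w i \<ge> 0 \<longrightarrow> (\<Sum>j<n. lam i j * of_int (w j)) = 0)"

definition generic :: "nat \<Rightarrow> (nat \<Rightarrow> nat \<Rightarrow> complex) \<Rightarrow> bool" where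
  "generic n lam \<longleftrightarrow> mat_rank n lam = n - 1 \<and>
     (\<forall>w. relevant n w \<and> hochschild_contrib n (EExp lam) w \<longrightarrow> poisson_contrib n lam w)"

definition Delta :: "nat \<Rightarrow> (nat \<Rightarrow> complex) set" where
  "Delta n = {z. (\<forall>k\<ge>n. z k = 0) \<and> (\<Sum>k<n. z k) = 0}"

definition matvec :: "nat \<Rightarrow> (nat \<Rightarrow> nat \<Rightarrow> complex) \<Rightarrow> (nat \<Rightarrow> complex) \<Rightarrow> nat \<Rightarrow> complex" where
  "matvec n A z = (\<lambda>i. if i < n then (\<Sum>j<n. A i j * z j) else 0)"

definition biresidue :: "nat \<Rightarrow> (nat \<Rightarrow> nat \<Rightarrow> complex) \<Rightarrow> nat \<Rightarrow> nat \<Rightarrow> complex" where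
  "biresidue n lam = (THE b. add_alt n b \<and> normalized n b \<and>
      (\<forall>i j. (n \<le> i \<or> n \<le> j) \<longrightarrow> b i j = 0) \<and>
      (\<forall>z\<in>Delta n. matvec n lam z \<in> Delta n \<and> matvec n b (matvec n lam z) = z))"

definition smoothable_edge :: "nat \<Rightarrow> (nat \<Rightarrow> nat \<Rightarrow> complex) \<Rightarrow> nat \<Rightarrow> nat \<Rightarrow> bool" where
  "smoothable_edge n b i j \<longleftrightarrow> i < n \<and> j < n \<and> i \<noteq> j \<and> b i j \<noteq> 0 \<and>
     (\<forall>k<n. k \<noteq> i \<and> k \<noteq> j \<longrightarrow> (\<exists>t::nat. (b j k + b k i) / b i j = of_nat t))"

definition smoothable_weight :: "nat \<Rightarrow> (nat \<Rightarrow> nat \<Rightarrow> complex) \<Rightarrow> nat \<Rightarrow> nat \<Rightarrow> nat \<Rightarrow> int" where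
  "smoothable_weight n b i j = (\<lambda>k. if k = i \<or> k = j then -1
      else if k < n then (THE t::int. of_int t = (b j k + b k i) / b i j) else 0)"

definition theta :: "nat \<Rightarrow> (nat \<Rightarrow> nat \<Rightarrow> complex) \<Rightarrow> nat \<Rightarrow> nat \<Rightarrow> int" where
  "theta n b i = smoothable_weight n b i (Suc i)"

definition Theta :: "nat \<Rightarrow> (nat \<Rightarrow> nat \<Rightarrow> complex) \<Rightarrow> nat set \<Rightarrow> nat \<Rightarrow> (nat \<Rightarrow> int) set" where
  "Theta n b I m = {w. \<exists>f. (\<forall>t<m. f t \<in> I) \<and> w = (\<lambda>k. \<Sum>t<m. theta n b (f t) k)}"

definition unitw :: "nat \<Rightarrow> nat \<Rightarrow> int" where
  "unitw a = (\<lambda>k. if k = a then 1 else 0)"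

definition relw :: "nat \<Rightarrow> nat \<Rightarrow> nat \<Rightarrow> nat \<Rightarrow> nat \<Rightarrow> int" where
  "relw a b k l = (\<lambda>j. - unitw a j - unitw b j + unitw k j + unitw l j)"

definition in_Theta_plus :: "nat \<Rightarrow> (nat \<Rightarrow> nat \<Rightarrow> complex) \<Rightarrow> nat set \<Rightarrow> nat \<Rightarrow> (nat \<Rightarrow> int) \<Rightarrow> bool" where
  "in_Theta_plus n b I m w \<longleftrightarrow> (\<exists>u\<in>Theta n b I m. \<forall>k<n. u k \<le> w k)"

text \<open>x_k lies in F_a (the filtration restricted to V* = span(x_0..x_{n-1}))\<close>
definition gen_in_F :: "nat \<Rightarrow> (nat \<Rightarrow> nat \<Rightarrow> complex) \<Rightarrow> nat set \<Rightarrow> nat \<Rightarrow> nat \<Rightarrow> bool" where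
  "gen_in_F n b I a k \<longleftrightarrow> (\<exists>m\<ge>a. in_Theta_plus n b I m (unitw k))"

text \<open>A noncommutative polynomial is a function from words (lists of generator indices) to
  coefficients; the free algebra is the set of finitely supported ones with letters < n.\<close>

definition ncR :: "nat \<Rightarrow> (nat list \<Rightarrow> 'a::zero) set" where
  "ncR n = {P. finite {w. P w \<noteq> 0} \<and> (\<forall>w. P w \<noteq> 0 \<longrightarrow> set w \<subseteq> {..<n})}"

definition ncmul :: "(nat list \<Rightarrow> 'a::comm_ring_1) \<Rightarrow> (nat list \<Rightarrow> 'a) \<Rightarrow> nat list \<Rightarrow> 'a" where
  "ncmul P Q = (\<lambda>w. \<Sum>i\<le>length w. P (take i w) * Q (drop i w))"

definition ncmon :: "nat list \<Rightarrow> 'a::zero \<Rightarrow> nat list \<Rightarrow> 'a" where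
  "ncmon w c = (\<lambda>v. if v = w then c else 0)"

inductive_set nc_ideal :: "nat \<Rightarrow> (nat list \<Rightarrow> 'a::comm_ring_1) set \<Rightarrow> (nat list \<Rightarrow> 'a) set"
  for n G where
  zero: "0 \<in> nc_ideal n G"
| gen: "g \<in> G \<Longrightarrow> x \<in> ncR n \<Longrightarrow> y \<in> ncR n \<Longrightarrow> ncmul (ncmul x g) y \<in> nc_ideal n G"
| add: "P \<in> nc_ideal n G \<Longrightarrow> Q \<in> nc_ideal n G \<Longrightarrow> P + Q \<in> nc_ideal n G"

definition qrel :: "(nat \<Rightarrow> nat \<Rightarrow> 'a::comm_ring_1) \<Rightarrow> nat \<Rightarrow> nat \<Rightarrow> nat list \<Rightarrow> 'a" where
  "qrel q i j = ncmon [i,j] 1 - ncmon [j,i] (q i j)"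

definition defrel :: "nat \<Rightarrow> (nat \<Rightarrow> nat \<Rightarrow> complex) \<Rightarrow> (nat \<Rightarrow> (nat \<Rightarrow> int) set) \<Rightarrow> nat
     \<Rightarrow> (nat \<Rightarrow> nat \<Rightarrow> nat \<Rightarrow> nat \<Rightarrow> complex) \<Rightarrow> nat \<Rightarrow> nat \<Rightarrow> nat list \<Rightarrow> complex poly" where
  "defrel n q Th N C a b = (\<lambda>w.
      (if w = [b,a] then -1 else 0) + (if w = [a,b] then [:q b a:] else 0) +
      (case w of [k,l] \<Rightarrow>
          (if k \<le> l \<and> l < n then
             (\<Sum>m\<in>{1..N}. if relw a b k l \<in> Th m then monom (C b a k l) m else 0)
           else 0)
        | _ \<Rightarrow> 0))"

definition defgens :: "nat \<Rightarrow> (nat \<Rightarrow> nat \<Rightarrow> complex) \<Rightarrow> (nat \<Rightarrow> (nat \<Rightarrow> int) set) \<Rightarrow> nat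
     \<Rightarrow> (nat \<Rightarrow> nat \<Rightarrow> nat \<Rightarrow> nat \<Rightarrow> complex) \<Rightarrow> (nat list \<Rightarrow> complex poly) set" where
  "defgens n q Th N C = {defrel n q Th N C a b | a b. a < b \<and> b < n}"

definition pscale :: "complex poly \<Rightarrow> (nat list \<Rightarrow> complex poly) \<Rightarrow> nat list \<Rightarrow> complex poly" where
  "pscale p P = (\<lambda>w. p * P w)"

definition free_quotient :: "nat \<Rightarrow> (nat list \<Rightarrow> complex poly) set \<Rightarrow> bool" where
  "free_quotient n J \<longleftrightarrow> (\<exists>B \<subseteq> ncR n.
     (\<forall>P\<in>ncR n. \<exists>c. finite {v\<in>B. c v \<noteq> 0} \<and>
          P - (\<Sum>v\<in>{v\<in>B. c v \<noteq> 0}. pscale (c v) v) \<in> J) \<and>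
     (\<forall>c. finite {v\<in>B. c v \<noteq> 0} \<and> (\<Sum>v\<in>{v\<in>B. c v \<noteq> 0}. pscale (c v) v) \<in> J
          \<longrightarrow> (\<forall>v\<in>B. c v = 0)))"

definition const_q :: "(nat \<Rightarrow> nat \<Rightarrow> complex) \<Rightarrow> nat \<Rightarrow> nat \<Rightarrow> complex poly" where
  "const_q q = (\<lambda>i j. [:q i j:])"

text \<open>Flat deformation of A_q: quotient free over C[eps], and reducing to A_q at eps = 0,
  i.e. J + (eps) = (relations of A_q) + (eps) as ideals of C<x>[eps].\<close>
definition flat_deformation :: "nat \<Rightarrow> (nat \<Rightarrow> nat \<Rightarrow> complex) \<Rightarrow> (nat list \<Rightarrow> complex poly) set \<Rightarrow> bool" where
  "flat_deformation n q G \<longleftrightarrow> G \<subseteq> ncR n \<and> free_quotient n (nc_ideal n G) \<and>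
     nc_ideal n (G \<union> {ncmon [] [:0,1:]}) =
     nc_ideal n ({qrel (const_q q) i j | i j. i < n \<and> j < n} \<union> {ncmon [] [:0,1:]})"

definition spec :: "complex \<Rightarrow> (nat list \<Rightarrow> complex poly) \<Rightarrow> nat list \<Rightarrow> complex" where
  "spec c P = (\<lambda>w. poly (P w) c)"

text \<open>Algebra endomorphism of C<x> induced by the linear map x_k |-> sum_j M j k x_j of V*.\<close>
definition ncsubst :: "nat \<Rightarrow> (nat \<Rightarrow> nat \<Rightarrow> complex) \<Rightarrow> (nat list \<Rightarrow> complex) \<Rightarrow> nat list \<Rightarrow> complex" where
  "ncsubst n M P = (\<lambda>v. \<Sum>w\<in>{w. P w \<noteq> 0}.
      if length v = length w then P w * (\<Prod>t<length w. M (v ! t) (w ! t)) else 0)"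

definition filtered_aut :: "nat \<Rightarrow> (nat \<Rightarrow> nat \<Rightarrow> complex) \<Rightarrow> nat set \<Rightarrow> (nat \<Rightarrow> nat \<Rightarrow> complex) \<Rightarrow> bool" where
  "filtered_aut n b I M \<longleftrightarrow>
     (\<forall>i j. (n \<le> i \<or> n \<le> j) \<longrightarrow> M i j = 0) \<and>
     (\<exists>M'. \<forall>i<n. \<forall>j<n. (\<Sum>k<n. M i k * M' k j) = (if i = j then 1 else 0)
                      \<and> (\<Sum>k<n. M' i k * M k j) = (if i = j then 1 else 0)) \<and>
     (\<forall>a k j. k < n \<and> j < n \<and> M j k \<noteq> 0 \<and> gen_in_F n b I a k \<longrightarrow> gen_in_F n b I a j)"

end

theory Submission
  imports Defs "HOL-Library.Poly_Mapping"
begin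

text \<open>The algebra is treated as a rewriting system \<open>x\<^sub>b x\<^sub>a \<rightarrow> q\<^sub>b\<^sub>a x\<^sub>a x\<^sub>b + \<dots>\<close> on words, where
  \<open>a < b\<close>. The weights \<open>\<theta>\<^sub>i\<close> are linearly independent: the functional \<open>B\<^sub>i \<Sum>\<^sub>j\<^sub>\<le>\<^sub>i \<lambda>\<^sub>j\<close>, with
  \<open>\<lambda>\<^sub>j\<close> the \<open>j\<close>-th row of \<open>\<lambda>\<close> and \<open>B\<^sub>i = b\<^sub>i\<^sub>,\<^sub>i\<^sub>+\<^sub>1\<close>, is 1 on \<open>\<theta>\<^sub>i\<close> and 0 on the
  other \<open>\<theta>\<^sub>k\<close>. Their sum is a level which every deformation term raises, so rewriting terminates, and by
  the diamond lemma the deformation is flat iff all overlaps \<open>x\<^sub>c x\<^sub>b x\<^sub>a\<close> resolve.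

  The constants \<open>C\<close> are found level by level. The overlaps at level \<open>m\<close> form a cocycle of weights in
  \<open>\<Theta>\<^sub>m\<close>. For \<open>m = 1\<close> it vanishes because \<open>\<theta>\<^sub>i\<close> is Poisson-contributing. For \<open>m \<ge> 2\<close> no weight
  in \<open>\<Theta>\<^sub>m\<close> with at most three entries \<open>-1\<close> is Poisson-contributing, hence by genericity none is
  Hochschild-contributing: there is an index \<open>d\<close> with \<open>w\<^sub>d \<ge> 0\<close> and \<open>\<Prod>\<^sub>j q\<^sub>d\<^sub>j^w\<^sub>j \<noteq> 1\<close>,
  and commutation with \<open>x\<^sub>d\<close> is a contracting homotopy in weight \<open>w\<close>. It kills the obstruction and, when no
  \<open>\<Theta>\<^sub>m\<close> contains some \<open>e\<^sub>a - e\<^sub>a\<^sub>'\<close>, it also shows that the level \<open>m\<close> constants are unique. Only finitely many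
  levels occur. As the \<open>\<theta>\<^sub>i\<close> are independent, the torus acts transitively on the nonzero \<open>\<gamma>\<close>
  and \<open>\<epsilon>\<close>.\<close>

section \<open>Noncommutative polynomials over the ring of the deformation parameter\<close>

text \<open>Normal forms follow one fixed strategy, reducing the rightmost descent, so that left
  multiplication is compatible with reduction before any confluence is known; only right
  multiplication needs the overlaps. The obstacle is that overlaps resolve only up to a power of
  \<epsilon> while the constants are being built, so the diamond lemma is proved modulo
  \<epsilon>^m. One more power is gained because every overlap is divisible by \<epsilon>: the
  coefficient at \<epsilon>^m then sees only the undeformed relations, where a word is a scalar
  times its sorted form, and the cocycle becomes a set of numerical equations. The homotopy letter
  \<open>d\<close> must depend on the weight alone, since each constant enters several overlaps.
  Only constants of pairs {a, b} without \<open>d\<close> are corrected; this settles the overlaps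
  containing \<open>d\<close>, and the four-letter cocycle settles the others. The bound three on
  the entries -1 reflects the three letters of an overlap. It suffices to build the constants for
  \<gamma> = 1, the torus supplying all other nonzero values.\<close>

text \<open>Words under concatenation, written additively as the convolution product of
  \<open>Poly_Mapping\<close> requires.\<close>

instantiation list :: (type) monoid_add
begin
definition "0 = []"
definition "xs + ys = xs @ ys"
instance by standard (simp_all add: zero_list_def plus_list_def)
end

type_synonym fpoly = "nat list \<Rightarrow>\<^sub>0 complex poly"

abbreviation coef :: "fpoly \<Rightarrow> nat list \<Rightarrow> complex poly" where
  "coef \<equiv> Poly_Mapping.lookup"

definition mon :: "nat list \<Rightarrow> fpoly" where
  "mon w = Poly_Mapping.single w 1"

definition sm :: "complex poly \<Rightarrow> fpoly \<Rightarrow> fpoly" (infixr "\<odot>" 75) where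
  "p \<odot> P = Poly_Mapping.single [] p * P"

lemma coef_sm [simp]: "coef (p \<odot> P) w = p * coef P w"
  unfolding sm_def zero_list_def [symmetric] mult_map_scale_conv_mult [symmetric]
  by (simp add: Poly_Mapping.map.rep_eq when_def)

lemma sm_zero_left [simp]: "0 \<odot> P = 0"
  and sm_zero_right [simp]: "p \<odot> 0 = 0"
  and sm_one [simp]: "1 \<odot> P = P"
  and sm_sm [simp]: "p \<odot> r \<odot> P = (p * r) \<odot> P"
  and sm_add_right: "p \<odot> (P + Q) = p \<odot> P + p \<odot> Q"
  and sm_diff_right: "p \<odot> (P - Q) = p \<odot> P - p \<odot> Q"
  and sm_minus_right: "p \<odot> (- P) = - (p \<odot> P)"
  and sm_add_left: "(p + r) \<odot> P = p \<odot> P + r \<odot> P"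
  and sm_diff_left: "(p - r) \<odot> P = p \<odot> P - r \<odot> P"
  and sm_minus_left: "(- p) \<odot> P = - (p \<odot> P)"
  by (auto intro!: poly_mapping_eqI simp: lookup_add lookup_minus algebra_simps)

lemma sm_sum: "p \<odot> (\<Sum>i\<in>A. f i) = (\<Sum>i\<in>A. p \<odot> f i)"
  by (induction A rule: infinite_finite_induct) (auto simp: sm_add_right)

lemma coef_mon: "coef (mon w) v = (if w = v then 1 else 0)"
  by (simp add: mon_def lookup_single when_def)

lemma sm_mon: "p \<odot> mon w = Poly_Mapping.single w p"
  by (rule poly_mapping_eqI) (auto simp: coef_mon lookup_single when_def)

lemma mon_mult [simp]: "mon u * mon v = mon (u @ v)"
  by (simp add: mon_def mult_single plus_list_def)

lemma mon_Nil [simp]: "mon [] = 1"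
  by (simp add: mon_def zero_list_def [symmetric])

lemma mon_mult_assoc [simp]: "mon u * (mon v * P) = mon (u @ v) * P"
  by (simp flip: mult.assoc)

lemma fpoly_expand:
  assumes "finite A" "Poly_Mapping.keys P \<subseteq> A"
  shows "P = (\<Sum>w\<in>A. coef P w \<odot> mon w)"
proof (rule poly_mapping_eqI)
  fix v
  have "coef (\<Sum>w\<in>A. coef P w \<odot> mon w) v = (\<Sum>w\<in>A. if w = v then coef P v else 0)"
    by (auto simp: lookup_sum coef_mon intro!: sum.cong)
  also have "\<dots> = coef P v"
    using assms by (auto simp: in_keys_iff)
  finally show "coef P v = coef (\<Sum>w\<in>A. coef P w \<odot> mon w) v" ..
qed

lemma fpoly_induct [case_names zero add mon]:
  assumes "\<Phi> 0" "\<And>P Q. \<Phi> P \<Longrightarrow> \<Phi> Q \<Longrightarrow> \<Phi> (P + Q)"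
    "\<And>p w. w \<in> Poly_Mapping.keys P \<Longrightarrow> \<Phi> (p \<odot> mon w)"
  shows "\<Phi> (P :: fpoly)"
proof -
  have "\<Phi> (\<Sum>w\<in>A. coef P w \<odot> mon w)" if "finite A" "A \<subseteq> Poly_Mapping.keys P" for A
    using that by (induction A rule: finite_induct) (auto intro: assms)
  from this [of "Poly_Mapping.keys P"] show ?thesis
    using fpoly_expand [of "Poly_Mapping.keys P" P] by simp
qed

lemma sm_mult_left [simp]: "(p \<odot> P) * Q = p \<odot> (P * Q)"
  by (simp add: sm_def mult.assoc)

text \<open>Constants are central although the algebra is not commutative, because the empty word
  commutes with every word.\<close>

lemma mult_sm_single: "Q * Poly_Mapping.single [] p = p \<odot> Q"
proof (induction Q rule: fpoly_induct)
  case (mon c w)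
  have "Poly_Mapping.single w c * Poly_Mapping.single [] p
      = Poly_Mapping.single [] p * Poly_Mapping.single w c"
    by (simp add: mult_single plus_list_def mult.commute)
  then show ?case by (simp add: sm_mon) (simp add: sm_def)
qed (auto simp: distrib_right sm_add_right)

lemma sm_mult_right [simp]: "Q * (p \<odot> P) = p \<odot> (Q * P)"
  using mult_sm_single [of Q p] by (simp add: sm_def flip: mult.assoc)

section \<open>Linear extension of maps defined on words\<close>

definition lin :: "(nat list \<Rightarrow> fpoly) \<Rightarrow> fpoly \<Rightarrow> fpoly" where
  "lin f P = (\<Sum>w\<in>Poly_Mapping.keys P. coef P w \<odot> f w)"

lemma lin_superset:
  assumes "finite A" "Poly_Mapping.keys P \<subseteq> A"
  shows "lin f P = (\<Sum>w\<in>A. coef P w \<odot> f w)"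
  unfolding lin_def using assms by (intro sum.mono_neutral_left) (auto simp: in_keys_iff)

lemma lin_zero [simp]: "lin f 0 = 0"
  by (simp add: lin_def)

lemma lin_add: "lin f (P + Q) = lin f P + lin f Q"
proof -
  let ?A = "Poly_Mapping.keys P \<union> Poly_Mapping.keys Q"
  have "Poly_Mapping.keys (P + Q) \<subseteq> ?A" by (rule Poly_Mapping.keys_add)
  then show ?thesis
    by (subst (1 2 3) lin_superset [of ?A]) (auto simp: lookup_add sm_add_left sum.distrib)
qed

lemma lin_sm: "lin f (p \<odot> P) = p \<odot> lin f P"
proof -
  have "Poly_Mapping.keys (p \<odot> P) \<subseteq> Poly_Mapping.keys P"
    by (auto simp: in_keys_iff)
  then show ?thesis
    by (subst (1 2) lin_superset [of "Poly_Mapping.keys P"]) (auto simp: sm_sum)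
qed

lemma lin_minus: "lin f (- P) = - lin f P"
  using lin_sm [of f "-1" P] by (simp add: sm_minus_left)

lemma lin_diff: "lin f (P - Q) = lin f P - lin f Q"
  using lin_add [of f P "- Q"] by (simp add: lin_minus)

lemma lin_sum: "lin f (\<Sum>i\<in>A. g i) = (\<Sum>i\<in>A. lin f (g i))"
  by (induction A rule: infinite_finite_induct) (auto simp: lin_add)

lemma lin_mon [simp]: "lin f (mon w) = f w"
  by (subst lin_superset [of "{w}"]) (auto simp: coef_mon mon_def)

lemma coef_lin: "coef (lin f P) v = (\<Sum>w\<in>Poly_Mapping.keys P. coef P w * coef (f w) v)"
  by (simp add: lin_def lookup_sum)

lemma keys_lin: "Poly_Mapping.keys (lin f P) \<subseteq> (\<Union>w\<in>Poly_Mapping.keys P. Poly_Mapping.keys (f w))"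
proof
  fix v assume "v \<in> Poly_Mapping.keys (lin f P)"
  then have "(\<Sum>w\<in>Poly_Mapping.keys P. coef P w * coef (f w) v) \<noteq> 0"
    by (simp add: in_keys_iff coef_lin)
  then obtain w where "w \<in> Poly_Mapping.keys P" "coef P w * coef (f w) v \<noteq> 0"
    by (rule sum.not_neutral_contains_not_neutral)
  then show "v \<in> (\<Union>w\<in>Poly_Mapping.keys P. Poly_Mapping.keys (f w))"
    by (auto simp: in_keys_iff)
qed

section \<open>The filtration by powers of the deformation parameter\<close>

definition epsI :: "nat \<Rightarrow> fpoly set" where
  "epsI m = {P. \<exists>Q. P = monom 1 m \<odot> Q}"

lemma epsI_sm_monom [intro]: "monom c m \<odot> P \<in> epsI m"
proof -
  have "monom c m = monom 1 m * monom c 0" by (simp only: mult_monom) simp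
  then have "monom c m \<odot> P = monom 1 m \<odot> (monom c 0 \<odot> P)" by (simp only: sm_sm)
  then show ?thesis unfolding epsI_def by blast
qed

lemma epsI_0 [simp]: "P \<in> epsI 0"
  unfolding epsI_def by (auto intro!: exI [of _ P])

lemma epsI_zero [simp, intro]: "0 \<in> epsI m"
  unfolding epsI_def by (auto intro: exI [of _ 0])

lemma epsI_add [intro]: "P \<in> epsI m \<Longrightarrow> Q \<in> epsI m \<Longrightarrow> P + Q \<in> epsI m"
  unfolding epsI_def by (auto simp: sm_add_right [symmetric])

lemma epsI_minus [intro]: "P \<in> epsI m \<Longrightarrow> - P \<in> epsI m"
  unfolding epsI_def by (auto simp: sm_minus_right [symmetric])

lemma epsI_diff [intro]: "P \<in> epsI m \<Longrightarrow> Q \<in> epsI m \<Longrightarrow> P - Q \<in> epsI m"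
  unfolding epsI_def by (auto simp: sm_diff_right [symmetric])

lemma epsI_mult_left [intro]: "P \<in> epsI m \<Longrightarrow> Q * P \<in> epsI m"
  unfolding epsI_def by auto

lemma epsI_mult_right [intro]: "P \<in> epsI m \<Longrightarrow> P * Q \<in> epsI m"
  unfolding epsI_def by auto

lemma epsI_sm [intro]: "P \<in> epsI m \<Longrightarrow> p \<odot> P \<in> epsI m"
  unfolding sm_def by (rule epsI_mult_left)

lemma epsI_sum: "(\<And>i. i \<in> A \<Longrightarrow> f i \<in> epsI m) \<Longrightarrow> (\<Sum>i\<in>A. f i) \<in> epsI m"
  by (induction A rule: infinite_finite_induct) auto

lemma epsI_sm_epsI:
  assumes "P \<in> epsI m"
  shows "monom c k \<odot> P \<in> epsI (k + m)"
proof -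
  obtain Q where Q: "P = monom 1 m \<odot> Q" using assms unfolding epsI_def by auto
  have "monom c k \<odot> P = monom c (k + m) \<odot> Q" by (simp add: mult_monom Q)
  then show ?thesis by (simp only: epsI_sm_monom)
qed

lemma epsI_lin: "P \<in> epsI m \<Longrightarrow> lin f P \<in> epsI m"
  unfolding epsI_def by (auto simp: lin_sm)

lemma epsI_lin': "(\<And>w. w \<in> Poly_Mapping.keys P \<Longrightarrow> f w \<in> epsI m) \<Longrightarrow> lin f P \<in> epsI m"
  unfolding lin_def by (intro epsI_sum epsI_sm)

lemma epsI_lin_Suc:
  assumes P: "P \<in> epsI k" and f: "\<And>w. f w \<in> epsI m"
  shows "lin f P \<in> epsI (k + m)"
proof -
  obtain Q where "P = monom 1 k \<odot> Q" using P unfolding epsI_def by auto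
  then show ?thesis by (auto simp: lin_sm intro!: epsI_sm_epsI epsI_lin' f)
qed

lemma epsI_iff: "P \<in> epsI m \<longleftrightarrow> (\<forall>w. \<forall>j<m. poly.coeff (coef P w) j = 0)"
proof
  assume "P \<in> epsI m"
  then show "\<forall>w. \<forall>j<m. poly.coeff (coef P w) j = 0"
    unfolding epsI_def by (auto simp: coeff_monom_mult)
next
  assume *: "\<forall>w. \<forall>j<m. poly.coeff (coef P w) j = 0"
  have shift: "monom 1 m * poly_shift m p = p" if "\<forall>j<m. poly.coeff p j = 0" for p :: "complex poly"
    using that by (intro poly_eqI) (auto simp: coeff_monom_mult coeff_poly_shift)
  have "P = (\<Sum>w\<in>Poly_Mapping.keys P. coef P w \<odot> mon w)"
    by (rule fpoly_expand) auto
  also have "\<dots> \<in> epsI m"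
  proof (rule epsI_sum)
    fix w
    have "coef P w \<odot> mon w = monom 1 m \<odot> (poly_shift m (coef P w) \<odot> mon w)"
      using * shift [of "coef P w"] by (simp only: sm_sm) simp
    then show "coef P w \<odot> mon w \<in> epsI m" unfolding epsI_def by blast
  qed
  finally show "P \<in> epsI m" .
qed

text \<open>The filtration is separated: a nonzero polynomial coefficient has a lowest term.
  Identities proved modulo every power thus become exact.\<close>

lemma epsI_all_zero: "(\<And>m. P \<in> epsI m) \<Longrightarrow> P = 0"
  by (intro poly_mapping_eqI poly_eqI) (auto simp: epsI_iff)

lemma epsI_coeff_cong:
  "P - Q \<in> epsI (Suc m) \<Longrightarrow> poly.coeff (coef P w) m = poly.coeff (coef Q w) m"
  by (auto simp: epsI_iff lookup_minus)

text \<open>Selects the rightmost descent, so that the part behind it is sorted and a longer prefix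
  never changes the choice.\<close>

fun rdesc :: "nat list \<Rightarrow> (nat list \<times> nat \<times> nat \<times> nat list) option" where
  "rdesc [] = None"
| "rdesc (x # w) = (case rdesc w of
      Some (u, b, a, v) \<Rightarrow> Some (x # u, b, a, v)
    | None \<Rightarrow> (case w of [] \<Rightarrow> None | y # v \<Rightarrow> if y < x then Some ([], x, y, v) else None))"

lemma rdesc_None_iff: "rdesc w = None \<longleftrightarrow> sorted w"
proof (induction w)
  case (Cons x w)
  show ?case
  proof (cases "rdesc w")
    case None
    with Cons have "sorted w" by simp
    with None show ?thesis by (cases w) (auto simp: not_less intro: order_trans)
  next
    case (Some d)
    with Cons have "\<not> sorted w" by simp
    with Some show ?thesis by (cases d) auto
  qed
qed simp

lemma rdesc_SomeD:
  "rdesc w = Some (u, b, a, v) \<Longrightarrow> w = u @ b # a # v \<and> a < b \<and> sorted (a # v)"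
proof (induction w arbitrary: u)
  case (Cons x w)
  show ?case
  proof (cases "rdesc w")
    case None
    then have "sorted w" by (simp add: rdesc_None_iff)
    with None Cons.prems show ?thesis by (cases w) (auto split: if_splits)
  next
    case (Some d)
    with Cons show ?thesis by (cases d) auto
  qed
qed simp

lemma rdesc_append:
  "rdesc w = Some (u', b, a, v) \<Longrightarrow> rdesc (u @ w) = Some (u @ u', b, a, v)"
  by (induction u) auto

lemma rdesc_eq:
  assumes "a < b" "sorted (a # v)"
  shows "rdesc (u @ b # a # v) = Some (u, b, a, v)"
proof -
  have "rdesc (a # v) = None" using assms(2) by (simp only: rdesc_None_iff)
  then have "rdesc (b # a # v) = Some ([], b, a, v)"
    using assms(1) by (simp del: rdesc.simps(2) add: rdesc.simps(2) [of b])
  from rdesc_append [OF this, of u] show ?thesis by simp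
qed

section \<open>Reduction of words and the diamond lemma\<close>

text \<open>Not a numeral system, as letters may exceed 1: only the doubling of place values
  matters, which makes \<open>[b, a]\<close> heavier than \<open>[a, b]\<close> when
  \<open>a < b\<close>.\<close>

fun val :: "nat list \<Rightarrow> nat" where
  "val [] = 0"
| "val (x # w) = x * 2 ^ length w + val w"

lemma val_append: "val (u @ w) = val u * 2 ^ length w + val w"
  by (induction u) (auto simp: power_add algebra_simps)

text \<open>Deformation terms raise \<open>\<phi>\<close>; the swap of a descent keeps \<open>\<phi>\<close> and lowers \<open>val\<close>.\<close>

definition prec :: "(nat \<Rightarrow> real) \<Rightarrow> nat list \<Rightarrow> nat list \<Rightarrow> bool" where
  "prec \<phi> w' w \<longleftrightarrow> length w' = length w \<and>
     (sum_list (map \<phi> w') > sum_list (map \<phi> w) \<or>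
      sum_list (map \<phi> w') = sum_list (map \<phi> w) \<and> val w' < val w)"

lemma prec_trans: "prec \<phi> x y \<Longrightarrow> prec \<phi> y z \<Longrightarrow> prec \<phi> x z"
  by (auto simp: prec_def)

lemma prec_irrefl: "\<not> prec \<phi> x x"
  by (auto simp: prec_def)

lemma prec_context: "prec \<phi> w' w \<Longrightarrow> prec \<phi> (u @ w' @ v) (u @ w @ v)"
  by (auto simp: prec_def val_append)

lemma prec_length: "prec \<phi> w' w \<Longrightarrow> length w' = length w"
  by (simp add: prec_def)

text \<open>The order \<open>prec\<close> compares real numbers; counting the finitely many words of
  the same length below \<open>w\<close> yields a natural number for termination and
  induction.\<close>

definition meas :: "nat \<Rightarrow> (nat \<Rightarrow> real) \<Rightarrow> nat list \<Rightarrow> nat" where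
  "meas n \<phi> w = card {w'. set w' \<subseteq> {..<n} \<and> prec \<phi> w' w}"

lemma meas_less:
  assumes "set w' \<subseteq> {..<n}" "prec \<phi> w' w"
  shows "meas n \<phi> w' < meas n \<phi> w"
  unfolding meas_def
proof (rule psubset_card_mono)
  have "{x. set x \<subseteq> {..<n} \<and> prec \<phi> x w} \<subseteq> {x. set x \<subseteq> {..<n} \<and> length x = length w}"
    by (auto simp: prec_def)
  then show "finite {x. set x \<subseteq> {..<n} \<and> prec \<phi> x w}"
    by (rule finite_subset) (rule finite_lists_length_eq, simp)
  show "{x. set x \<subseteq> {..<n} \<and> prec \<phi> x w'} \<subset> {x. set x \<subseteq> {..<n} \<and> prec \<phi> x w}"
    using assms prec_trans prec_irrefl by blast
qed

text \<open>The rules are kept abstract so that truncations, corrections and rescalings of one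
  deformation are instances that can be compared. Each deformation term is a sorted word of higher
  \<open>\<phi>\<close>, with a coefficient divisible by \<epsilon>.\<close>

locale reduction_system =
  fixes n :: nat and \<phi> :: "nat \<Rightarrow> real" and q :: "nat \<Rightarrow> nat \<Rightarrow> complex"
    and G :: "nat \<Rightarrow> nat \<Rightarrow> nat \<Rightarrow> nat \<Rightarrow> complex poly"
  assumes q_inv: "i < n \<Longrightarrow> j < n \<Longrightarrow> q i j * q j i = 1"
    and q_refl: "i < n \<Longrightarrow> q i i = 1"
    and G_supp: "a < b \<Longrightarrow> b < n \<Longrightarrow> G b a k l \<noteq> 0 \<Longrightarrow> k \<le> l \<and> l < n \<and> \<phi> k + \<phi> l > \<phi> a + \<phi> b"
    and G_eps: "a < b \<Longrightarrow> b < n \<Longrightarrow> poly.coeff (G b a k l) 0 = 0"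
begin

definition F :: "nat \<Rightarrow> nat \<Rightarrow> nat \<Rightarrow> nat \<Rightarrow> complex poly" where
  "F b a k l = (if k = a \<and> l = b then [:q b a:] else 0) + G b a k l"

lemma prec_F:
  assumes "a < b" "b < n" "F b a k l \<noteq> 0"
  shows "prec \<phi> (u @ [k, l] @ v) (u @ [b, a] @ v)"
proof (rule prec_context)
  show "prec \<phi> [k, l] [b, a]"
    using assms G_supp [of a b k l] by (auto simp: F_def prec_def split: if_splits)
qed

text \<open>The test \<open>F b a k l = 0\<close> confines the recursive calls to smaller words;
  words with a letter out of range are sent to 0 to make the function total.\<close>

function nf :: "nat list \<Rightarrow> fpoly" where
  "nf w = (if \<not> set w \<subseteq> {..<n} then 0 else
     case rdesc w of None \<Rightarrow> mon w
     | Some (u, b, a, v) \<Rightarrow> (\<Sum>k<n. \<Sum>l<n.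
          if F b a k l = 0 then 0 else F b a k l \<odot> nf (u @ [k, l] @ v)))"
  by pat_completeness auto
termination
proof (relation "measure (meas n \<phi>)", simp)
  fix w :: "nat list" and d u d1 b d2 a v k l
  assume w: "\<not> \<not> set w \<subseteq> {..<n}" and r: "rdesc w = Some d" "(u, d1) = d" "(b, d2) = d1" "(a, v) = d2"
    and kl: "k \<in> {..<n}" "l \<in> {..<n}" "F b a k l \<noteq> 0"
  have "w = u @ [b, a] @ v" "a < b"
    using rdesc_SomeD [of w u b a v] r by auto
  moreover from this w have "b < n" by auto
  ultimately have "prec \<phi> (u @ [k, l] @ v) w" using prec_F kl by simp
  moreover have "set (u @ [k, l] @ v) \<subseteq> {..<n}" using \<open>w = _\<close> w kl by auto
  ultimately show "(u @ [k, l] @ v, w) \<in> measure (meas n \<phi>)"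
    using meas_less by simp
qed

declare nf.simps [simp del]

lemma nf_sorted: "set w \<subseteq> {..<n} \<Longrightarrow> sorted w \<Longrightarrow> nf w = mon w"
  using rdesc_None_iff [of w] by (simp add: nf.simps)

lemma nf_outside: "\<not> set w \<subseteq> {..<n} \<Longrightarrow> nf w = 0"
  by (simp add: nf.simps)

lemma nf_step:
  assumes "set w \<subseteq> {..<n}" "rdesc w = Some (u, b, a, v)"
  shows "nf w = (\<Sum>k<n. \<Sum>l<n. F b a k l \<odot> nf (u @ [k, l] @ v))"
  using assms by (subst nf.simps) (auto intro!: sum.cong)

lemma nf_step':
  assumes "set (u @ b # a # v) \<subseteq> {..<n}" "a < b" "sorted (a # v)"
  shows "nf (u @ b # a # v) = (\<Sum>k<n. \<Sum>l<n. F b a k l \<odot> nf (u @ [k, l] @ v))"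
  using assms by (intro nf_step rdesc_eq)

definition Phi :: "fpoly \<Rightarrow> fpoly" where
  "Phi = lin nf"

lemmas Phi_linear = lin_add [of nf, folded Phi_def] lin_diff [of nf, folded Phi_def]
  lin_minus [of nf, folded Phi_def] lin_sm [of nf, folded Phi_def] lin_zero [of nf, folded Phi_def]

lemma Phi_sum: "Phi (\<Sum>i\<in>A. g i) = (\<Sum>i\<in>A. Phi (g i))"
  by (simp add: Phi_def lin_sum)

lemma Phi_mon [simp]: "Phi (mon w) = nf w"
  by (simp add: Phi_def)

text \<open>Follows the strategy of \<open>nf\<close>: the step case sees only the descent actually
  chosen, and the induction hypothesis only words with a nonzero coefficient.\<close>

lemma reduction_induct [consumes 1, case_names sorted step]:
  assumes "set w \<subseteq> {..<n}"
    and "\<And>w. set w \<subseteq> {..<n} \<Longrightarrow> sorted w \<Longrightarrow> P w"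
    and "\<And>u b a v. set (u @ b # a # v) \<subseteq> {..<n} \<Longrightarrow> a < b \<Longrightarrow> sorted (a # v) \<Longrightarrow>
       (\<And>k l. F b a k l \<noteq> 0 \<Longrightarrow> k < n \<Longrightarrow> l < n \<Longrightarrow> prec \<phi> (u @ [k, l] @ v) (u @ b # a # v)
          \<Longrightarrow> P (u @ [k, l] @ v)) \<Longrightarrow> P (u @ b # a # v)"
  shows "P w"
  using assms(1)
proof (induction w rule: measure_induct_rule [of "meas n \<phi>"])
  case (less w)
  show ?case
  proof (cases "rdesc w")
    case None
    with less.prems assms(2) show ?thesis by (simp add: rdesc_None_iff)
  next
    case (Some d)
    then obtain u b a v where "rdesc w = Some (u, b, a, v)" by (cases d) auto
    then have w: "w = u @ b # a # v" and ab: "a < b" "sorted (a # v)"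
      using rdesc_SomeD by auto
    show ?thesis unfolding w
    proof (rule assms(3))
      show "set (u @ b # a # v) \<subseteq> {..<n}" using less.prems w by simp
      fix k l assume kl: "F b a k l \<noteq> 0" "k < n" "l < n" "prec \<phi> (u @ [k, l] @ v) (u @ b # a # v)"
      then show "P (u @ [k, l] @ v)"
        using less.prems w by (intro less.IH meas_less) auto
    qed (fact ab)+
  qed
qed

lemma nf_keys:
  assumes "set w \<subseteq> {..<n}" "v \<in> Poly_Mapping.keys (nf w)"
  shows "set v \<subseteq> {..<n}" "sorted v" "v = w \<or> prec \<phi> v w"
proof -
  have "set v \<subseteq> {..<n} \<and> sorted v \<and> (v = w \<or> prec \<phi> v w)"
    using assms
  proof (induction w rule: reduction_induct)
    case (sorted w)
    then show ?case by (simp add: nf_sorted mon_def)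
  next
    case (step u b a z)
    have "coef (nf (u @ b # a # z)) v \<noteq> 0" using step.prems by (simp add: in_keys_iff)
    then have "(\<Sum>k<n. \<Sum>l<n. F b a k l * coef (nf (u @ [k, l] @ z)) v) \<noteq> 0"
      using step.hyps by (simp add: nf_step' lookup_sum)
    then obtain k where k: "k < n" "(\<Sum>l<n. F b a k l * coef (nf (u @ [k, l] @ z)) v) \<noteq> 0"
      by (metis (no_types, lifting) lessThan_iff sum.not_neutral_contains_not_neutral)
    then obtain l where l: "l < n" "F b a k l * coef (nf (u @ [k, l] @ z)) v \<noteq> 0"
      by (metis (no_types, lifting) lessThan_iff sum.not_neutral_contains_not_neutral)
    have p: "prec \<phi> (u @ [k, l] @ z) (u @ b # a # z)"
      using prec_F [of a b k l u z] l step.hyps by simp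
    then show ?case
      using step.IH [of k l] k l prec_trans by (auto simp: in_keys_iff)
  qed
  then show "set v \<subseteq> {..<n}" "sorted v" "v = w \<or> prec \<phi> v w" by auto
qed

text \<open>Holds without confluence: the strategy exhausts the descents inside \<open>w\<close>
  before touching \<open>u\<close>, so reducing \<open>w\<close> in advance replays the same
  steps.\<close>

lemma nf_append: "Phi (mon u * nf w) = nf (u @ w)"
proof (cases "set w \<subseteq> {..<n}")
  case True
  then show ?thesis
  proof (induction w rule: reduction_induct)
    case (sorted w)
    then show ?case by (simp add: nf_sorted)
  next
    case (step u' b a v)
    show ?case
    proof (cases "set u \<subseteq> {..<n}")
      case True
      have "F b a k l \<odot> Phi (mon u * nf (u' @ [k, l] @ v)) = F b a k l \<odot> nf ((u @ u') @ [k, l] @ v)"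
        if "k < n" "l < n" for k l
        using step.IH [of k l] that prec_F [of a b k l u' v] step.hyps by (cases "F b a k l = 0") auto
      moreover have "set ((u @ u') @ b # a # v) \<subseteq> {..<n}" using True step.hyps by auto
      note nf_step' [OF this step.hyps(2,3)]
      ultimately show ?thesis
        using step.hyps by (simp add: nf_step' Phi_sum Phi_linear sum_distrib_left)
    next
      case False
      \<comment> \<open>A letter of \<open>u\<close> out of range survives in every product, so all
        terms are sent to 0.\<close>
      have "lin nf (mon u * P) = 0" for P
      proof (induction P rule: fpoly_induct)
        case (mon p w)
        then show ?case using False by (simp add: lin_sm nf_outside)
      qed (auto simp: distrib_left lin_add)
      then show ?thesis using False by (simp add: Phi_def nf_outside)
    qed
  qed
qed (auto simp: nf_outside Phi_linear)

text \<open>Hence the kernel of \<open>Phi\<close> is a left ideal; whether it absorbs right factors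
  is what the overlaps decide.\<close>

lemma Phi_mult_Phi: "Phi (P * Phi Q) = Phi (P * Q)"
proof (induction P rule: fpoly_induct)
  case (mon p u)
  show ?case
  proof (induction Q rule: fpoly_induct)
    case (mon r w)
    then show ?case by (simp add: Phi_linear nf_append)
  qed (auto simp: Phi_linear distrib_left sm_add_right)
qed (auto simp: Phi_linear distrib_right)

definition g :: "nat \<Rightarrow> nat \<Rightarrow> fpoly" where
  "g b a = (\<Sum>k<n. \<Sum>l<n. G b a k l \<odot> mon [k, l])"

definition rel :: "nat \<Rightarrow> nat \<Rightarrow> fpoly" where
  "rel b a = - mon [b, a] + [:q b a:] \<odot> mon [a, b] + g b a"

lemma sum_F:
  assumes "a < n" "b < n"
  shows "(\<Sum>k<n. \<Sum>l<n. F b a k l \<odot> f k l) = [:q b a:] \<odot> f a b + (\<Sum>k<n. \<Sum>l<n. G b a k l \<odot> f k l)"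
proof -
  have "(\<Sum>k<n. \<Sum>l<n. F b a k l \<odot> f k l)
      = (\<Sum>k<n. \<Sum>l<n. (if k = a \<and> l = b then [:q b a:] else 0) \<odot> f k l)
        + (\<Sum>k<n. \<Sum>l<n. G b a k l \<odot> f k l)"
    by (simp add: F_def sm_add_left sum.distrib)
  also have "(\<Sum>k<n. \<Sum>l<n. (if k = a \<and> l = b then [:q b a:] else 0) \<odot> f k l)
      = (\<Sum>k<n. if k = a then (\<Sum>l<n. if l = b then [:q b a:] \<odot> f k l else 0) else 0)"
    by (intro sum.cong refl) (simp add: if_distrib [of "\<lambda>p. p \<odot> _"] if_distrib [of "sum _"] cong: if_cong)
  also have "\<dots> = [:q b a:] \<odot> f a b" using assms by simp
  finally show ?thesis .
qed

lemma rel_altdef: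
  "a < n \<Longrightarrow> b < n \<Longrightarrow> rel b a = - mon [b, a] + (\<Sum>k<n. \<Sum>l<n. F b a k l \<odot> mon [k, l])"
  by (simp add: sum_F rel_def g_def)

lemma Phi_rel_mult:
  assumes "a < n" "b < n"
  shows "Phi (mon u * rel b a * mon v) = - nf (u @ b # a # v) + (\<Sum>k<n. \<Sum>l<n. F b a k l \<odot> nf (u @ [k, l] @ v))"
  using assms
  by (simp add: rel_altdef Phi_linear Phi_sum algebra_simps sum_distrib_left sum_distrib_right)

text \<open>The front descent is the one chosen by the strategy, so \<open>nf\<close> itself applies
  the relation and no overlap is involved.\<close>

lemma Phi_rel_eq_0:
  assumes "set (b # a # v) \<subseteq> {..<n}" "a < b" "sorted (a # v)"
  shows "Phi (rel b a * mon v) = 0"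
  using Phi_rel_mult [of a b "[]" v] nf_step' [of "[]" b a v] assms by simp

text \<open>The two ways to resolve \<open>c b a\<close>, of which only the deformation terms are left since the
  undeformed relations are confluent.\<close>

definition overlap :: "nat \<Rightarrow> nat \<Rightarrow> nat \<Rightarrow> fpoly" where
  "overlap c b a = mon [c] * g b a - [:q c b * q c a:] \<odot> (g b a * mon [c])
     - [:q c b:] \<odot> (mon [b] * g c a) + [:q b a:] \<odot> (g c a * mon [b])
     + [:q b a * q c a:] \<odot> (mon [a] * g c b) - g c b * mon [a]"

lemma overlap_eq_rel:
  "overlap c b a = mon [c] * rel b a - [:q c b * q c a:] \<odot> (rel b a * mon [c])
     - [:q c b:] \<odot> (mon [b] * rel c a) + [:q b a:] \<odot> (rel c a * mon [b])
     + [:q b a * q c a:] \<odot> (mon [a] * rel c b) - rel c b * mon [a]"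
  by (simp add: overlap_def rel_def distrib_left distrib_right sm_add_right sm_minus_right sm_diff_right algebra_simps)

end

lemma keys_sm: "Poly_Mapping.keys (p \<odot> P) \<subseteq> Poly_Mapping.keys P"
  by (auto simp: in_keys_iff)

lemma keys_mon [simp]: "Poly_Mapping.keys (mon w) = {w}"
  by (simp add: mon_def)

lemma keys_mon_mult: "Poly_Mapping.keys (mon u * P) \<subseteq> (@) u ` Poly_Mapping.keys P"
  using keys_mult [of "mon u" P] by (auto simp: plus_list_def)

lemma keys_mult_mon: "Poly_Mapping.keys (P * mon u) \<subseteq> (\<lambda>w. w @ u) ` Poly_Mapping.keys P"
  using keys_mult [of P "mon u"] by (auto simp: plus_list_def)

lemma coeff_mult_lowest:
  fixes p r :: "complex poly"
  assumes "\<And>j. j < m \<Longrightarrow> poly.coeff p j = 0"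
  shows "poly.coeff (p * r) m = poly.coeff p m * poly.coeff r 0"
proof -
  have "poly.coeff (p * r) m = (\<Sum>i\<le>m. poly.coeff p i * poly.coeff r (m - i))"
    by (rule coeff_mult)
  also have "\<dots> = (\<Sum>i\<in>{m}. poly.coeff p i * poly.coeff r (m - i))"
    using assms by (intro sum.mono_neutral_right) auto
  finally show ?thesis by simp
qed

lemma sort_snoc_eq_iff:
  assumes "sorted w" "sorted t"
  shows "sort (w @ [x]) = t \<longleftrightarrow> x \<in> set t \<and> w = remove1 x t"
proof
  assume *: "sort (w @ [x]) = t"
  then have m: "mset t = add_mset x (mset w)" by auto
  then have x: "x \<in> set t" by (metis set_mset_mset union_single_eq_member)
  from m have "mset (remove1 x t) = mset w" by simp
  moreover have "sorted (remove1 x t)" using assms by (simp add: sorted_remove1)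
  ultimately show "x \<in> set t \<and> w = remove1 x t"
    using assms x by (metis properties_for_sort sorted_sort_id)
next
  assume *: "x \<in> set t \<and> w = remove1 x t"
  then have "mset t = mset (w @ [x])" by simp
  then show "sort (w @ [x]) = t" using assms by (metis properties_for_sort)
qed

context reduction_system
begin

text \<open>Words of smaller length count as lower, because splitting off a prefix leaves a relation
  in front of a shorter tail.\<close>

definition below :: "nat list \<Rightarrow> nat list \<Rightarrow> bool" where
  "below w' w \<longleftrightarrow> length w' < length w \<or> prec \<phi> w' w"

lemma below_trans: "below x y \<Longrightarrow> below y z \<Longrightarrow> below x z"
  unfolding below_def using prec_trans prec_length by (metis order.strict_trans)

lemma Phi_mult_epsI:
  assumes "\<And>t. t \<in> Poly_Mapping.keys P \<Longrightarrow> Phi (A * mon t) \<in> epsI m"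
  shows "Phi (A * P) \<in> epsI m"
  using assms
proof -
  have "Phi (A * P) = (\<Sum>w\<in>Poly_Mapping.keys P. coef P w \<odot> Phi (A * mon w))"
    by (subst (1) fpoly_expand [of "Poly_Mapping.keys P" P])
      (auto simp: sum_distrib_left Phi_sum Phi_linear)
  then show ?thesis using assms by (auto intro!: epsI_sum)
qed

lemma Phi_mult_epsI':
  assumes "\<And>t. t \<in> Poly_Mapping.keys P \<Longrightarrow> Phi (mon t * A) - Phi (nf t * A) \<in> epsI m"
  shows "Phi (P * A) - Phi (Phi P * A) \<in> epsI m"
  using assms
proof -
  have "Phi (P * A) = (\<Sum>w\<in>Poly_Mapping.keys P. coef P w \<odot> Phi (mon w * A))"
    by (subst (1) fpoly_expand [of "Poly_Mapping.keys P" P])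
      (auto simp: sum_distrib_right Phi_sum Phi_linear)
  moreover have "Phi (Phi P * A) = (\<Sum>w\<in>Poly_Mapping.keys P. coef P w \<odot> Phi (nf w * A))"
    by (subst (2) Phi_def) (auto simp: lin_def sum_distrib_right Phi_sum Phi_linear)
  ultimately have "Phi (P * A) - Phi (Phi P * A)
      = (\<Sum>w\<in>Poly_Mapping.keys P. coef P w \<odot> (Phi (mon w * A) - Phi (nf w * A)))"
    by (simp add: sm_diff_right sum_subtractf)
  then show ?thesis using assms by (auto intro!: epsI_sum)
qed

lemma Phi_epsI: "P \<in> epsI m \<Longrightarrow> Phi P \<in> epsI m"
  by (simp add: Phi_def epsI_lin)

lemma Phi_rel_nf:
  assumes "\<And>t. sorted t \<Longrightarrow> set t \<subseteq> {..<n} \<Longrightarrow> t = v \<or> prec \<phi> t v \<Longrightarrow> Phi (rel b a * mon t) \<in> epsI m"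
    and v: "set v \<subseteq> {..<n}"
  shows "Phi (rel b a * mon v) \<in> epsI m"
proof -
  have "Phi (rel b a * nf v) \<in> epsI m"
    by (rule Phi_mult_epsI) (use assms nf_keys [OF v] in blast)
  then show ?thesis using Phi_mult_Phi [of "rel b a" "mon v"] by simp
qed

text \<open>Reducing a left factor first may apply a relation in front of an unsorted tail. The
  bound \<open>top_w\<close> records that only relations below it are used, so the lemma can serve
  inside the induction that proves them.\<close>

lemma Phi_nf_left:
  assumes H: "\<And>b a t. a < b \<Longrightarrow> set (b # a # t) \<subseteq> {..<n} \<Longrightarrow> sorted t \<Longrightarrow>
       below (b # a # t) top_w \<Longrightarrow> Phi (rel b a * mon t) \<in> epsI m"
    and "set y \<subseteq> {..<n}" "set z \<subseteq> {..<n}" "below (y @ z) top_w"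
  shows "Phi (mon y * mon z) - Phi (nf y * mon z) \<in> epsI m"
  using assms(2-4)
proof (induction y rule: reduction_induct)
  case (sorted y)
  then show ?case by (simp add: nf_sorted)
next
  case (step u b a v)
  have ab: "a < n" "b < n" using step.hyps by auto
  have bel: "below (b # a # t) top_w" if "t = v @ z \<or> prec \<phi> t (v @ z)" for t
  proof -
    \<comment> \<open>The order goes down, or stays, in three moves: normalizing the tail, dropping
      the prefix \<open>u\<close>, and the bound on the whole word.\<close>
    have 1: "b # a # t = b # a # v @ z \<or> below (b # a # t) (b # a # v @ z)"
      using that prec_context [of \<phi> t "v @ z" "[b, a]" "[]"] by (auto simp: below_def)
    have 2: "b # a # v @ z = u @ b # a # v @ z \<or> below (b # a # v @ z) (u @ b # a # v @ z)"
      by (cases u) (auto simp: below_def)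
    have 3: "below (u @ b # a # v @ z) top_w" using step.prems by simp
    show ?thesis using 1 2 3 below_trans by metis
  qed
  have "Phi (rel b a * mon (v @ z)) \<in> epsI m"
    by (rule Phi_rel_nf) (use step H bel in auto)
  then have "Phi (mon u * (rel b a * mon (v @ z))) \<in> epsI m"
    using Phi_mult_Phi [of "mon u" "rel b a * mon (v @ z)"]
    by (metis Phi_epsI epsI_mult_left)
  then have r: "Phi (mon u * rel b a * mon (v @ z)) \<in> epsI m" by (simp only: mult.assoc)
  have d: "F b a k l \<odot> (nf (u @ [k, l] @ v @ z) - Phi (nf (u @ [k, l] @ v) * mon z)) \<in> epsI m"
    if "k < n" "l < n" for k l
  proof (cases "F b a k l = 0")
    case False
    have p: "prec \<phi> (u @ [k, l] @ v) (u @ b # a # v)"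
      using prec_F [of a b k l u v] False step.hyps ab by simp
    then have "below ((u @ [k, l] @ v) @ z) ((u @ b # a # v) @ z)"
      using prec_context [of \<phi> "u @ [k, l] @ v" "u @ b # a # v" "[]" z] by (simp add: below_def)
    with step.IH [of k l] False that p step.prems below_trans show ?thesis by auto
  qed auto
  have "Phi (mon (u @ b # a # v) * mon z) - Phi (nf (u @ b # a # v) * mon z)
     = - Phi (mon u * rel b a * mon (v @ z)) +
       (\<Sum>k<n. \<Sum>l<n. F b a k l \<odot> (nf (u @ [k, l] @ v @ z) - Phi (nf (u @ [k, l] @ v) * mon z)))"
    using step.hyps ab
    by (simp add: nf_step' Phi_rel_mult Phi_sum Phi_linear sum_distrib_right sm_diff_right sum_subtractf)
  also have "\<dots> \<in> epsI m"
    using r d by (intro epsI_add epsI_minus epsI_sum) auto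
  finally show ?case .
qed

lemma keys_g:
  assumes "y \<in> Poly_Mapping.keys (g b a)"
  obtains k l where "y = [k, l]" "k < n" "l < n" "G b a k l \<noteq> 0"
proof -
  have "coef (g b a) y \<noteq> 0" using assms by (simp add: in_keys_iff)
  then have "(\<Sum>k<n. \<Sum>l<n. G b a k l * coef (mon [k, l]) y) \<noteq> 0"
    by (simp add: g_def lookup_sum)
  then obtain k where k: "k < n" "(\<Sum>l<n. G b a k l * coef (mon [k, l]) y) \<noteq> 0"
    by (metis (no_types, lifting) lessThan_iff sum.not_neutral_contains_not_neutral)
  then obtain l where l: "l < n" "G b a k l * coef (mon [k, l]) y \<noteq> 0"
    by (metis (no_types, lifting) lessThan_iff sum.not_neutral_contains_not_neutral)
  with k that show thesis by (auto simp: coef_mon split: if_splits)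
qed

text \<open>Each of the six products contains one factor \<open>g\<close>, which raises
  \<open>\<phi>\<close>; the words therefore precede \<open>[c, b, a]\<close> whatever the
  arrangement of their letters.\<close>

lemma keys_overlap:
  assumes "a < b" "b < c" "c < n" "y \<in> Poly_Mapping.keys (overlap c b a)"
  shows "set y \<subseteq> {..<n}" "prec \<phi> y [c, b, a]"
proof -
  define S where "S = {y. set y \<subseteq> {..<n} \<and> length y = 3 \<and> sum_list (map \<phi> y) > \<phi> c + \<phi> b + \<phi> a}"
  have 1: "Poly_Mapping.keys (mon [x] * g w z) \<subseteq> S"
    if "z < w" "w < n" "x < n" "\<phi> x + \<phi> w + \<phi> z = \<phi> c + \<phi> b + \<phi> a" for x w z
  proof
    fix y assume "y \<in> Poly_Mapping.keys (mon [x] * g w z)"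
    then obtain y' where y': "y = x # y'" "y' \<in> Poly_Mapping.keys (g w z)"
      using keys_mon_mult by fastforce
    from y'(2) obtain k l where "y' = [k, l]" "k < n" "l < n" "G w z k l \<noteq> 0" by (rule keys_g)
    with y' that G_supp [of z w k l] show "y \<in> S" by (auto simp: S_def)
  qed
  have 2: "Poly_Mapping.keys (g w z * mon [x]) \<subseteq> S"
    if "z < w" "w < n" "x < n" "\<phi> x + \<phi> w + \<phi> z = \<phi> c + \<phi> b + \<phi> a" for x w z
  proof
    fix y assume "y \<in> Poly_Mapping.keys (g w z * mon [x])"
    then obtain y' where y': "y = y' @ [x]" "y' \<in> Poly_Mapping.keys (g w z)"
      using keys_mult_mon by fastforce
    from y'(2) obtain k l where "y' = [k, l]" "k < n" "l < n" "G w z k l \<noteq> 0" by (rule keys_g)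
    with y' that G_supp [of z w k l] show "y \<in> S" by (auto simp: S_def)
  qed
  have add: "Poly_Mapping.keys (P + Q) \<subseteq> S" and diff: "Poly_Mapping.keys (P - Q) \<subseteq> S"
    if "Poly_Mapping.keys P \<subseteq> S" "Poly_Mapping.keys Q \<subseteq> S" for P Q :: fpoly
    using that by (auto simp: in_keys_iff lookup_add lookup_minus subset_iff) (metis add_0 diff_zero)+
  have sm: "Poly_Mapping.keys (p \<odot> P) \<subseteq> S" if "Poly_Mapping.keys P \<subseteq> S" for P p
    using that keys_sm by blast
  have "Poly_Mapping.keys (overlap c b a) \<subseteq> S"
    unfolding overlap_def by (intro add diff sm 1 2) (use assms(1-3) in auto)
  with assms(4) show "set y \<subseteq> {..<n}" "prec \<phi> y [c, b, a]"
    by (auto simp: S_def prec_def)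
qed

lemma below_imp_rel:
  "set w' \<subseteq> {..<n} \<Longrightarrow> below w' w \<Longrightarrow>
     (w', w) \<in> inv_image (less_than <*lex*> less_than) (\<lambda>w. (length w, meas n \<phi> w))"
  by (auto simp: below_def dest: meas_less prec_length)

text \<open>A letter on the left allows the inner product to be reduced first; a letter on the right
  is absorbed into the tail.\<close>

lemma overlap_times:
  "Phi (overlap c b a * mon z) = Phi (mon [c] * Phi (rel b a * mon z))
     - [:q c b * q c a:] \<odot> Phi (rel b a * mon (c # z))
     - [:q c b:] \<odot> Phi (mon [b] * Phi (rel c a * mon z)) + [:q b a:] \<odot> Phi (rel c a * mon (b # z))
     + [:q b a * q c a:] \<odot> Phi (mon [a] * Phi (rel c b * mon z)) - Phi (rel c b * mon (a # z))"
  unfolding overlap_eq_rel Phi_mult_Phi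
  by (simp add: Phi_linear distrib_right left_diff_distrib mult.assoc)

text \<open>Bergman's diamond lemma, modulo a power of the deformation parameter.\<close>

theorem Phi_rel_sorted:
  assumes ov: "\<And>a b c. a < b \<Longrightarrow> b < c \<Longrightarrow> c < n \<Longrightarrow> Phi (overlap c b a) \<in> epsI m"
  shows "a < b \<Longrightarrow> set (b # a # z) \<subseteq> {..<n} \<Longrightarrow> sorted z \<Longrightarrow> Phi (rel b a * mon z) \<in> epsI m"
proof (induction "b # a # z" arbitrary: b a z rule: wf_induct_rule [OF wf_inv_image [OF wf_lex_prod [OF wf_less_than wf_less_than], of "\<lambda>w. (length w, meas n \<phi> w)"]])
  case (1 C B z)
  have IH: "Phi (rel b' a' * mon t) \<in> epsI m"
    if "a' < b'" "set (b' # a' # t) \<subseteq> {..<n}" "sorted t" "below (b' # a' # t) (C # B # z)" for b' a' t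
    using that 1(1) [OF below_imp_rel [OF that(2,4)]] by blast
  show ?case
  proof (cases "sorted (B # z)")
    case True
    with 1 show ?thesis using Phi_rel_eq_0 [of C B z] by simp
  next
    case False
    \<comment> \<open>As \<open>z\<close> is sorted but \<open>B # z\<close> is not, the first
      letter of \<open>z\<close> lies below \<open>B\<close>, which exhibits the overlap of
      \<open>C\<close>, \<open>B\<close>, \<open>A\<close>.\<close>
    then obtain A z' where z: "z = A # z'" "A < B" using 1 by (cases z) (auto simp: not_le intro: order_trans)
    have lt: "A < n" "B < n" "C < n" "set z' \<subseteq> {..<n}" using 1 z by auto
    have short: "Phi (mon [x] * Phi (rel b' a' * mon z')) \<in> epsI m"
      if "a' < b'" "b' < n" for x a' b'
    proof (rule Phi_epsI, rule epsI_mult_left, rule IH)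
      show "below (b' # a' # z') (C # B # z)" using z by (simp add: below_def)
    qed (use that lt 1 z in auto)
    \<comment> \<open>Here the length stays the same, and the word goes down because its first three
      letters precede \<open>[C, B, A]\<close>.\<close>
    have long: "Phi (rel b' a' * mon (x # z')) \<in> epsI m"
      if "a' < b'" "b' < n" "x < n" "prec \<phi> [b', a', x] [C, B, A]" for b' a' x
    proof (rule Phi_rel_nf)
      fix t assume t: "sorted t" "set t \<subseteq> {..<n}" "t = x # z' \<or> prec \<phi> t (x # z')"
      then have "b' # a' # t = b' # a' # x # z' \<or> prec \<phi> (b' # a' # t) (b' # a' # x # z')"
        using prec_context [of \<phi> t "x # z'" "[b', a']" "[]"] by auto
      moreover have "prec \<phi> (b' # a' # x # z') (C # B # z)"
        using prec_context [OF that(4), of "[]" z'] z by simp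
      ultimately have "below (b' # a' # t) (C # B # z)"
        unfolding below_def using prec_trans by metis
      then show "Phi (rel b' a' * mon t) \<in> epsI m" using that t by (intro IH) auto
    qed (use that lt in auto)
    have "Phi (overlap C B A * mon z') - Phi (Phi (overlap C B A) * mon z') \<in> epsI m"
    proof (rule Phi_mult_epsI')
      fix y assume y: "y \<in> Poly_Mapping.keys (overlap C B A)"
      have ys: "set y \<subseteq> {..<n}" "prec \<phi> y [C, B, A]"
        using keys_overlap [OF _ _ _ y] 1 z lt by auto
      show "Phi (mon y * mon z') - Phi (nf y * mon z') \<in> epsI m"
      proof (rule Phi_nf_left [where top_w = "C # B # z"])
        show "below (y @ z') (C # B # z)"
          using prec_context [OF ys(2), of "[]" z'] z by (simp add: below_def)
      qed (use ys lt IH in auto)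
    qed
    moreover have "Phi (Phi (overlap C B A) * mon z') \<in> epsI m"
      by (rule Phi_epsI, rule epsI_mult_right, rule ov) (use 1 z lt in auto)
    ultimately have ovz: "Phi (overlap C B A * mon z') \<in> epsI m"
      using epsI_add by fastforce
    \<comment> \<open>The overlap identity is solved for the only relation at the top word; the
      other relations are covered by induction.\<close>
    have "Phi (rel C B * mon (A # z')) = Phi (mon [C] * Phi (rel B A * mon z'))
     - [:q C B * q C A:] \<odot> Phi (rel B A * mon (C # z'))
     - [:q C B:] \<odot> Phi (mon [B] * Phi (rel C A * mon z')) + [:q B A:] \<odot> Phi (rel C A * mon (B # z'))
     + [:q B A * q C A:] \<odot> Phi (mon [A] * Phi (rel C B * mon z')) - Phi (overlap C B A * mon z')"
      unfolding overlap_times by simp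
    also have "\<dots> \<in> epsI m"
      using 1 z lt by (intro epsI_add epsI_diff epsI_sm short long ovz) (auto simp: prec_def)
    finally show ?thesis using z by simp
  qed
qed

text \<open>The right factor may be replaced by its normal form, whose words are sorted, and the
  left factor is harmless by \<open>Phi_mult_Phi\<close>.\<close>

theorem Phi_ideal_epsI:
  assumes ov: "\<And>a b c. a < b \<Longrightarrow> b < c \<Longrightarrow> c < n \<Longrightarrow> Phi (overlap c b a) \<in> epsI m"
    and ab: "a < b" "b < n"
  shows "Phi (P * rel b a * Q) \<in> epsI m"
proof -
  have "Phi (rel b a * Phi Q) \<in> epsI m"
  proof (rule Phi_mult_epsI)
    fix t assume "t \<in> Poly_Mapping.keys (Phi Q)"
    then obtain w where w: "t \<in> Poly_Mapping.keys (nf w)" unfolding Phi_def using keys_lin by blast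
    then have "set w \<subseteq> {..<n}" using nf_outside by fastforce
    with w have "sorted t" "set t \<subseteq> {..<n}" using nf_keys by auto
    then show "Phi (rel b a * mon t) \<in> epsI m" using Phi_rel_sorted [OF ov] ab by auto
  qed
  then have "Phi (rel b a * Q) \<in> epsI m" by (simp add: Phi_mult_Phi)
  then have "Phi (P * Phi (rel b a * Q)) \<in> epsI m" by (rule Phi_epsI [OF epsI_mult_left])
  then show ?thesis by (simp add: Phi_mult_Phi mult.assoc)
qed

lemma g_epsI: "a < b \<Longrightarrow> b < n \<Longrightarrow> g b a \<in> epsI 1"
  unfolding epsI_iff g_def
  by (auto simp: lookup_sum coeff_sum coeff_mult_lowest [where m = 0] G_eps intro!: sum.neutral)

lemma overlap_epsI: "a < b \<Longrightarrow> b < c \<Longrightarrow> c < n \<Longrightarrow> overlap c b a \<in> epsI 1"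
  unfolding overlap_def
  by (intro epsI_add epsI_diff epsI_sm epsI_mult_left epsI_mult_right g_epsI) auto

text \<open>The unconditional starting point: modulo the first power every overlap resolves, being
  divisible by \<epsilon>.\<close>

lemma Phi_ideal_epsI_1: "a < b \<Longrightarrow> b < n \<Longrightarrow> Phi (P * rel b a * Q) \<in> epsI 1"
  by (rule Phi_ideal_epsI) (auto intro: Phi_epsI overlap_epsI simp del: One_nat_def)

end

section \<open>The obstruction cocycle\<close>

lemma epsI_diff_trans: "P - Q \<in> epsI m \<Longrightarrow> Q - R \<in> epsI m \<Longrightarrow> P - R \<in> epsI m"
  using epsI_add by fastforce

lemma epsI_sm_diff: "P - Q \<in> epsI m \<Longrightarrow> p \<odot> P - p \<odot> Q \<in> epsI m"
  by (metis epsI_sm sm_diff_right)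

context reduction_system
begin

lemma q_nonzero: "i < n \<Longrightarrow> j < n \<Longrightarrow> q i j \<noteq> 0"
  using q_inv by fastforce

text \<open>At \<epsilon> = 0 only the swap of each step survives, so the scalar is a product of
  nonzero entries of \<open>q\<close>.\<close>

lemma nf_mod_eps:
  assumes "set w \<subseteq> {..<n}"
  shows "\<exists>c. c \<noteq> 0 \<and> nf w - [:c:] \<odot> mon (sort w) \<in> epsI 1"
  using assms
proof (induction w rule: reduction_induct)
  case (sorted w)
  then show ?case by (intro exI [of _ 1]) (simp add: nf_sorted sorted_sort_id one_pCons [symmetric])
next
  case (step u b a v)
  have ab: "a < n" "b < n" using step.hyps by auto
  \<comment> \<open>The induction hypothesis is available only for nonzero coefficients; that of the
    swap has constant term \<open>q b a\<close>.\<close>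
  have "F b a a b \<noteq> 0"
    using G_eps [of a b a b] q_nonzero [of b a] step.hyps ab by (auto simp: F_def poly_eq_iff) 
      (metis add_cancel_right_right coeff_pCons_0)
  with step.IH [of a b] prec_F [of a b a b u v] step.hyps ab
  obtain c where c: "c \<noteq> 0" "nf (u @ [a, b] @ v) - [:c:] \<odot> mon (sort (u @ [a, b] @ v)) \<in> epsI 1"
    by auto
  have sort_eq: "sort (u @ a # b # v) = sort (u @ b # a # v)"
    by (rule properties_for_sort [symmetric]) auto
  have eps: "(\<Sum>k<n. \<Sum>l<n. G b a k l \<odot> nf (u @ [k, l] @ v)) \<in> epsI 1"
  proof (intro epsI_sum)
    fix k l
    show "G b a k l \<odot> nf (u @ [k, l] @ v) \<in> epsI 1"
      unfolding epsI_iff using G_eps [of a b k l] step.hyps ab by (auto simp: coeff_mult)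
  qed
  have "nf (u @ b # a # v) - [:q b a * c:] \<odot> mon (sort (u @ b # a # v))
     = [:q b a:] \<odot> (nf (u @ [a, b] @ v) - [:c:] \<odot> mon (sort (u @ [a, b] @ v)))
       + (\<Sum>k<n. \<Sum>l<n. G b a k l \<odot> nf (u @ [k, l] @ v))"
    using step.hyps ab by (simp add: nf_step' sum_F sort_eq sm_diff_right mult.commute)
  also have "\<dots> \<in> epsI 1" using c eps by (intro epsI_add epsI_sm)
  finally show ?case using c(1) q_nonzero [of b a] ab by (intro exI [of _ "q b a * c"]) auto
qed

text \<open>The scalar with which the undeformed relations sort a word.\<close>

definition kappa :: "nat list \<Rightarrow> complex" where
  "kappa w = poly.coeff (coef (nf w) (sort w)) 0"

lemma kappa:
  assumes "set w \<subseteq> {..<n}"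
  shows "kappa w \<noteq> 0" "nf w - [:kappa w:] \<odot> mon (sort w) \<in> epsI 1"
proof -
  obtain c where c: "c \<noteq> 0" "nf w - [:c:] \<odot> mon (sort w) \<in> epsI 1"
    using nf_mod_eps [OF assms] by blast
  then have "kappa w = c"
    using epsI_coeff_cong [of "nf w" "[:c:] \<odot> mon (sort w)" 0 "sort w"]
    by (simp add: kappa_def coef_mon)
  with c show "kappa w \<noteq> 0" "nf w - [:kappa w:] \<odot> mon (sort w) \<in> epsI 1" by auto
qed

lemma nf_swap_less:
  assumes "a < b" "b < n"
  shows "nf (u @ b # a # v) - [:q b a:] \<odot> nf (u @ a # b # v) \<in> epsI 1"
proof -
  have "nf (u @ b # a # v) - [:q b a:] \<odot> nf (u @ a # b # v)
     = Phi (mon u * g b a * mon v) - Phi (mon u * rel b a * mon v)"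
    by (simp add: rel_def Phi_linear algebra_simps)
  also have "\<dots> \<in> epsI 1"
    by (intro epsI_diff Phi_ideal_epsI_1 assms Phi_epsI [OF epsI_mult_right] epsI_mult_left g_epsI)
  finally show ?thesis .
qed

lemma nf_swap:
  assumes "a < n" "b < n"
  shows "nf (u @ b # a # v) - [:q b a:] \<odot> nf (u @ a # b # v) \<in> epsI 1"
proof -
  consider "a < b" | "a = b" | "b < a" by linarith
  then show ?thesis
  proof cases
    case 1
    then show ?thesis using assms by (intro nf_swap_less)
  next
    case 2
    then show ?thesis using assms by (simp add: q_refl one_pCons [symmetric])
  next
    case 3
    have "nf (u @ b # a # v) - [:q b a:] \<odot> nf (u @ a # b # v)
      = - ([:q b a:] \<odot> (nf (u @ a # b # v) - [:q a b:] \<odot> nf (u @ b # a # v)))"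
      using q_inv [of a b] assms by (simp add: sm_diff_right one_pCons [symmetric])
    also have "\<dots> \<in> epsI 1" using 3 assms by (intro epsI_minus epsI_sm nf_swap_less)
    finally show ?thesis .
  qed
qed

lemma nf_move:
  assumes "d < n" "set v \<subseteq> {..<n}"
  shows "nf (u @ d # v) - [:prod_list (map (q d) v):] \<odot> nf (u @ v @ [d]) \<in> epsI 1"
  using assms(2)
proof (induction v arbitrary: u)
  case Nil
  then show ?case by (simp add: one_pCons [symmetric])
next
  case (Cons x v)
  have "nf (u @ d # x # v) - [:q d x:] \<odot> nf (u @ x # d # v) \<in> epsI 1"
    using Cons.prems assms by (intro nf_swap) auto
  moreover have "[:q d x:] \<odot> nf ((u @ [x]) @ d # v)
     - [:q d x:] \<odot> [:prod_list (map (q d) v):] \<odot> nf ((u @ [x]) @ v @ [d]) \<in> epsI 1"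
    using Cons by (intro epsI_sm_diff Cons.IH) auto
  ultimately show ?case
    using epsI_diff_trans [of "nf (u @ d # x # v)" "[:q d x:] \<odot> nf (u @ x # d # v)"] by (simp add: mult.commute)
qed

text \<open>A commutator with x_d twisted by \<open>\<chi>\<close>. In the overlap formulas
  \<open>\<chi>\<close> is the scalar by which x_d passes the undeformed word that \<open>P\<close>
  deforms, so a bracket measures the failure of \<open>P\<close> to commute in the same way.\<close>

definition bracket :: "nat \<Rightarrow> complex \<Rightarrow> fpoly \<Rightarrow> fpoly" where
  "bracket d \<chi> P = mon [d] * P - [:\<chi>:] \<odot> (P * mon [d])"

lemma Phi_bracket_mon:
  assumes "d < n" "set w \<subseteq> {..<n}"
  shows "Phi (bracket d \<chi> (mon w))
    - [:(prod_list (map (q d) w) - \<chi>) * kappa (w @ [d]):] \<odot> mon (sort (w @ [d])) \<in> epsI 1"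
proof -
  have "Phi (bracket d \<chi> (mon w)) - [:prod_list (map (q d) w) - \<chi>:] \<odot> nf (w @ [d])
     = nf ([] @ d # w) - [:prod_list (map (q d) w):] \<odot> nf ([] @ w @ [d])"
  proof -
    have "[:prod_list (map (q d) w) - \<chi>:] = [:prod_list (map (q d) w):] - [:\<chi>:]" by simp
    then show ?thesis by (simp only: sm_diff_left) (simp add: bracket_def Phi_linear)
  qed
  also have "\<dots> \<in> epsI 1" using assms by (rule nf_move)
  finally have 1: "Phi (bracket d \<chi> (mon w)) - [:prod_list (map (q d) w) - \<chi>:] \<odot> nf (w @ [d]) \<in> epsI 1" .
  have "[:prod_list (map (q d) w) - \<chi>:] \<odot> nf (w @ [d])
      - [:prod_list (map (q d) w) - \<chi>:] \<odot> [:kappa (w @ [d]):] \<odot> mon (sort (w @ [d])) \<in> epsI 1"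
    using assms by (intro epsI_sm_diff kappa) auto
  with 1 show ?thesis
    using epsI_diff_trans [of "Phi (bracket d \<chi> (mon w))" "[:prod_list (map (q d) w) - \<chi>:] \<odot> nf (w @ [d])"]
    by (simp add: mult.commute)
qed

text \<open>The coefficient of the sorted word \<open>t\<close> in the leading term of the bracket of \<open>d\<close> with
  \<open>t\<close> deprived of one letter \<open>d\<close>.\<close>

definition bfac :: "nat \<Rightarrow> complex \<Rightarrow> nat list \<Rightarrow> complex" where
  "bfac d \<chi> t = (if d \<in> set t
     then (prod_list (map (q d) (remove1 d t)) - \<chi>) * kappa (remove1 d t @ [d]) else 0)"

text \<open>At the lowest power only the undeformed sorting of \<open>w @ [d]\<close> counts, and
  \<open>t\<close> arises from the single word \<open>remove1 d t\<close>. If \<open>d\<close> is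
  not in \<open>t\<close>, then \<open>bfac\<close> is 0 and the value of \<open>remove1\<close> is
  immaterial.\<close>

lemma bracket_coeff:
  assumes P: "P \<in> epsI m" "\<And>w. w \<in> Poly_Mapping.keys P \<Longrightarrow> sorted w \<and> set w \<subseteq> {..<n}"
    and d: "d < n" and t: "sorted t"
  shows "poly.coeff (coef (Phi (bracket d \<chi> P)) t) m
     = bfac d \<chi> t * poly.coeff (coef P (remove1 d t)) m"
proof -
  let ?K = "Poly_Mapping.keys P"
  have "bracket d \<chi> P = (\<Sum>w\<in>?K. coef P w \<odot> bracket d \<chi> (mon w))"
    unfolding bracket_def
    by (subst (1 2) fpoly_expand [of ?K P])
      (auto simp: sum_distrib_left sum_distrib_right sm_sum sm_diff_right sum_subtractf mult.commute)
  then have "coef (Phi (bracket d \<chi> P)) t = (\<Sum>w\<in>?K. coef P w * coef (Phi (bracket d \<chi> (mon w))) t)"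
    by (simp add: Phi_sum Phi_linear lookup_sum)
  then have "poly.coeff (coef (Phi (bracket d \<chi> P)) t) m
      = (\<Sum>w\<in>?K. poly.coeff (coef P w * coef (Phi (bracket d \<chi> (mon w))) t) m)"
    by (simp add: coeff_sum)
  also have "\<dots> = (\<Sum>w\<in>?K. if w = remove1 d t then bfac d \<chi> t * poly.coeff (coef P w) m else 0)"
  proof (rule sum.cong [OF refl])
    fix w assume w: "w \<in> ?K"
    have "poly.coeff (coef (Phi (bracket d \<chi> (mon w))) t) 0
       = poly.coeff (coef ([:(prod_list (map (q d) w) - \<chi>) * kappa (w @ [d]):] \<odot> mon (sort (w @ [d]))) t) 0"
      using Phi_bracket_mon [of d w \<chi>] P w d by (intro epsI_coeff_cong) auto
    also have "\<dots> = (if w = remove1 d t then bfac d \<chi> t else 0)"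
      using sort_snoc_eq_iff [of w t d] P w t by (auto simp: coef_mon bfac_def)
    moreover have "poly.coeff (coef P w * coef (Phi (bracket d \<chi> (mon w))) t) m
        = poly.coeff (coef P w) m * poly.coeff (coef (Phi (bracket d \<chi> (mon w))) t) 0"
      using P by (intro coeff_mult_lowest) (auto simp: epsI_iff)
    ultimately show "poly.coeff (coef P w * coef (Phi (bracket d \<chi> (mon w))) t) m =
         (if w = remove1 d t then bfac d \<chi> t * poly.coeff (coef P w) m else 0)"
      by auto
  qed
  also have "\<dots> = bfac d \<chi> t * poly.coeff (coef P (remove1 d t)) m"
    by (auto simp: in_keys_iff)
  finally show ?thesis .
qed

text \<open>This is the shape of a Koszul differential applied to the 2-cochain \<open>g\<close>,
  with one twisted commutator per letter; the outer scalars come from q being multiplicatively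
  alternating.\<close>

lemma overlap_eq_bracket:
  assumes "a < n" "b < n" "c < n"
  shows "overlap c b a = bracket c (q c b * q c a) (g b a)
     - [:q c b:] \<odot> bracket b (q b c * q b a) (g c a)
     + [:q b a * q c a:] \<odot> bracket a (q a c * q a b) (g c b)"
proof -
  have q1: "q c b * q b c = 1" "q b a * q a b = 1" "q c a * q a c = 1"
    using assms by (auto intro!: q_inv)
  have "q c b * (q b c * q b a) = (q c b * q b c) * q b a"
    "q b a * q c a * (q a c * q a b) = (q b a * q a b) * (q c a * q a c)"
    by (simp_all only: ac_simps)
  then have qs: "q c b * (q b c * q b a) = q b a" "q b a * q c a * (q a c * q a b) = 1"
    unfolding q1 by simp_all
  have const: "[:x:] * [:y:] = [:x * y:]" for x y :: complex by simp
  show ?thesis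
    by (simp only: overlap_def bracket_def sm_diff_right sm_sm const qs one_pCons [symmetric] sm_one)
      (simp only: algebra_simps)
qed

lemma Phi_keys:
  assumes "t \<in> Poly_Mapping.keys (Phi P)"
  shows "sorted t" "set t \<subseteq> {..<n}"
proof -
  obtain w where w: "t \<in> Poly_Mapping.keys (nf w)" using assms keys_lin unfolding Phi_def by blast
  then have "set w \<subseteq> {..<n}" using nf_outside by fastforce
  with w show "sorted t" "set t \<subseteq> {..<n}" using nf_keys by auto
qed

context
  fixes m :: nat
  assumes ov: "\<And>a b c. a < b \<Longrightarrow> b < c \<Longrightarrow> c < n \<Longrightarrow> Phi (overlap c b a) \<in> epsI m"
begin

lemma Phi_rel_epsI:
  assumes "a < b" "b < n" "P \<in> epsI k"
  shows "Phi (rel b a * P) \<in> epsI (k + m)"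
proof -
  obtain Q where Q: "P = monom 1 k \<odot> Q" using assms(3) unfolding epsI_def by auto
  have "Phi (1 * rel b a * Q) \<in> epsI m" using Phi_ideal_epsI [OF ov] assms(1,2) by blast
  then show ?thesis by (simp add: Q Phi_linear epsI_sm_epsI)
qed

text \<open>Reducing the left factor first is correct only modulo the power \<open>m\<close>; the
  extra power is the factor \<epsilon> of the overlap itself.\<close>

lemma Phi_overlap_left:
  assumes "a < b" "b < c" "c < n" "d < n"
  shows "Phi (overlap c b a * mon [d]) - Phi (Phi (overlap c b a) * mon [d]) \<in> epsI (Suc m)"
proof -
  obtain Q where Q: "overlap c b a = monom 1 1 \<odot> Q"
    using overlap_epsI [OF assms(1-3)] unfolding epsI_def by auto
  have "Phi (Q * mon [d]) - Phi (Phi Q * mon [d]) \<in> epsI m"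
  proof (rule Phi_mult_epsI')
    fix t
    show "Phi (mon t * mon [d]) - Phi (nf t * mon [d]) \<in> epsI m"
    proof (cases "set t \<subseteq> {..<n}")
      case True
      show ?thesis
      \<comment> \<open>Only the length of \<open>top_w\<close> matters: it exceeds that of
        \<open>t\<close> followed by \<open>d\<close>.\<close>
      proof (rule Phi_nf_left [where top_w = "replicate (length t + 2) 0"])
        show "Phi (rel b a * mon t) \<in> epsI m" if "a < b" "set (b # a # t) \<subseteq> {..<n}" for b a t
          using Phi_ideal_epsI [OF ov, of a b 1 "mon t"] that by simp
      qed (use True assms in \<open>auto simp: below_def\<close>)
    qed (simp add: nf_outside Phi_linear)
  qed
  from epsI_sm_epsI [OF this, of 1 1] show ?thesis
    by (simp add: Q Phi_linear sm_diff_right)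
qed

text \<open>Five of the six terms are reductions which the strategy performs itself; only
  \<open>rel c b\<close> in front of \<open>a\<close> competes with it.\<close>

lemma Phi_overlap: 
  assumes "a < b" "b < c" "c < n"
  shows "Phi (overlap c b a) = - Phi (rel c b * mon [a])"
  using overlap_times [of c b a "[]"] assms Phi_rel_eq_0 [of b a "[]"] Phi_rel_eq_0 [of c a "[]"]
    Phi_rel_eq_0 [of c b "[]"] Phi_rel_eq_0 [of b a "[c]"] Phi_rel_eq_0 [of c a "[b]"]
  by (simp add: Phi_linear)

text \<open>The swap is correct up to one power of \<epsilon>, and a relation times this error gains
  \<open>m\<close> more.\<close>

lemma Phi_rel_swap:
  assumes "a < b" "b < n" "x < n" "y < n"
  shows "Phi (rel b a * mon [y, x]) - [:q y x:] \<odot> Phi (rel b a * mon [x, y]) \<in> epsI (Suc m)"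
proof -
  have "nf [y, x] - [:q y x:] \<odot> nf [x, y] \<in> epsI 1"
    using nf_swap [of x y "[]" "[]"] assms by simp
  from Phi_rel_epsI [OF assms(1,2) this] show ?thesis
    using Phi_mult_Phi [of "rel b a" "mon [x, y]"] Phi_mult_Phi [of "rel b a" "mon [y, x]"]
    by (simp add: right_diff_distrib Phi_linear)
qed

text \<open>The four hexagons around the word \<open>d c b a\<close>, glued along their common edges.\<close>

theorem overlap_cocycle:
  assumes "a < b" "b < c" "c < d" "d < n"
  shows "Phi (bracket d (q d c * q d b * q d a) (Phi (overlap c b a))
      - [:q d c:] \<odot> bracket c (q c d * q c b * q c a) (Phi (overlap d b a))
      + [:q c b * q d b:] \<odot> bracket b (q b d * q b c * q b a) (Phi (overlap d c a))
      - [:q b a * q c a * q d a:] \<odot> bracket a (q a d * q a c * q a b) (Phi (overlap d c b))) \<in> epsI (Suc m)"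
    (is "?Z \<in> _")
proof -
  let ?r = "\<lambda>b a w. Phi (rel b a * mon w)"
  let ?O = "\<lambda>c b a. Phi (overlap c b a)"
  have lt: "a < n" "b < n" "c < n" "a < c" "a < d" "b < d" using assms by auto
  have zero: "?r z y v = 0" if "set (z # y # v) \<subseteq> {..<n}" "y < z" "sorted (y # v)" for z y v
    using that by (rule Phi_rel_eq_0)
  note T = overlap_times [where z = "[_]"]
  have left: "Phi (overlap z y x * mon [w]) - Phi (?O z y x * mon [w]) \<in> epsI (Suc m)"
    if "x < y" "y < z" "z < n" "w < n" for x y z w using that by (rule Phi_overlap_left)
  have comb: "- A - p \<odot> B \<in> epsI k" "- A - p \<odot> B + r \<odot> C \<in> epsI k" "- A - p \<odot> B + r \<odot> C - D \<in> epsI k"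
    if "A \<in> epsI k" "B \<in> epsI k" "C \<in> epsI k" "D \<in> epsI k" for A B C D p r k
    using that by (auto intro!: epsI_diff epsI_add epsI_minus epsI_sm)
  \<comment> \<open>In each of the four expansions a relation is zero when its second letter
    followed by the tail is sorted; tails in the wrong order are swapped at the cost of a scalar.
    What survives is cancelled by the final combination.\<close>
  have e1: "Phi (?O c b a * mon [d]) + ?r c b [a, d] \<in> epsI (Suc m)"
  proof -
    have "Phi (overlap c b a * mon [d]) = - ?r c b [a, d]"
      unfolding T using assms lt by (simp add: zero Phi_linear)
    then show ?thesis using epsI_minus [OF left [of a b c d]] assms lt by simp
  qed
  have e2: "Phi (?O d b a * mon [c]) + ?r d b [a, c] \<in> epsI (Suc m)"
  proof -
    have "Phi (overlap d b a * mon [c]) = - ?r d b [a, c] - [:q d b * q d a:] \<odot> ?r b a [d, c]"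
      unfolding T using assms lt by (simp add: zero Phi_linear)
    then have "Phi (?O d b a * mon [c]) + ?r d b [a, c]
       = - (Phi (overlap d b a * mon [c]) - Phi (?O d b a * mon [c]))
         - [:q d b * q d a:] \<odot> (?r b a [d, c] - [:q d c:] \<odot> ?r b a [c, d])"
      using assms lt by (simp add: zero)
    also have "\<dots> \<in> epsI (Suc m)"
      using assms lt by (intro comb(1) [where C = 0 and D = 0] left Phi_rel_swap) auto
    finally show ?thesis .
  qed
  have e3: "Phi (?O d c a * mon [b]) + ?r d c [a, b] + [:q c a * q d a:] \<odot> Phi (mon [a] * ?O d c b) \<in> epsI (Suc m)"
  proof -
    have eq: "Phi (overlap d c a * mon [b]) = - ?r d c [a, b] - [:q d c * q d a:] \<odot> ?r c a [d, b]
        + [:q c a:] \<odot> ?r d a [c, b] - [:q c a * q d a:] \<odot> Phi (mon [a] * ?O d c b)"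
      unfolding T using assms lt by (simp add: zero Phi_linear Phi_overlap sm_minus_right)
    have z: "?r c a [b, d] = 0" "?r d a [b, c] = 0"
      using assms lt by (auto intro!: zero)
    have lin: "A + B + C = - ((- B - D + E - C) - A) - D + E" for A B C D E :: fpoly by simp
    have "Phi (?O d c a * mon [b]) + ?r d c [a, b] + [:q c a * q d a:] \<odot> Phi (mon [a] * ?O d c b)
       = - (Phi (overlap d c a * mon [b]) - Phi (?O d c a * mon [b]))
         - [:q d c * q d a:] \<odot> (?r c a [d, b] - [:q d b:] \<odot> ?r c a [b, d])
         + [:q c a:] \<odot> (?r d a [c, b] - [:q c b:] \<odot> ?r d a [b, c])"
      unfolding eq z sm_zero_right diff_zero by (rule lin)
    also have "\<dots> \<in> epsI (Suc m)"
      using assms lt by (intro comb(2) [where D = 0] left Phi_rel_swap) auto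
    finally show ?thesis .
  qed
  have e4: "Phi (?O d c b * mon [a]) + Phi (mon [d] * ?O c b a) + [:q d c * q d b * q d a:] \<odot> ?r c b [a, d]
      - [:q c b * q c a:] \<odot> ?r d b [a, c] - [:q d c:] \<odot> Phi (mon [c] * ?O d b a)
      + [:q c b * q d b:] \<odot> Phi (mon [b] * ?O d c a) + [:q b a:] \<odot> ?r d c [a, b] \<in> epsI (Suc m)" (is "?e4 \<in> _")
  proof -
    have "Phi (overlap d c b * mon [a]) = - Phi (mon [d] * ?O c b a) - [:q d c * q d b:] \<odot> ?r c b [d, a]
        + [:q d c:] \<odot> Phi (mon [c] * ?O d b a) + [:q c b:] \<odot> ?r d b [c, a]
        - [:q c b * q d b:] \<odot> Phi (mon [b] * ?O d c a) - ?r d c [b, a]"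
      unfolding T using assms lt by (simp add: Phi_linear Phi_overlap sm_minus_right)
    then have "?e4 = - (Phi (overlap d c b * mon [a]) - Phi (?O d c b * mon [a]))
         - [:q d c * q d b:] \<odot> (?r c b [d, a] - [:q d a:] \<odot> ?r c b [a, d])
         + [:q c b:] \<odot> (?r d b [c, a] - [:q c a:] \<odot> ?r d b [a, c])
         - (?r d c [b, a] - [:q b a:] \<odot> ?r d c [a, b])"
      by (simp add: sm_diff_right mult.commute)
    also have "\<dots> \<in> epsI (Suc m)"
      using assms lt by (intro comb(3) left Phi_rel_swap) auto
    finally show ?thesis .
  qed
  have q1: "q d c * q c d = 1" "q c b * q b c = 1" "q d b * q b d = 1" "q b a * q a b = 1"
      "q c a * q a c = 1" "q d a * q a d = 1"
    using assms lt by (auto intro!: q_inv)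
  have "q d c * (q c d * q c b * q c a) = (q d c * q c d) * (q c b * q c a)"
    by (simp only: ac_simps)
  moreover have "q c b * q d b * (q b d * q b c * q b a) = (q c b * q b c) * (q d b * q b d) * q b a"
    by (simp only: ac_simps)
  moreover have "q b a * q c a * q d a * (q a d * q a c * q a b)
      = (q b a * q a b) * (q c a * q a c) * (q d a * q a d)"
    by (simp only: ac_simps)
  ultimately have qs: "q d c * (q c d * q c b * q c a) = q c b * q c a"
    "q c b * q d b * (q b d * q b c * q b a) = q b a"
    "q b a * q c a * q d a * (q a d * q a c * q a b) = 1"
    unfolding q1 by simp_all
  have const: "[:x:] * [:y:] = [:x * y:]" for x y :: complex by simp
  have Z: "?Z = Phi (mon [d] * ?O c b a) - [:q d c * q d b * q d a:] \<odot> Phi (?O c b a * mon [d])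
      - ([:q d c:] \<odot> Phi (mon [c] * ?O d b a) - [:q c b * q c a:] \<odot> Phi (?O d b a * mon [c]))
      + ([:q c b * q d b:] \<odot> Phi (mon [b] * ?O d c a) - [:q b a:] \<odot> Phi (?O d c a * mon [b]))
      - ([:q b a * q c a * q d a:] \<odot> Phi (mon [a] * ?O d c b) - Phi (?O d c b * mon [a]))"
    by (simp only: bracket_def Phi_linear sm_diff_right sm_sm const qs one_pCons [symmetric] sm_one)
  have lin: "A1 - A2 - (A3 - A4) + (A5 - A6) - (A7 - A8)
      = (A8 + A1 + B1 - B2 - A3 + A5 + B3) - (A2 + B1) + (A4 + B2) - (A6 + B3 + A7)"
    for A1 A2 A3 A4 A5 A6 A7 A8 B1 B2 B3 :: fpoly by (simp add: algebra_simps)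
  \<comment> \<open>The multipliers are those which \<open>?Z\<close> puts on the products with a
    letter on the right; with them the surviving relation terms cancel in pairs.\<close>
  have "?Z = ?e4
     - [:q d c * q d b * q d a:] \<odot> (Phi (?O c b a * mon [d]) + ?r c b [a, d])
     + [:q c b * q c a:] \<odot> (Phi (?O d b a * mon [c]) + ?r d b [a, c])
     - [:q b a:] \<odot> (Phi (?O d c a * mon [b]) + ?r d c [a, b] + [:q c a * q d a:] \<odot> Phi (mon [a] * ?O d c b))"
    unfolding Z sm_add_right sm_sm const mult.assoc [symmetric] by (rule lin)
  also have "\<dots> \<in> epsI (Suc m)" by (intro epsI_diff epsI_add epsI_sm e1 e2 e3 e4)
  finally show ?thesis .
qed

text \<open>Comparing coefficients at the lowest power turns the cocycle into numerical equations,
  one for each sorted word \<open>t\<close>.\<close>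

corollary obstruction_cocycle:
  assumes "a < b" "b < c" "c < d" "d < n" "sorted t"
  defines "ob \<equiv> \<lambda>c b a v. poly.coeff (coef (Phi (overlap c b a)) v) m"
  shows "bfac d (q d c * q d b * q d a) t * ob c b a (remove1 d t)
      - q d c * (bfac c (q c d * q c b * q c a) t * ob d b a (remove1 c t))
      + q c b * q d b * (bfac b (q b d * q b c * q b a) t * ob d c a (remove1 b t))
      - q b a * q c a * q d a * (bfac a (q a d * q a c * q a b) t * ob d c b (remove1 a t)) = 0"
proof -
  have c: "poly.coeff (coef (Phi (bracket e \<chi> (Phi (overlap z y x)))) t) m
     = bfac e \<chi> t * ob z y x (remove1 e t)" if "x < y" "y < z" "z < n" "e < n" for e \<chi> x y z
    unfolding ob_def using that assms(5) by (intro bracket_coeff ov) (auto dest: Phi_keys)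
  have "poly.coeff (coef P t) m = 0" if "P \<in> epsI (Suc m)" for P
    using that by (simp add: epsI_iff)
  from this [OF overlap_cocycle [OF assms(1-4)]] show ?thesis
    using assms(1-4) by (simp add: Phi_linear lookup_add lookup_minus c)
qed

end

end

lemma epsI_sm_low: 
  assumes "\<And>j. j < m \<Longrightarrow> poly.coeff p j = 0"
  shows "p \<odot> P \<in> epsI m"
  unfolding epsI_iff using assms by (auto simp: coeff_mult intro!: sum.neutral)

lemma coeff_mult_nonzeroE:
  fixes p r :: "complex poly"
  assumes "poly.coeff (p * r) s \<noteq> 0"
  obtains i j where "s = i + j" "poly.coeff p i \<noteq> 0" "poly.coeff r j \<noteq> 0"
proof -
  have "(\<Sum>i\<le>s. poly.coeff p i * poly.coeff r (s - i)) \<noteq> 0" using assms by (simp add: coeff_mult)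
  then obtain i where "i \<in> {..s}" "poly.coeff p i * poly.coeff r (s - i) \<noteq> 0"
    by (rule sum.not_neutral_contains_not_neutral)
  then show thesis by (intro that [of i "s - i"]) auto
qed

context reduction_system
begin

lemma coef_g: "coef (g b a) v = (case v of [k, l] \<Rightarrow> if k < n \<and> l < n then G b a k l else 0 | _ \<Rightarrow> 0)"
proof -
  have "coef (g b a) v = (\<Sum>k<n. \<Sum>l<n. if [k, l] = v then G b a k l else 0)"
    by (simp add: g_def lookup_sum coef_mon if_distrib cong: if_cong)
  also have "\<dots> = (case v of [k, l] \<Rightarrow> if k < n \<and> l < n then G b a k l else 0 | _ \<Rightarrow> 0)"
  proof (cases "\<exists>x y. v = [x, y]")
    case True
    then obtain x y where v: "v = [x, y]" by blast
    have "(\<Sum>k<n. \<Sum>l<n. if [k, l] = v then G b a k l else 0)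
        = (\<Sum>k<n. if k = x then (\<Sum>l<n. if l = y then G b a x y else 0) else 0)"
      by (intro sum.cong refl) (auto simp: v intro!: sum.cong)
    then show ?thesis by (simp add: v)
  next
    case False
    then show ?thesis by (auto split: list.splits)
  qed
  finally show ?thesis .
qed

lemma Phi_overlap_nf:
  assumes "a < b" "b < c" "c < n"
  shows "Phi (overlap c b a) = nf [c, b, a] - (\<Sum>k<n. \<Sum>l<n. F c b k l \<odot> nf [k, l, a])"
proof -
  have "Phi (overlap c b a) = - Phi (rel c b * mon [a])"
    using assms by (intro Phi_overlap [where m = 0]) auto
  then show ?thesis using Phi_rel_mult [of b c "[]" "[a]"] assms by simp
qed

end

section \<open>Weights of words and their relation to powers of the parameter\<close>

definition wt :: "nat list \<Rightarrow> nat \<Rightarrow> int" where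
  "wt w k = int (count_list w k)"

lemma wt_simps [simp]: "wt [] k = 0" "wt (x # w) k = (if x = k then 1 else 0) + wt w k"
  "wt (u @ w) k = wt u k + wt w k"
  by (auto simp: wt_def)

lemma relw_wt: "relw a b k l = (\<lambda>j. wt [k, l] j - wt [a, b] j)"
  by (auto simp: relw_def unitw_def fun_eq_iff)

text \<open>Ties the power of \<epsilon> to the weight. The closure properties of \<open>Th\<close>
  carry this tie through products, so an overlap coefficient at the power \<open>s\<close> has
  weight in \<open>Th s\<close>.\<close>

locale graded_system = reduction_system +
  fixes Th :: "nat \<Rightarrow> (nat \<Rightarrow> int) set"
  assumes Th_0: "(\<lambda>_. 0) \<in> Th 0"
    and Th_add: "u \<in> Th s \<Longrightarrow> v \<in> Th r \<Longrightarrow> (\<lambda>k. u k + v k) \<in> Th (s + r)"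
    and G_wt: "a < b \<Longrightarrow> b < n \<Longrightarrow> poly.coeff (G b a k l) s \<noteq> 0 \<Longrightarrow> relw a b k l \<in> Th s"
begin

lemma F_wt:
  assumes "a < b" "b < n" "poly.coeff (F b a k l) s \<noteq> 0"
  shows "relw a b k l \<in> Th s"
proof (cases "poly.coeff (G b a k l) s = 0")
  case True
  with assms have "k = a" "l = b" "s = 0"
    by (auto simp: F_def coeff_pCons split: if_splits nat.splits)
  then show ?thesis using Th_0 by (simp add: relw_wt)
qed (use G_wt assms in blast)

lemma nf_wt:
  assumes "set w \<subseteq> {..<n}" "poly.coeff (coef (nf w) v) s \<noteq> 0"
  shows "(\<lambda>k. wt v k - wt w k) \<in> Th s"
  using assms
proof (induction w arbitrary: s rule: reduction_induct)
  case (sorted w)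
  then show ?case using Th_0 by (auto simp: nf_sorted coef_mon coeff_1 split: if_splits)
next
  case (step u b a z)
  have "(\<Sum>k<n. \<Sum>l<n. poly.coeff (F b a k l * coef (nf (u @ [k, l] @ z)) v) s) \<noteq> 0"
    using step.prems step.hyps by (simp add: nf_step' lookup_sum coeff_sum)
  then obtain k where k: "k < n" "(\<Sum>l<n. poly.coeff (F b a k l * coef (nf (u @ [k, l] @ z)) v) s) \<noteq> 0"
    by (metis (no_types, lifting) lessThan_iff sum.not_neutral_contains_not_neutral)
  then obtain l where l: "l < n" "poly.coeff (F b a k l * coef (nf (u @ [k, l] @ z)) v) s \<noteq> 0"
    by (metis (no_types, lifting) lessThan_iff sum.not_neutral_contains_not_neutral)
  from l(2) obtain i j where ij: "s = i + j" "poly.coeff (F b a k l) i \<noteq> 0"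
      "poly.coeff (coef (nf (u @ [k, l] @ z)) v) j \<noteq> 0"
    by (rule coeff_mult_nonzeroE)
  have ab: "a < b" "b < n" using step.hyps by auto
  have F: "F b a k l \<noteq> 0" using ij(2) by auto
  have "(\<lambda>x. wt v x - wt (u @ [k, l] @ z) x) \<in> Th j"
    using step.IH [of k l j] F k l ij prec_F [OF ab F, of u z] by simp
  from Th_add [OF F_wt [OF ab ij(2)] this] show ?case
    by (simp add: relw_wt ij algebra_simps)
qed

lemma overlap_wt:
  assumes "a < b" "b < c" "c < n" "poly.coeff (coef (Phi (overlap c b a)) v) s \<noteq> 0"
  shows "(\<lambda>k. wt v k - wt [a, b, c] k) \<in> Th s"
proof (cases "poly.coeff (coef (nf [c, b, a]) v) s = 0")
  case False
  from nf_wt [OF _ this] assms show ?thesis by (simp add: algebra_simps)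
next
  case True
  with assms have "(\<Sum>k<n. \<Sum>l<n. poly.coeff (F c b k l * coef (nf [k, l, a]) v) s) \<noteq> 0"
    by (simp add: Phi_overlap_nf lookup_minus lookup_sum coeff_sum)
  then obtain k where k: "k < n" "(\<Sum>l<n. poly.coeff (F c b k l * coef (nf [k, l, a]) v) s) \<noteq> 0"
    by (metis (no_types, lifting) lessThan_iff sum.not_neutral_contains_not_neutral)
  then obtain l where l: "l < n" "poly.coeff (F c b k l * coef (nf [k, l, a]) v) s \<noteq> 0"
    by (metis (no_types, lifting) lessThan_iff sum.not_neutral_contains_not_neutral)
  from l(2) obtain i j where ij: "s = i + j" "poly.coeff (F c b k l) i \<noteq> 0"
      "poly.coeff (coef (nf [k, l, a]) v) j \<noteq> 0"
    by (rule coeff_mult_nonzeroE)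
  have "(\<lambda>x. wt v x - wt [k, l, a] x) \<in> Th j"
    using ij k l assms by (intro nf_wt) auto
  from Th_add [OF F_wt [OF assms(2,3) ij(2)] this] show ?thesis
    by (simp add: relw_wt ij algebra_simps)
qed

end

section \<open>Comparison of two deformations that agree to a given order\<close>

locale system_pair = A: reduction_system n \<phi> q G + B: reduction_system n \<phi> q G'
  for n \<phi> q G G' +
  fixes m :: nat
  assumes agree: "a < b \<Longrightarrow> b < n \<Longrightarrow> j < m \<Longrightarrow> poly.coeff (G' b a k l) j = poly.coeff (G b a k l) j"
begin

lemma nf_agree: "set w \<subseteq> {..<n} \<Longrightarrow> B.nf w - A.nf w \<in> epsI m"
proof (induction w rule: A.reduction_induct)
  case (sorted w)
  then show ?case by (simp add: A.nf_sorted B.nf_sorted)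
next
  case (step u b a v)
  have ab: "a < b" "b < n" using step.hyps by auto
  let ?w = "\<lambda>k l. u @ [k, l] @ v"
  have "B.nf (u @ b # a # v) - A.nf (u @ b # a # v)
    = (\<Sum>k<n. \<Sum>l<n. (B.F b a k l - A.F b a k l) \<odot> B.nf (?w k l)
         + A.F b a k l \<odot> (B.nf (?w k l) - A.nf (?w k l)))"
    using step.hyps
    by (simp add: A.nf_step' B.nf_step' sm_diff_left sm_diff_right flip: sum_subtractf)
  also have "\<dots> \<in> epsI m"
  proof (intro epsI_sum epsI_add)
    fix k l assume kl: "k \<in> {..<n}" "l \<in> {..<n}"
    show "(B.F b a k l - A.F b a k l) \<odot> B.nf (?w k l) \<in> epsI m"
      using ab agree by (intro epsI_sm_low) (simp add: A.F_def B.F_def)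
    show "A.F b a k l \<odot> (B.nf (?w k l) - A.nf (?w k l)) \<in> epsI m"
    proof (cases "A.F b a k l = 0")
      case False
      then show ?thesis
        using step.IH [of k l] kl A.prec_F [OF ab False, of u v] by (intro epsI_sm) auto
    qed auto
  qed
  finally show ?case .
qed

lemma Phi_agree:
  assumes "P \<in> epsI k"
  shows "B.Phi P - A.Phi P \<in> epsI (k + m)"
proof -
  have "B.nf w - A.nf w \<in> epsI m" for w
    using nf_agree by (cases "set w \<subseteq> {..<n}") (auto simp: A.nf_outside B.nf_outside)
  then have "lin (\<lambda>w. B.nf w - A.nf w) P \<in> epsI (k + m)"
    by (intro epsI_lin_Suc assms) auto
  also have "lin (\<lambda>w. B.nf w - A.nf w) P = B.Phi P - A.Phi P"
    by (simp add: A.Phi_def B.Phi_def lin_def sm_diff_right sum_subtractf)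
  finally show ?thesis .
qed

text \<open>Changing constants at order \<open>m\<close> acts on the overlaps at this order through
  the linear Koszul term alone: the overlap is divisible by \<epsilon>, so exchanging the two
  reductions costs only order \<open>Suc m\<close>.\<close>

theorem obstruction_change:
  assumes "a < b" "b < c" "c < n" "sorted t"
  defines "\<delta> \<equiv> \<lambda>b a v. poly.coeff (coef (B.g b a) v) m - poly.coeff (coef (A.g b a) v) m"
  shows "poly.coeff (coef (B.Phi (B.overlap c b a)) t) m = poly.coeff (coef (A.Phi (A.overlap c b a)) t) m
     + A.bfac c (q c b * q c a) t * \<delta> b a (remove1 c t)
     - q c b * (A.bfac b (q b c * q b a) t * \<delta> c a (remove1 b t))
     + q b a * q c a * (A.bfac a (q a c * q a b) t * \<delta> c b (remove1 a t))"
proof -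
  define h where "h b a = B.g b a - A.g b a" for b a
  have h_eps: "h y x \<in> epsI m" if "x < y" "y < n" for x y
    unfolding epsI_iff h_def using that agree
    by (auto simp: lookup_minus A.coef_g B.coef_g split: list.splits)
  have h_keys: "sorted w \<and> set w \<subseteq> {..<n}" if "x < y" "y < n" "w \<in> Poly_Mapping.keys (h y x)" for x y w
  proof -
    have "w \<in> Poly_Mapping.keys (B.g y x) \<or> w \<in> Poly_Mapping.keys (A.g y x)"
      using that(3) keys_diff [of "B.g y x" "A.g y x"] unfolding h_def by blast
    then show ?thesis
    proof
      assume "w \<in> Poly_Mapping.keys (B.g y x)"
      then show ?thesis by (rule B.keys_g) (use B.G_supp that in fastforce)
    next
      assume "w \<in> Poly_Mapping.keys (A.g y x)"
      then show ?thesis by (rule A.keys_g) (use A.G_supp that in fastforce)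
    qed
  qed
  have lt: "a < n" "b < n" "a < c" using assms by auto
  have br: "poly.coeff (coef (A.Phi (A.bracket e \<chi> (h y x))) t) m = A.bfac e \<chi> t * \<delta> y x (remove1 e t)"
    if "x < y" "y < n" "e < n" for e \<chi> x y
  proof -
    have "poly.coeff (coef (A.Phi (A.bracket e \<chi> (h y x))) t) m
        = A.bfac e \<chi> t * poly.coeff (coef (h y x) (remove1 e t)) m"
      using that assms(4) by (intro A.bracket_coeff h_eps) (auto dest: h_keys)
    then show ?thesis by (simp add: \<delta>_def h_def lookup_minus)
  qed
  have "A.bracket = B.bracket" by (simp add: A.bracket_def B.bracket_def fun_eq_iff)
  then have D: "B.overlap c b a - A.overlap c b a = A.bracket c (q c b * q c a) (h b a)
     - [:q c b:] \<odot> A.bracket b (q b c * q b a) (h c a)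
     + [:q b a * q c a:] \<odot> A.bracket a (q a c * q a b) (h c b)"
    using assms lt
    by (simp add: A.overlap_eq_bracket B.overlap_eq_bracket h_def A.bracket_def algebra_simps
      sm_diff_right sm_add_right)
  have "B.overlap c b a \<in> epsI 1" using assms by (intro B.overlap_epsI) auto
  from Phi_agree [OF this]
  have "B.Phi (B.overlap c b a) - A.Phi (A.overlap c b a + (B.overlap c b a - A.overlap c b a)) \<in> epsI (Suc m)"
    by simp
  from epsI_coeff_cong [OF this, of t] show ?thesis
    unfolding D using assms lt by (simp add: A.Phi_linear lookup_add lookup_minus br)
qed

end

section \<open>The biresidue matrix and the weights of smoothable edges\<close>

text \<open>Constants are in the kernel as rows sum to 0, and the rank leaves room for nothing else:
  subtracting from \<open>z\<close> its value at the index of the one omitted column makes it a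
  linear relation between independent columns.\<close>

lemma kernel_of_corank_1:
  fixes lam :: "nat \<Rightarrow> nat \<Rightarrow> complex"
  assumes norm: "normalized n lam" and rk: "mat_rank n lam = n - 1"
    and z: "\<And>i. i < n \<Longrightarrow> (\<Sum>j<n. lam i j * z j) = 0"
    and ij: "i < n" "j < n"
  shows "z i = z j"
proof -
  interpret vec_space "TYPE(complex)" n .
  define A where "A = mat n n (\<lambda>(i, j). lam i j)"
  have A: "A \<in> carrier_mat n n" by (simp add: A_def)
  have "finite (set (cols A))" by simp
  then obtain S where S: "maximal S (\<lambda>T. T \<subseteq> set (cols A) \<and> lin_indpt T)"
    using maximal_exists_superset [of "set (cols A)" "\<lambda>T. T \<subseteq> set (cols A) \<and> lin_indpt T" "{}"]
      finite_lin_indpt2 [of "{}"] by (auto simp: lin_dep_def)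
  then have S_sub: "S \<subseteq> set (cols A)" and S_ind: "lin_indpt S"
    by (auto simp: maximal_def)
  have cS: "card S = n - 1"
    using rank_card_indpt [OF A S] rk by (simp add: mat_rank_def A_def)
  have finS: "finite S" using S_sub finite_subset by blast
  have "\<forall>s\<in>S. \<exists>k<n. col A k = s"
    using S_sub A unfolding cols_def by fastforce
  then obtain f where f: "\<And>s. s \<in> S \<Longrightarrow> f s < n \<and> col A (f s) = s" by metis
  have inj: "inj_on f S" using f by (metis inj_onI)
  have card_f: "card (f ` S) = n - 1" using card_image [OF inj] cS by simp
  \<comment> \<open>Independence concerns a set of vectors; \<open>f\<close> returns to indices, and
    exactly one index is left over.\<close>
  have "\<exists>p<n. f ` S = {..<n} - {p}"
  proof -
    have sub: "f ` S \<subseteq> {..<n}" using f by auto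
    then have "card ({..<n} - f ` S) = 1"
      using card_f ij finS by (simp add: card_Diff_subset)
    then obtain p where "{..<n} - f ` S = {p}" using card_1_singletonE by blast
    then show ?thesis using sub by auto
  qed
  then obtain p where p: "p < n" "f ` S = {..<n} - {p}" by blast
  have "lincomb (\<lambda>s. z (f s) - z p) S = 0\<^sub>v n"
  proof (rule eq_vecI)
    show "dim_vec (lincomb (\<lambda>s. z (f s) - z p) S) = dim_vec (0\<^sub>v n)"
      using S_sub A cols_dim [of A] by (simp add: lincomb_dim finS)
    fix i assume "i < dim_vec (0\<^sub>v n :: complex vec)"
    then have i: "i < n" by simp
    have "lincomb (\<lambda>s. z (f s) - z p) S $ i = (\<Sum>s\<in>S. (z (f s) - z p) * s $ i)"
      using S_sub A cols_dim [of A] i by (intro lincomb_index) auto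
    also have "\<dots> = (\<Sum>s\<in>S. (z (f s) - z p) * lam i (f s))"
    proof (intro sum.cong refl)
      fix s assume s: "s \<in> S"
      have "s $ i = col A (f s) $ i" using f [OF s] by simp
      then show "(z (f s) - z p) * s $ i = (z (f s) - z p) * lam i (f s)"
        using f [OF s] i by (simp add: A_def)
    qed
    also have "\<dots> = (\<Sum>k\<in>{..<n} - {p}. (z k - z p) * lam i k)"
      unfolding p(2) [symmetric] by (simp add: sum.reindex [OF inj])
    also have "\<dots> = (\<Sum>k<n. (z k - z p) * lam i k)"
      by (rule sum.mono_neutral_left) auto
    also have "\<dots> = (\<Sum>k<n. lam i k * z k) - z p * (\<Sum>k<n. lam i k)"
      by (simp add: algebra_simps sum_subtractf sum_distrib_left)
    also have "\<dots> = 0" using z i norm by (simp add: normalized_def)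
    finally show "lincomb (\<lambda>s. z (f s) - z p) S $ i = 0\<^sub>v n $ i" using i by simp
  qed
  moreover have "a s = 0" if "lincomb a S = 0\<^sub>v n" "s \<in> S" for a s
    using S_ind finS that unfolding lin_dep_def by (auto simp: class_ring_simps)
  ultimately have eq: "z (f s) - z p = 0" if "s \<in> S" for s using that by blast
  have "z k = z p" if "k < n" for k
  proof (cases "k = p")
    case False
    then have "k \<in> f ` S" using p(2) that by auto
    then show ?thesis using eq by auto
  qed auto
  then show ?thesis using ij by simp
qed

lemma matrix_inverse_exists:
  fixes A :: "nat \<Rightarrow> nat \<Rightarrow> complex"
  assumes inj: "\<And>z. (\<And>i. i < n \<Longrightarrow> (\<Sum>j<n. A i j * z j) = 0) \<Longrightarrow> (\<And>i. i < n \<Longrightarrow> z i = 0)"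
  obtains M where "\<And>i j. i < n \<Longrightarrow> j < n \<Longrightarrow> (\<Sum>k<n. A i k * M k j) = (if i = j then 1 else 0)"
    "\<And>i j. i < n \<Longrightarrow> j < n \<Longrightarrow> (\<Sum>k<n. M i k * A k j) = (if i = j then 1 else 0)"
proof -
  define X where "X = mat n n (\<lambda>(i, j). A i j)"
  have X: "X \<in> carrier_mat n n" by (simp add: X_def)
  have "det X \<noteq> 0"
  proof
    assume "det X = 0"
    then obtain v where v: "v \<in> carrier_vec n" "v \<noteq> 0\<^sub>v n" "X *\<^sub>v v = 0\<^sub>v n"
      using det_0_iff_vec_prod_zero_field [OF X] by blast
    have "(\<Sum>j<n. A i j * v $ j) = 0" if i: "i < n" for i
    proof -
      have "(X *\<^sub>v v) $ i = (\<Sum>j<n. A i j * v $ j)"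
        using v(1) i by (simp add: X_def scalar_prod_def lessThan_atLeast0)
      then show ?thesis using v i by simp
    qed
    then have "v $ i = 0" if "i < n" for i using inj [of "\<lambda>i. v $ i"] that by blast
    with v show False by auto
  qed
  then obtain Y where Y: "Y \<in> carrier_mat n n" "X * Y = 1\<^sub>m n" "Y * X = 1\<^sub>m n"
    using det_non_zero_imp_unit [OF X, of "TYPE(complex)"] unfolding Units_def ring_mat_def by auto
  have "(\<Sum>k<n. A i k * Y $$ (k, j)) = (if i = j then 1 else 0)"
    "(\<Sum>k<n. Y $$ (i, k) * A k j) = (if i = j then 1 else 0)" if "i < n" "j < n" for i j
  proof -
    have "(X * Y) $$ (i, j) = (\<Sum>k<n. A i k * Y $$ (k, j))"
      "(Y * X) $$ (i, j) = (\<Sum>k<n. Y $$ (i, k) * A k j)"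
      using that Y(1) by (simp_all add: X_def scalar_prod_def lessThan_atLeast0)
    then show "(\<Sum>k<n. A i k * Y $$ (k, j)) = (if i = j then 1 else 0)"
      "(\<Sum>k<n. Y $$ (i, k) * A k j) = (if i = j then 1 else 0)"
      using that Y(2,3) by simp_all
  qed
  then show thesis by (rule that)
qed

text \<open>For \<open>t = 1 / of_nat n\<close> the matrix is the projection onto vectors of sum 0
  along the constants.\<close>

lemma sum_delta_minus:
  fixes f :: "nat \<Rightarrow> complex"
  assumes "i < n"
  shows "(\<Sum>j<n. ((if i = j then 1 else 0) - t) * f j) = f i - t * (\<Sum>j<n. f j)"
    and "(\<Sum>j<n. f j * ((if j = i then 1 else 0) - t)) = f i - t * (\<Sum>j<n. f j)"
proof -
  have "(\<Sum>j<n. ((if i = j then 1 else 0) - t) * f j) = (\<Sum>j<n. (if i = j then f j else 0) - t * f j)"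
    by (intro sum.cong refl) (simp add: left_diff_distrib)
  also have "\<dots> = f i - t * (\<Sum>j<n. f j)"
    unfolding sum_subtractf sum_distrib_left using assms by simp
  finally show "(\<Sum>j<n. ((if i = j then 1 else 0) - t) * f j) = f i - t * (\<Sum>j<n. f j)" .
  have "(\<Sum>j<n. f j * ((if j = i then 1 else 0) - t)) = (\<Sum>j<n. (if j = i then f j else 0) - t * f j)"
    by (intro sum.cong refl) (simp add: right_diff_distrib)
  also have "\<dots> = f i - t * (\<Sum>j<n. f j)"
    unfolding sum_subtractf sum_distrib_left using assms by simp
  finally show "(\<Sum>j<n. f j * ((if j = i then 1 else 0) - t)) = f i - t * (\<Sum>j<n. f j)" .
qed

context
  fixes n :: nat and lam :: "nat \<Rightarrow> nat \<Rightarrow> complex"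
  assumes alt: "add_alt n lam" and norm: "normalized n lam" and rk: "mat_rank n lam = n - 1"
begin

lemma lam_row: "i < n \<Longrightarrow> (\<Sum>j<n. lam i j) = 0"
  using norm by (simp add: normalized_def)

lemma lam_alt: "i < n \<Longrightarrow> j < n \<Longrightarrow> lam j i = - lam i j"
  using alt unfolding add_alt_def by blast

lemma lam_col:
  assumes "j < n"
  shows "(\<Sum>i<n. lam i j) = 0"
proof -
  have "(\<Sum>i<n. lam i j) = (\<Sum>i<n. - lam j i)"
    by (intro sum.cong refl lam_alt) (use assms in auto)
  then show ?thesis using lam_row [OF assms] by (simp add: sum_negf)
qed

text \<open>The matrix with all entries 1 / n is the identity on constants and 0 on vectors of sum
  0, so adding it makes \<open>lam\<close> invertible. Subtracting it again from the inverse gives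
  \<open>b\<close>.\<close>

lemma pseudo_inverse_exists:
  obtains b where "\<And>i j. n \<le> i \<or> n \<le> j \<Longrightarrow> b i j = 0" "add_alt n b" "normalized n b"
    "\<And>i j. i < n \<Longrightarrow> j < n \<Longrightarrow> (\<Sum>k<n. lam i k * b k j) = (if i = j then 1 else 0) - 1 / of_nat n"
    "\<And>i j. i < n \<Longrightarrow> j < n \<Longrightarrow> (\<Sum>k<n. b i k * lam k j) = (if i = j then 1 else 0) - 1 / of_nat n"
proof -
  have inj: "z i = 0"
    if z: "\<And>i. i < n \<Longrightarrow> (\<Sum>j<n. (lam i j + 1 / of_nat n) * z j) = 0" and i: "i < n" for z i
  proof -
    have n: "(of_nat n :: complex) \<noteq> 0" using i by auto
    have e: "(\<Sum>j<n. lam i j * z j) + (\<Sum>j<n. z j) / of_nat n = 0" if "i < n" for i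
    proof -
      have "(\<Sum>j<n. 1 / of_nat n * z j) = (\<Sum>j<n. z j) / of_nat n"
        unfolding sum_divide_distrib by simp
      then show ?thesis using z [OF that] by (simp only: distrib_right sum.distrib)
    qed
    have "0 = (\<Sum>i<n. (\<Sum>j<n. lam i j * z j) + (\<Sum>j<n. z j) / of_nat n)"
      using e by simp
    also have "\<dots> = (\<Sum>i<n. \<Sum>j<n. lam i j * z j) + (\<Sum>j<n. z j)"
      using n by (simp add: sum.distrib)
    also have "(\<Sum>i<n. \<Sum>j<n. lam i j * z j) = (\<Sum>j<n. (\<Sum>i<n. lam i j) * z j)"
      unfolding sum_distrib_right by (rule sum.swap)
    also have "(\<Sum>j<n. (\<Sum>i<n. lam i j) * z j) + (\<Sum>j<n. z j) = (\<Sum>j<n. z j)"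
      by (simp add: lam_col)
    finally have s: "(\<Sum>j<n. z j) = 0" by simp
    have "(\<Sum>j<n. lam i j * z j) = 0" if "i < n" for i
      using e [OF that] s by simp
    then have "z j = z i" if "j < n" for j
      by (rule kernel_of_corank_1 [OF norm rk]) (use that i in auto)
    then have "(\<Sum>j<n. z j) = of_nat n * z i" by simp
    with s n show "z i = 0" by simp
  qed
  have "\<exists>M. (\<forall>i<n. \<forall>j<n. (\<Sum>k<n. (lam i k + 1 / of_nat n) * M k j) = (if i = j then 1 else 0)) \<and>
      (\<forall>i<n. \<forall>j<n. (\<Sum>k<n. M i k * (lam k j + 1 / of_nat n)) = (if i = j then 1 else 0))"
  proof (rule matrix_inverse_exists [of n "\<lambda>i j. lam i j + 1 / of_nat n"])
    fix z i assume "\<And>i. i < n \<Longrightarrow> (\<Sum>j<n. (lam i j + 1 / of_nat n) * z j) = 0" "i < n"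
    then show "z i = 0" by (rule inj)
  next
    fix M
    assume "\<And>i j. i < n \<Longrightarrow> j < n \<Longrightarrow> (\<Sum>k<n. (lam i k + 1 / of_nat n) * M k j) = (if i = j then 1 else 0)"
      "\<And>i j. i < n \<Longrightarrow> j < n \<Longrightarrow> (\<Sum>k<n. M i k * (lam k j + 1 / of_nat n)) = (if i = j then 1 else 0)"
    then show ?thesis by (intro exI [of _ M] conjI allI impI)
  qed
  then obtain M where M:
    "\<forall>i<n. \<forall>j<n. (\<Sum>k<n. (lam i k + 1 / of_nat n) * M k j) = (if i = j then 1 else 0)"
    "\<forall>i<n. \<forall>j<n. (\<Sum>k<n. M i k * (lam k j + 1 / of_nat n)) = (if i = j then 1 else 0)"
    by (elim exE conjE)
  have M1: "(\<Sum>k<n. (lam i k + 1 / of_nat n) * M k j) = (if i = j then 1 else 0)"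
    and M2: "(\<Sum>k<n. M i k * (lam k j + 1 / of_nat n)) = (if i = j then 1 else 0)"
    if "i < n" "j < n" for i j
    using M that by blast+
  \<comment> \<open>The shifted matrix fixes the all-one vector, hence so does its inverse.\<close>
  have row: "(\<Sum>k<n. M i k) = 1" if i: "i < n" for i
  proof -
    have n: "(of_nat n :: complex) \<noteq> 0" using i by auto
    have "1 = (\<Sum>j<n. \<Sum>k<n. M i k * (lam k j + 1 / of_nat n))" using i by (simp add: M2)
    also have "\<dots> = (\<Sum>k<n. M i k * (\<Sum>j<n. lam k j + 1 / of_nat n))"
      by (simp only: sum_distrib_left) (rule sum.swap)
    also have "\<dots> = (\<Sum>k<n. M i k)" using n by (simp add: sum.distrib lam_row)
    finally show ?thesis by simp
  qed
  have col: "(\<Sum>k<n. M k j) = 1" if j: "j < n" for j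
  proof -
    have n: "(of_nat n :: complex) \<noteq> 0" using j by auto
    have "1 = (\<Sum>i<n. \<Sum>k<n. (lam i k + 1 / of_nat n) * M k j)" using j by (simp add: M1)
    also have "\<dots> = (\<Sum>k<n. (\<Sum>i<n. lam i k + 1 / of_nat n) * M k j)"
      by (simp only: sum_distrib_right) (rule sum.swap)
    also have "\<dots> = (\<Sum>k<n. M k j)" using n by (simp add: sum.distrib lam_col)
    finally show ?thesis by simp
  qed
  define b where "b i j = (if i < n \<and> j < n then M i j - 1 / of_nat n else 0)" for i j
  have brow: "(\<Sum>k<n. b i k) = 0" if "i < n" for i
    using row [OF that] that by (simp add: b_def sum_subtractf)
  have bcol: "(\<Sum>k<n. b k j) = 0" if "j < n" for j
    using col [OF that] that by (simp add: b_def sum_subtractf)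
  have lb: "(\<Sum>k<n. lam i k * b k j) = (if i = j then 1 else 0) - 1 / of_nat n" if "i < n" "j < n" for i j
  proof -
    have "(\<Sum>k<n. lam i k * b k j)
        = (\<Sum>k<n. (lam i k + 1 / of_nat n) * M k j - 1 / of_nat n * M k j - 1 / of_nat n * lam i k)"
      using that by (intro sum.cong refl) (simp add: b_def distrib_right right_diff_distrib)
    also have "\<dots> = (\<Sum>k<n. (lam i k + 1 / of_nat n) * M k j) - 1 / of_nat n * (\<Sum>k<n. M k j)
        - 1 / of_nat n * (\<Sum>k<n. lam i k)"
      by (simp only: sum_subtractf sum_distrib_left)
    finally have "(\<Sum>k<n. lam i k * b k j) = (\<Sum>k<n. (lam i k + 1 / of_nat n) * M k j)
        - 1 / of_nat n * (\<Sum>k<n. M k j) - 1 / of_nat n * (\<Sum>k<n. lam i k)" .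
    then show ?thesis using that by (simp add: M1 col lam_row)
  qed
  have bl: "(\<Sum>k<n. b i k * lam k j) = (if i = j then 1 else 0) - 1 / of_nat n" if "i < n" "j < n" for i j
  proof -
    have "(\<Sum>k<n. b i k * lam k j)
        = (\<Sum>k<n. M i k * (lam k j + 1 / of_nat n) - 1 / of_nat n * M i k - 1 / of_nat n * lam k j)"
      using that by (intro sum.cong refl) (simp add: b_def distrib_left left_diff_distrib)
    also have "\<dots> = (\<Sum>k<n. M i k * (lam k j + 1 / of_nat n)) - 1 / of_nat n * (\<Sum>k<n. M i k)
        - 1 / of_nat n * (\<Sum>k<n. lam k j)"
      by (simp only: sum_subtractf sum_distrib_left)
    finally have "(\<Sum>k<n. b i k * lam k j) = (\<Sum>k<n. M i k * (lam k j + 1 / of_nat n))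
        - 1 / of_nat n * (\<Sum>k<n. M i k) - 1 / of_nat n * (\<Sum>k<n. lam k j)" .
    then show ?thesis using that by (simp add: M2 row lam_col)
  qed
  have b_alt: "add_alt n b"
    unfolding add_alt_def
  proof (intro allI impI)
    fix i j assume ij: "i < n" "j < n"
    \<comment> \<open>The bilinear form of \<open>lam\<close> on the columns \<open>i\<close> and
      \<open>j\<close> of \<open>b\<close> is evaluated from both sides.\<close>
    have "- b j i = (\<Sum>l<n. (- b l i) * ((if l = j then 1 else 0) - 1 / of_nat n))"
      using sum_delta_minus(2) [OF ij(2), of "\<lambda>l. - b l i" "1 / of_nat n"] bcol [OF ij(1)]
      by (simp add: sum_negf)
    also have "\<dots> = (\<Sum>l<n. (- b l i) * (\<Sum>k<n. lam l k * b k j))"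
      using ij by (intro sum.cong refl) (simp add: lb)
    also have "\<dots> = (\<Sum>l<n. \<Sum>k<n. lam k l * b l i * b k j)"
      unfolding sum_distrib_left
    proof (intro sum.cong refl)
      fix l k assume "l \<in> {..<n}" "k \<in> {..<n}"
      then have "lam l k = - lam k l" using lam_alt [of k l] by simp
      then show "- b l i * (lam l k * b k j) = lam k l * b l i * b k j" by simp
    qed
    also have "\<dots> = (\<Sum>k<n. (\<Sum>l<n. lam k l * b l i) * b k j)"
      unfolding sum_distrib_right by (rule sum.swap)
    also have "\<dots> = (\<Sum>k<n. ((if i = k then 1 else 0) - 1 / of_nat n) * b k j)"
      using ij by (intro sum.cong refl) (auto simp: lb)
    also have "\<dots> = b i j"
      using sum_delta_minus(1) [OF ij(1), of "1 / of_nat n" "\<lambda>k. b k j"] bcol [OF ij(2)] by simp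
    finally show "b j i = - b i j" by (metis minus_minus)
  qed
  have b_norm: "normalized n b" by (simp add: normalized_def brow)
  have b_out: "b i j = 0" if "n \<le> i \<or> n \<le> j" for i j using that by (auto simp: b_def)
  show thesis by (rule that [OF b_out b_alt b_norm lb bl])
qed

text \<open>Existence is the pseudo-inverse. For uniqueness a competitor is applied to the image
  under \<open>lam\<close> of a column of \<open>b0\<close>: this is a unit vector up to a constant
  vector, and the competitor kills constants.\<close>

lemma biresidue_properties:
  defines "b \<equiv> biresidue n lam"
  shows "add_alt n b" "normalized n b"
    "\<And>i j. i < n \<Longrightarrow> j < n \<Longrightarrow> (\<Sum>k<n. lam i k * b k j) = (if i = j then 1 else 0) - 1 / of_nat n"
proof -
  obtain b0 where out: "\<And>i j. n \<le> i \<or> n \<le> j \<Longrightarrow> b0 i j = 0"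
    and ba: "add_alt n b0" and bn: "normalized n b0"
    and lb: "\<And>i j. i < n \<Longrightarrow> j < n \<Longrightarrow> (\<Sum>k<n. lam i k * b0 k j) = (if i = j then 1 else 0) - 1 / of_nat n"
    and bl: "\<And>i j. i < n \<Longrightarrow> j < n \<Longrightarrow> (\<Sum>k<n. b0 i k * lam k j) = (if i = j then 1 else 0) - 1 / of_nat n"
    using pseudo_inverse_exists by blast
  have "biresidue n lam = b0"
    unfolding biresidue_def
  proof (rule the_equality)
    have "matvec n lam z \<in> Delta n \<and> matvec n b0 (matvec n lam z) = z" if z: "z \<in> Delta n" for z
    proof
      have "(\<Sum>i<n. \<Sum>j<n. lam i j * z j) = (\<Sum>j<n. (\<Sum>i<n. lam i j) * z j)"
        unfolding sum_distrib_right by (rule sum.swap)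
      then show "matvec n lam z \<in> Delta n" by (simp add: Delta_def matvec_def lam_col)
      show "matvec n b0 (matvec n lam z) = z"
      proof
        fix i
        show "matvec n b0 (matvec n lam z) i = z i"
        proof (cases "i < n")
          case True
          have "(\<Sum>k<n. b0 i k * (\<Sum>j<n. lam k j * z j)) = (\<Sum>j<n. (\<Sum>k<n. b0 i k * lam k j) * z j)"
            unfolding sum_distrib_left sum_distrib_right by (subst sum.swap) (simp add: mult.assoc)
          also have "\<dots> = (\<Sum>j<n. ((if i = j then 1 else 0) - 1 / of_nat n) * z j)"
            using True by (intro sum.cong refl) (simp add: bl)
          also have "\<dots> = z i"
            using sum_delta_minus(1) [OF True, of "1 / of_nat n" z] z by (simp add: Delta_def)
          finally show ?thesis using True by (simp add: matvec_def)
        next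
          case False
          then show ?thesis using z by (simp add: matvec_def Delta_def)
        qed
      qed
    qed
    then show "add_alt n b0 \<and> normalized n b0 \<and> (\<forall>i j. n \<le> i \<or> n \<le> j \<longrightarrow> b0 i j = 0) \<and>
      (\<forall>z\<in>Delta n. matvec n lam z \<in> Delta n \<and> matvec n b0 (matvec n lam z) = z)"
      using ba bn out by blast
  next
    fix b1 assume b1: "add_alt n b1 \<and> normalized n b1 \<and> (\<forall>i j. n \<le> i \<or> n \<le> j \<longrightarrow> b1 i j = 0) \<and>
      (\<forall>z\<in>Delta n. matvec n lam z \<in> Delta n \<and> matvec n b1 (matvec n lam z) = z)"
    show "b1 = b0"
    proof (intro ext)
      fix i j
      show "b1 i j = b0 i j"
      proof (cases "i < n \<and> j < n")
        case True
        define z where "z k = b0 k j" for k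
        have "b0 k j = - b0 j k" if "k < n" for k
          using ba True that unfolding add_alt_def by blast
        then have "(\<Sum>k<n. b0 k j) = - (\<Sum>k<n. b0 j k)"
          unfolding sum_negf [symmetric] by (intro sum.cong) auto
        then have "(\<Sum>k<n. b0 k j) = 0" using bn True by (simp add: normalized_def)
        then have z: "z \<in> Delta n" using out by (auto simp: z_def Delta_def)
        have "matvec n b1 (matvec n lam z) i = (\<Sum>k<n. b1 i k * ((if k = j then 1 else 0) - 1 / of_nat n))"
          using True by (auto simp: matvec_def z_def lb intro!: sum.cong)
        also have "\<dots> = b1 i j"
          using sum_delta_minus(2) [of j n "b1 i" "1 / of_nat n"] True b1 by (simp add: normalized_def)
        finally show ?thesis using b1 z by (simp add: z_def)
      next
        case False
        then show ?thesis using b1 out by (metis not_less)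
      qed
    qed
  qed
  then show "add_alt n b" "normalized n b"
    "\<And>i j. i < n \<Longrightarrow> j < n \<Longrightarrow> (\<Sum>k<n. lam i k * b k j) = (if i = j then 1 else 0) - 1 / of_nat n"
    using ba bn lb by (simp_all add: b_def)
qed

end

locale smoothing =
  fixes n :: nat and lam br :: "nat \<Rightarrow> nat \<Rightarrow> complex" and I :: "nat set"
  assumes alt: "add_alt n lam"
    and norm: "normalized n lam"
    and gen: "generic n lam"
    and b_def: "br = biresidue n lam"
    and I_sub: "I \<subseteq> {i. Suc i < n}"
    and smooth: "\<forall>i\<in>I. smoothable_edge n br i (Suc i)"
begin

lemma rank_lam: "mat_rank n lam = n - 1"
  using gen by (simp add: generic_def)

lemma b_alt: "i < n \<Longrightarrow> j < n \<Longrightarrow> br j i = - br i j"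
  using biresidue_properties(1) [OF alt norm rank_lam] unfolding b_def add_alt_def by blast

lemma b_row: "i < n \<Longrightarrow> (\<Sum>k<n. br i k) = 0"
  using biresidue_properties(2) [OF alt norm rank_lam] unfolding b_def normalized_def by blast

lemma lam_b: "i < n \<Longrightarrow> j < n \<Longrightarrow> (\<Sum>k<n. lam i k * br k j) = (if i = j then 1 else 0) - 1 / of_nat n"
  using biresidue_properties(3) [OF alt norm rank_lam] unfolding b_def .

lemma lam_antisym: "i < n \<Longrightarrow> j < n \<Longrightarrow> lam j i = - lam i j"
  using alt unfolding add_alt_def by blast

lemma finite_I: "finite I"
  by (rule finite_subset [OF I_sub]) (rule finite_subset [of _ "{..<n}"], auto)

lemma I_less: "i \<in> I \<Longrightarrow> i < n" "i \<in> I \<Longrightarrow> Suc i < n"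
  using I_sub by auto

definition B :: "nat \<Rightarrow> complex" where "B i = br i (Suc i)"

abbreviation th :: "nat \<Rightarrow> nat \<Rightarrow> int" where "th \<equiv> theta n br"

lemma B_nonzero: "i \<in> I \<Longrightarrow> B i \<noteq> 0"
  using smooth unfolding smoothable_edge_def B_def by blast

lemma th_minus: "i \<in> I \<Longrightarrow> th i i = -1" "i \<in> I \<Longrightarrow> th i (Suc i) = -1"
  by (auto simp: theta_def smoothable_weight_def)

lemma th_other:
  assumes "i \<in> I" "k < n" "k \<noteq> i" "k \<noteq> Suc i"
  shows "th i k \<ge> 0" "B i * of_int (th i k) = br (Suc i) k + br k i"
proof -
  obtain t :: nat where t: "(br (Suc i) k + br k i) / br i (Suc i) = of_nat t"
    using smooth assms unfolding smoothable_edge_def by blast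
  have "(THE t::int. of_int t = (br (Suc i) k + br k i) / br i (Suc i)) = int t"
    unfolding t by (rule the_equality) (auto, metis of_int_eq_iff of_int_of_nat_eq)
  then have th: "th i k = int t" using assms by (simp add: theta_def smoothable_weight_def)
  then show "th i k \<ge> 0" by simp
  show "B i * of_int (th i k) = br (Suc i) k + br k i"
    using t B_nonzero [OF assms(1)] by (simp add: th B_def field_simps)
qed

text \<open>One formula also covers the two entries -1, so \<open>B i\<close> times
  \<open>th i\<close> is a difference of two columns of the biresidue matrix.\<close>

lemma th_eq:
  assumes i: "i \<in> I" and k: "k < n"
  shows "B i * of_int (th i k) = br k i - br k (Suc i)"
proof -
  note lt = I_less [OF i]
  have d: "br k k = 0" using b_alt [OF k k] by (simp add: eq_neg_iff_add_eq_0 flip: mult_2)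
  consider "k = i" | "k = Suc i" | "k \<noteq> i" "k \<noteq> Suc i" by blast
  then show ?thesis
  proof cases
    case 1
    then show ?thesis using d th_minus [OF i] by (simp add: B_def)
  next
    case 2
    then show ?thesis using d th_minus [OF i] b_alt [OF lt(1) lt(2)] by (simp add: B_def)
  next
    case 3
    then show ?thesis using th_other [OF i k] b_alt [OF k lt(2)] by simp
  qed
qed

text \<open>The terms 1 / n of the two columns cancel. This sparse image is what the later weight
  computations rest on.\<close>

lemma lam_th:
  assumes i: "i \<in> I" and k: "k < n"
  shows "(\<Sum>j<n. lam k j * of_int (th i j)) = ((if k = i then 1 else 0) - (if k = Suc i then 1 else 0)) / B i"
proof -
  note lt = I_less [OF i]
  have "B i * (\<Sum>j<n. lam k j * of_int (th i j)) = (\<Sum>j<n. lam k j * (B i * of_int (th i j)))"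
    by (simp add: sum_distrib_left algebra_simps)
  also have "\<dots> = (\<Sum>j<n. lam k j * br j i) - (\<Sum>j<n. lam k j * br j (Suc i))"
    unfolding sum_subtractf [symmetric] by (intro sum.cong refl) (simp add: th_eq [OF i] algebra_simps)
  also have "\<dots> = (if k = i then 1 else 0) - (if k = Suc i then 1 else 0)"
    using lam_b [OF k lt(1)] lam_b [OF k lt(2)] by simp
  finally show ?thesis using B_nonzero [OF i] by (simp add: field_simps)
qed

lemma sum_th: "i \<in> I \<Longrightarrow> (\<Sum>k<n. th i k) = 0"
proof -
  assume i: "i \<in> I"
  note lt = I_less [OF i]
  have col: "(\<Sum>k<n. br k j) = 0" if "j < n" for j
  proof -
    have "(\<Sum>k<n. br k j) = (\<Sum>k<n. - br j k)" by (intro sum.cong refl b_alt) (use that in auto)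
    then show ?thesis using b_row [OF that] by (simp add: sum_negf)
  qed
  have "B i * of_int (\<Sum>k<n. th i k) = (\<Sum>k<n. br k i - br k (Suc i))"
    using th_eq [OF i] by (simp add: sum_distrib_left)
  also have "\<dots> = 0" using col lt by (simp add: sum_subtractf)
  finally have "of_int (\<Sum>k<n. th i k) = (0::complex)" using B_nonzero [OF i] by simp
  then show ?thesis by (simp only: of_int_eq_0_iff)
qed

text \<open>Partial sums of rows telescope the images of the weights, which are multiples of e_i -
  e_(i+1); the factor \<open>B i\<close> normalizes the value on \<open>th i\<close>.\<close>

definition dual :: "nat \<Rightarrow> nat \<Rightarrow> complex" where
  "dual i k = B i * (\<Sum>j\<le>i. lam j k)"

lemma dual_th:
  assumes "i \<in> I" "i' \<in> I"
  shows "(\<Sum>k<n. dual i k * of_int (th i' k)) = (if i = i' then 1 else 0)"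
proof -
  have "(\<Sum>k<n. dual i k * of_int (th i' k)) = (\<Sum>k<n. \<Sum>j\<le>i. B i * (lam j k * of_int (th i' k)))"
    by (simp add: dual_def sum_distrib_left sum_distrib_right mult.assoc)
  also have "\<dots> = (\<Sum>j\<le>i. B i * (\<Sum>k<n. lam j k * of_int (th i' k)))"
    unfolding sum_distrib_left by (rule sum.swap)
  also have "\<dots> = (\<Sum>j\<le>i. B i * (((if j = i' then 1 else 0) - (if j = Suc i' then 1 else 0)) / B i'))"
    using I_less [OF assms(1)] assms(2) by (intro sum.cong refl) (simp add: lam_th)
  also have "\<dots> = (\<Sum>j\<le>i. B i / B i' * ((if j = i' then 1 else 0) - (if j = Suc i' then 1 else 0)))"
    by simp
  also have "\<dots> = B i / B i' * ((\<Sum>j\<le>i. if j = i' then 1 else 0) - (\<Sum>j\<le>i. if j = Suc i' then 1 else 0))"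
    by (simp only: sum_subtractf [symmetric] sum_distrib_left)
  also have "\<dots> = (if i = i' then 1 else 0)"
    using B_nonzero [OF assms(1)] by (auto simp: not_le)
  finally show ?thesis .
qed

text \<open>The real part gives values that can be ordered; on each \<open>th i\<close> the sum of
  the functionals is already the real number 1.\<close>

definition level :: "nat \<Rightarrow> real" where
  "level k = Re (\<Sum>i\<in>I. dual i k)"

abbreviation Th :: "nat \<Rightarrow> (nat \<Rightarrow> int) set" where "Th \<equiv> Theta n br I"

lemma level_th: "i \<in> I \<Longrightarrow> (\<Sum>k<n. level k * of_int (th i k)) = 1"
proof -
  assume i: "i \<in> I"
  have "(\<Sum>k<n. level k * of_int (th i k)) = Re (\<Sum>k<n. \<Sum>i'\<in>I. dual i' k * of_int (th i k))"
    unfolding Re_sum level_def by (intro sum.cong refl) (simp flip: sum_distrib_right)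
  also have "(\<Sum>k<n. \<Sum>i'\<in>I. dual i' k * of_int (th i k)) = (\<Sum>i'\<in>I. \<Sum>k<n. dual i' k * of_int (th i k))"
    by (rule sum.swap)
  also have "\<dots> = (\<Sum>i'\<in>I. if i' = i then 1 else 0)"
    using i by (intro sum.cong refl) (simp add: dual_th)
  also have "\<dots> = 1" using i finite_I by simp
  finally show ?thesis by simp
qed

lemma level_Theta:
  assumes "w \<in> Th m"
  shows "(\<Sum>k<n. level k * of_int (w k)) = real m"
proof -
  obtain f where f: "\<forall>t<m. f t \<in> I" "w = (\<lambda>k. \<Sum>t<m. th (f t) k)"
    using assms by (auto simp: Theta_def)
  have "(\<Sum>k<n. level k * of_int (w k)) = (\<Sum>k<n. \<Sum>t<m. level k * of_int (th (f t) k))"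
    by (simp add: f(2) sum_distrib_left)
  also have "\<dots> = (\<Sum>t<m. \<Sum>k<n. level k * of_int (th (f t) k))" by (rule sum.swap)
  also have "\<dots> = (\<Sum>t<m. 1)" using f(1) by (intro sum.cong refl level_th) auto
  finally show ?thesis by simp
qed

text \<open>The power of \<epsilon> at which a constant occurs is thus determined by its weight, so
  constants of one level can be changed without touching the other powers.\<close>

lemma Theta_unique:
  assumes "w \<in> Th m" "w \<in> Th m'"
  shows "m = m'"
  using level_Theta [OF assms(1)] level_Theta [OF assms(2)] by simp

lemma Theta_0: "(\<lambda>_. 0) \<in> Th 0"
  by (simp add: Theta_def)

lemma Theta_1: "w \<in> Th (Suc 0) \<Longrightarrow> \<exists>i\<in>I. w = th i"
  by (auto simp: Theta_def)

lemma th_in_Theta: "i \<in> I \<Longrightarrow> th i \<in> Th (Suc 0)"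
  by (auto simp: Theta_def intro!: exI [of _ "\<lambda>_. i"])

lemma Theta_add:
  assumes "u \<in> Th s" "v \<in> Th r"
  shows "(\<lambda>k. u k + v k) \<in> Th (s + r)"
proof -
  obtain f g where f: "\<forall>t<s. f t \<in> I" "u = (\<lambda>k. \<Sum>t<s. th (f t) k)"
    and g: "\<forall>t<r. g t \<in> I" "v = (\<lambda>k. \<Sum>t<r. th (g t) k)"
    using assms by (auto simp: Theta_def)
  define h where "h t = (if t < s then f t else g (t - s))" for t
  have split: "(\<Sum>t<s + r. F t) = (\<Sum>t<s. F t) + (\<Sum>t<r. F (s + t))" for F :: "nat \<Rightarrow> int"
    by (induction r) auto
  have "(\<lambda>k. u k + v k) = (\<lambda>k. \<Sum>t<s + r. th (h t) k)"
    by (simp add: f(2) g(2) split h_def)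
  moreover have "\<forall>t<s + r. h t \<in> I" using f(1) g(1) by (auto simp: h_def)
  ultimately show ?thesis unfolding Theta_def by blast
qed

lemma Theta_multiplicities:
  assumes "w \<in> Th m"
  obtains \<mu> :: "nat \<Rightarrow> nat" where "\<And>i. \<mu> i \<noteq> 0 \<Longrightarrow> i \<in> I" "m = (\<Sum>i\<in>I. \<mu> i)"
    "w = (\<lambda>k. \<Sum>i\<in>I. int (\<mu> i) * th i k)"
proof -
  obtain f where f: "\<forall>t<m. f t \<in> I" "w = (\<lambda>k. \<Sum>t<m. th (f t) k)"
    using assms by (auto simp: Theta_def)
  define \<mu> where "\<mu> i = card {t\<in>{..<m}. f t = i}" for i
  have fI: "f ` {..<m} \<subseteq> I" using f(1) by auto
  have "\<mu> i \<noteq> 0 \<Longrightarrow> i \<in> I" for i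
    using f(1) by (auto simp: \<mu>_def card_eq_0_iff)
  moreover have "(\<Sum>i\<in>I. \<mu> i) = (\<Sum>i\<in>I. \<Sum>t | t \<in> {..<m} \<and> f t = i. 1)"
    by (simp add: \<mu>_def)
  then have "(\<Sum>i\<in>I. \<mu> i) = m"
    using sum.group [OF _ finite_I fI, of "\<lambda>_. 1 :: nat"] by simp
  moreover have "w = (\<lambda>k. \<Sum>i\<in>I. int (\<mu> i) * th i k)"
  proof
    fix k
    have "w k = (\<Sum>i\<in>I. \<Sum>t | t \<in> {..<m} \<and> f t = i. th (f t) k)"
      using sum.group [OF _ finite_I fI, of "\<lambda>t. th (f t) k"] by (simp add: f(2))
    also have "\<dots> = (\<Sum>i\<in>I. int (\<mu> i) * th i k)"
      by (intro sum.cong refl) (simp add: \<mu>_def)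
    finally show "w k = (\<Sum>i\<in>I. int (\<mu> i) * th i k)" .
  qed
  ultimately show thesis using that by metis
qed

lemma sum_Theta: "w \<in> Th m \<Longrightarrow> (\<Sum>k<n. w k) = 0"
proof -
  assume "w \<in> Th m"
  then obtain f where f: "\<forall>t<m. f t \<in> I" "w = (\<lambda>k. \<Sum>t<m. th (f t) k)"
    by (auto simp: Theta_def)
  have "(\<Sum>k<n. w k) = (\<Sum>t<m. \<Sum>k<n. th (f t) k)" unfolding f(2) by (rule sum.swap)
  also have "\<dots> = 0" using f(1) by (intro sum.neutral ballI sum_th) auto
  finally show ?thesis .
qed

lemma prod_EExp:
  "d < n \<Longrightarrow> (\<Prod>j<n. EExp lam d j powi w j) = exp (\<Sum>j<n. lam d j * of_int (w j))"
proof -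
  have "EExp lam d j powi w j = exp (lam d j * of_int (w j))" for j
    by (cases "w j" rule: int_cases2)
      (simp_all add: EExp_def power_int_minus exp_of_nat_mult exp_minus mult.commute [of "lam d j"])
  then show ?thesis by (simp add: exp_sum)
qed

text \<open>Both sides equal the cyclic sum of \<open>br\<close> over j, j+1, j+2. As the bracketed
  factors are positive integers, neighbouring \<open>B\<close> have a positive rational
  ratio.\<close>

lemma B_ratio:
  assumes "j \<in> I" "Suc j \<in> I"
  shows "B (Suc j) * (1 + of_int (th (Suc j) j)) = B j * (1 + of_int (th j (Suc (Suc j))))"
proof -
  note lt = I_less [OF assms(1)] I_less [OF assms(2)]
  have e: "B j * of_int (th j (Suc (Suc j))) = br (Suc (Suc j)) j - br (Suc (Suc j)) (Suc j)"
    "B (Suc j) * of_int (th (Suc j) j) = br j (Suc j) - br j (Suc (Suc j))"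
    using th_eq assms lt by auto
  show ?thesis
    unfolding distrib_left e using b_alt [OF lt(1) lt(4)] b_alt [OF lt(2) lt(4)] by (simp add: B_def)
qed

text \<open>Pair \<open>lam w\<close> with \<open>th j\<close> and move \<open>lam\<close> across by
  antisymmetry; \<open>lam_th\<close> then leaves two entries of \<open>w\<close>.\<close>

lemma weight_step:
  assumes j: "j \<in> I"
  shows "of_int (w (Suc j)) - of_int (w j) = B j * (\<Sum>k<n. of_int (th j k) * (\<Sum>l<n. lam k l * of_int (w l)))"
proof -
  note lt = I_less [OF j]
  have "(\<Sum>k<n. of_int (th j k) * (\<Sum>l<n. lam k l * of_int (w l)))
      = (\<Sum>k<n. \<Sum>l<n. of_int (th j k) * (lam k l * of_int (w l)))"
    by (simp add: sum_distrib_left)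
  also have "\<dots> = (\<Sum>l<n. \<Sum>k<n. of_int (th j k) * (lam k l * of_int (w l)))" by (rule sum.swap)
  also have "\<dots> = (\<Sum>l<n. - (\<Sum>k<n. lam l k * of_int (th j k)) * of_int (w l))"
    unfolding sum_negf [symmetric] sum_distrib_right
  proof (intro sum.cong refl)
    fix l k assume "l \<in> {..<n}" "k \<in> {..<n}"
    then have "lam k l = - lam l k" by (intro lam_antisym) auto
    then show "of_int (th j k) * (lam k l * of_int (w l)) = - (lam l k * of_int (th j k)) * of_int (w l)"
      by simp
  qed
  also have "\<dots> = (\<Sum>l<n. ((if l = Suc j then of_int (w l) else 0) - (if l = j then of_int (w l) else 0)) / B j)"
    using j by (intro sum.cong refl) (auto simp: lam_th)
  also have "\<dots> = (of_int (w (Suc j)) - of_int (w j)) / B j"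
    using lt by (simp add: sum_subtractf flip: sum_divide_distrib)
  finally show ?thesis using B_nonzero [OF j] by simp
qed

text \<open>Let \<open>w = \<Sum> \<mu>\<^sub>i \<theta>\<^sub>i\<close>. The sequence \<open>c\<^sub>i = \<mu>\<^sub>i / B\<^sub>i\<close> jumps exactly at the indices where
  \<open>\<lambda>w\<close> is nonzero. If \<open>w\<close> is Poisson-contributing these are among the at most three indices with
  entry \<open>-1\<close>, so \<open>c\<close> takes at most two nonzero values; comparing adjacent entries of \<open>w\<close> near
  the jumps is then contradictory as soon as at least two \<open>\<theta>\<^sub>i\<close> are involved.\<close>

lemma no_poisson_contrib:
  assumes w: "w \<in> Th m" and m: "m \<ge> 2"
    and ge: "\<And>i. i < n \<Longrightarrow> w i \<ge> -1" and card: "card {i. i < n \<and> w i = -1} \<le> 3"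
    and pc: "\<And>i. i < n \<Longrightarrow> w i \<ge> 0 \<Longrightarrow> (\<Sum>j<n. lam i j * of_int (w j)) = 0"
  shows False
proof -
  obtain \<mu> :: "nat \<Rightarrow> nat" where \<mu>: "\<And>i. \<mu> i \<noteq> 0 \<Longrightarrow> i \<in> I" "m = (\<Sum>i\<in>I. \<mu> i)"
    "w = (\<lambda>k. \<Sum>i\<in>I. int (\<mu> i) * th i k)"
    using Theta_multiplicities [OF w] by metis
  define c where "c i = (if i \<in> I then of_nat (\<mu> i) / B i else 0)" for i
  define v where "v k = (\<Sum>l<n. lam k l * of_int (w l))" for k
  have v_eq: "v k = c k - (if k = 0 then 0 else c (k - 1))" if k: "k < n" for k
  proof -
    have "v k = (\<Sum>l<n. \<Sum>i\<in>I. lam k l * (of_nat (\<mu> i) * of_int (th i l)))"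
      by (simp add: v_def \<mu>(3) sum_distrib_left)
    also have "\<dots> = (\<Sum>i\<in>I. \<Sum>l<n. lam k l * (of_nat (\<mu> i) * of_int (th i l)))" by (rule sum.swap)
    also have "\<dots> = (\<Sum>i\<in>I. of_nat (\<mu> i) * (\<Sum>l<n. lam k l * of_int (th i l)))"
      by (simp add: sum_distrib_left mult.left_commute)
    also have "\<dots> = (\<Sum>i\<in>I. (if k = i then c k else 0) - (if k = Suc i then c i else 0))"
      using k by (intro sum.cong refl) (auto simp: lam_th c_def)
    also have "\<dots> = c k - (\<Sum>i\<in>I. if k = Suc i then c i else 0)"
      using finite_I by (simp add: sum_subtractf c_def)
    also have "(\<Sum>i\<in>I. if k = Suc i then c i else 0) = (if k = 0 then 0 else c (k - 1))"
    proof (cases k)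
      case (Suc k')
      then have "(\<Sum>i\<in>I. if k = Suc i then c i else 0) = (\<Sum>i\<in>I. if k' = i then c i else 0)" by simp
      then show ?thesis using finite_I Suc by (simp add: c_def)
    qed simp
    finally show ?thesis .
  qed
  have c_nz: "c i \<noteq> 0 \<longleftrightarrow> \<mu> i \<noteq> 0" for i
    using \<mu>(1) B_nonzero by (auto simp: c_def)
  define S where "S = {i. \<mu> i \<noteq> 0}"
  have S: "finite S" "S \<subseteq> I" using \<mu>(1) finite_I finite_subset [of S I] by (auto simp: S_def)
  have "S \<noteq> {}"
  proof
    assume "S = {}"
    then have "\<mu> i = 0" for i by (auto simp: S_def)
    then show False using \<mu>(2) m by simp
  qed
  \<comment> \<open>The sequence \<open>c\<close> vanishes outside the range from \<open>a\<close>
    to \<open>e - 1\<close> and not at its ends, so it jumps at \<open>a\<close> and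
    \<open>e\<close>, which makes both entries -1.\<close>
  define a where "a = Min S"
  define e where "e = Suc (Max S)"
  have a: "a \<in> S" and eS: "Max S \<in> S" using S \<open>S \<noteq> {}\<close> by (auto simp: a_def)
  have S_bounds: "a \<le> i" "i < e" if "i \<in> S" for i
    using S(1) that by (auto simp: a_def e_def less_Suc_eq_le)
  have aI: "a \<in> I" using a S by auto
  have out: "c i = 0" if "i < a \<or> e \<le> i" for i
  proof -
    have "i \<notin> S" using that S_bounds [of i] by auto
    then show ?thesis using c_nz [of i] by (simp add: S_def)
  qed
  have ae: "a < e" using S a by (auto simp: e_def a_def less_Suc_eq_le)
  have en: "e < n" using eS S I_less by (auto simp: e_def)
  have an: "a < n" "Suc a < n" using aI I_less by auto
  have va: "v a = c a" using v_eq [OF an(1)] out [of "a - 1"] by (cases a) auto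
  have ve: "v e = - c (e - 1)" using v_eq [OF en] out [of e] by (auto simp: e_def)
  have c_a: "c a \<noteq> 0" and c_e: "c (e - 1) \<noteq> 0" using a eS c_nz by (auto simp: S_def e_def)
  have minus: "w k = -1" if "k < n" "v k \<noteq> 0" for k
    using pc [of k] ge [of k] that by (force simp: v_def)
  have wa: "w a = -1" and we: "w e = -1" using minus an en va ve c_a c_e by auto
  have step: "of_int (w (Suc j)) - of_int (w j) = B j * (\<Sum>k<n. of_int (th j k) * v k)" if "j \<in> I" for j
    unfolding v_def by (rule weight_step [OF that])
  show False
  \<comment> \<open>Without an inner jump \<open>c\<close> is constant between the ends, so the
    support is a full interval and \<open>lam w\<close> lives at \<open>a\<close> and
    \<open>e\<close> only.\<close>
  proof (cases "\<forall>k. a < k \<and> k < e \<longrightarrow> v k = 0")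
    case True
    have const: "c k = c a" if "a \<le> k" "k < e" for k
      using that
    proof (induction k rule: dec_induct)
      case (step k)
      then show ?case using v_eq [of "Suc k"] True en by simp
    qed simp
    have v_sum: "(\<Sum>k<n. f k * v k) = c a * (f a - f e)" for f :: "nat \<Rightarrow> complex"
    proof -
      have vz: "v k = 0" if k: "k < n" "k \<noteq> a" "k \<noteq> e" for k
      proof -
        consider "k < a" | "a < k" "k < e" | "e < k" using k by linarith
        then show ?thesis
        proof cases
          case 1
          then have "c k = 0" "c (k - 1) = 0" by (auto intro!: out)
          then show ?thesis using v_eq [OF k(1)] by simp
        next
          case 2
          then show ?thesis using True by auto
        next
          case 3
          then have "c k = 0" "c (k - 1) = 0" by (auto intro!: out)
          then show ?thesis using v_eq [OF k(1)] by simp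
        qed
      qed
      have "(\<Sum>k<n. f k * v k) = (\<Sum>k\<in>{a, e}. f k * v k)"
        using an en vz by (intro sum.mono_neutral_right) auto
      also have "\<dots> = c a * (f a - f e)"
        using ae va ve const [of "e - 1"] by (simp add: algebra_simps)
      finally show ?thesis .
    qed
    show False
    proof (cases "e = Suc a")
      case True
      have "S = {a}"
      proof
        show "S \<subseteq> {a}"
        proof
          fix i assume "i \<in> S"
          then show "i \<in> {a}" using S_bounds [of i] True by simp
        qed
      qed (use a in simp)
      have \<mu>0: "\<mu> i = 0" if "i \<noteq> a" for i
      proof -
        have "i \<notin> S" using \<open>S = {a}\<close> that by simp
        then show ?thesis by (simp add: S_def)
      qed
      \<comment> \<open>Only \<open>th a\<close> occurs, and the entry -1 at \<open>a\<close> forces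
        multiplicity 1, against \<open>m \<ge> 2\<close>.\<close>
      have "w a = (\<Sum>i\<in>{a}. int (\<mu> i) * th i a)"
        unfolding \<mu>(3) using aI \<mu>0 finite_I by (intro sum.mono_neutral_right) auto
      then have "\<mu> a = 1" using wa th_minus [OF aI] by simp
      moreover have "m = (\<Sum>i\<in>{a}. \<mu> i)"
        unfolding \<mu>(2) using aI \<mu>0 finite_I by (intro sum.mono_neutral_right) auto
      ultimately show False using m by simp
    next
      case False
      have te: "th a e \<ge> 0" using th_other [OF aI en] ae False by auto
      \<comment> \<open>The entry after \<open>a\<close> would be smaller than -1.\<close>
      have "of_int (w (Suc a)) - of_int (w a) = B a * (c a * (of_int (th a a) - of_int (th a e)))"
        unfolding step [OF aI] v_sum ..
      also have "\<dots> = of_int (int (\<mu> a) * (-1 - th a e))"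
        using B_nonzero [OF aI] aI th_minus [OF aI] by (simp add: c_def)
      finally have "of_int (w (Suc a) - w a) = (of_int (int (\<mu> a) * (-1 - th a e)) :: complex)" by simp
      then have "w (Suc a) - w a = int (\<mu> a) * (-1 - th a e)" by (simp only: of_int_eq_iff)
      moreover have "int (\<mu> a) * (-1 - th a e) \<le> 1 * (-1)"
      proof -
        have "1 * (1 + th a e) \<le> int (\<mu> a) * (1 + th a e)"
          using a te by (intro mult_right_mono) (auto simp: S_def)
        then show ?thesis using te by (simp add: algebra_simps)
      qed
      ultimately show False using wa ge [OF an(2)] by simp
    qed
  next
    case False
    \<comment> \<open>The inner jump uses up the third entry -1, so \<open>c\<close> has exactly two
      plateaus, of values \<open>s\<close> and \<open>r\<close>.\<close>
    then obtain p where p: "a < p" "p < e" "v p \<noteq> 0" by blast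
    have pn: "p < n" using p en by simp
    have wp: "w p = -1" using minus pn p by blast
    have N: "{i. i < n \<and> w i = -1} = {a, p, e}"
    proof (rule card_subset_eq [symmetric])
      show "{a, p, e} \<subseteq> {i. i < n \<and> w i = -1}" using an en pn wa we wp by auto
      have "card {a, p, e} = 3" using p by simp
      moreover from this card_mono [OF _ \<open>{a, p, e} \<subseteq> {i. i < n \<and> w i = -1}\<close>] card
      show "card {a, p, e} = card {i. i < n \<and> w i = -1}" by simp
    qed simp
    have other: "w k \<ge> 0" "v k = 0" if "k < n" "k \<noteq> a" "k \<noteq> p" "k \<noteq> e" for k
    proof -
      have "w k \<noteq> -1" using N that by blast
      then show "w k \<ge> 0" "v k = 0" using ge [OF that(1)] minus [OF that(1)] by auto
    qed
    define s where "s = c a"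
    define r where "r = c (e - 1)"
    have cs: "c k = s" if "a \<le> k" "k < p" for k
      using that
    proof (induction k rule: dec_induct)
      case (step k)
      then show ?case using v_eq [of "Suc k"] other(2) [of "Suc k"] pn p by simp
    qed (simp add: s_def)
    have cr: "c k = c p" if "p \<le> k" "k < e" for k
      using that
    proof (induction k rule: dec_induct)
      case (step k)
      then show ?case using v_eq [of "Suc k"] other(2) [of "Suc k"] en p by simp
    qed simp
    have cp: "c p = r" using cr [of "e - 1"] p by (simp add: r_def)
    have cp1: "c (p - 1) = s" by (rule cs) (use p in auto)
    have vp: "v p = r - s" using v_eq [OF pn] cp cp1 p by simp
    have v_sum: "(\<Sum>k<n. f k * v k) = s * (f a - f p) + r * (f p - f e)" for f :: "nat \<Rightarrow> complex"
    proof -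
      have "(\<Sum>k<n. f k * v k) = (\<Sum>k\<in>{a, p, e}. f k * v k)"
        using an en pn other by (intro sum.mono_neutral_right) auto
      also have "\<dots> = s * (f a - f p) + r * (f p - f e)"
      proof -
        have "(\<Sum>k\<in>{a, p, e}. f k * v k) = f a * v a + (f p * v p + f e * v e)" using p by simp
        also have "\<dots> = f a * s + (f p * (r - s) + f e * (- r))"
          unfolding va ve vp by (simp only: s_def r_def)
        finally show ?thesis by (simp add: algebra_simps)
      qed
      finally show ?thesis .
    qed
    have sr: "s \<noteq> 0" "r \<noteq> 0" using c_a c_e by (simp_all add: s_def r_def)
    have pI: "p \<in> I" using cp sr by (auto simp: c_def split: if_splits)
    have p1: "p - 1 \<in> I" using cp1 sr by (auto simp: c_def split: if_splits)
    have e1: "e - 1 \<in> I" using eS S by (auto simp: e_def)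
    have step': "of_int (w (Suc j)) - of_int (w j)
        = B j * (s * (of_int (th j a) - of_int (th j p)) + r * (of_int (th j p) - of_int (th j e)))"
      if "j \<in> I" for j
      unfolding step [OF that] v_sum ..
    \<comment> \<open>Adjacent entries -1 would make the step between them 0, but its factor
      \<open>-1 - th a e\<close> is negative.\<close>
    have "p \<noteq> Suc a"
    proof
      assume pa: "p = Suc a"
      have te: "th a e \<ge> 0" using th_other [OF aI en] p pa by auto
      have "B a * (r * (-1 - of_int (th a e))) = 0"
        using step' [OF aI] wa wp pa th_minus [OF aI] by simp
      then have "(of_int (-1 - th a e) :: complex) = 0"
        using B_nonzero [OF aI] sr by simp
      then have "-1 - th a e = 0" by (simp only: of_int_eq_0_iff)
      with te show False by simp
    qed
    have "e \<noteq> Suc p"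
    proof
      assume ep: "e = Suc p"
      have te: "th p a \<ge> 0" using th_other [OF pI an(1)] p by auto
      have "B p * (s * (of_int (th p a) + 1)) = 0"
        using step' [OF pI] wp we ep th_minus [OF pI] by simp
      then have "(of_int (th p a + 1) :: complex) = 0"
        using B_nonzero [OF pI] sr by simp
      then have "th p a + 1 = 0" by (simp only: of_int_eq_0_iff)
      with te show False by simp
    qed
    have mu_pos: "\<mu> a > 0" "\<mu> p > 0" "\<mu> (p - 1) > 0" "\<mu> (e - 1) > 0"
      using sr c_nz [of a] c_nz [of p] c_nz [of "p - 1"] c_nz [of "e - 1"] cp cs [of "p - 1"] p
      by (auto simp: s_def r_def)
    \<comment> \<open>This is the ratio of \<open>r\<close> to \<open>s\<close>, made visibly real
      and positive by \<open>B_ratio\<close> for the two edges meeting in \<open>p\<close>.\<close>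
    define x where "x = of_int (1 + th p (p - 1)) * of_nat (\<mu> p) / (of_int (1 + th (p - 1) (Suc p)) * of_nat (\<mu> (p - 1)) :: real)"
    have tp: "th p (p - 1) \<ge> 0" "th (p - 1) (Suc p) \<ge> 0"
      using th_other [OF pI, of "p - 1"] th_other [OF p1, of "Suc p"] p pn I_less [OF pI] by auto
    have x: "x > 0" unfolding x_def using tp mu_pos by (intro divide_pos_pos mult_pos_pos) auto
    have rs: "r = of_real x * s"
    proof -
      define u t :: complex where "u = of_int (1 + th p (p - 1))" and "t = of_int (1 + th (p - 1) (Suc p))"
      define y z :: complex where "y = of_nat (\<mu> p)" and "z = of_nat (\<mu> (p - 1))"
      have 1: "B p * u = B (p - 1) * t"
        using B_ratio [of "p - 1"] p1 pI p by (simp add: u_def t_def)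
      have 2: "r * B p = y" "s * B (p - 1) = z"
        using cp cp1 pI p1 B_nonzero [OF pI] B_nonzero [OF p1] by (auto simp: c_def y_def z_def)
      have "t \<noteq> 0" unfolding t_def of_int_eq_0_iff using tp by simp
      moreover have "z \<noteq> 0" using mu_pos by (simp add: z_def)
      ultimately have 3: "t * z \<noteq> 0" by simp
      have "of_real x = u * y / (t * z)" by (simp add: x_def u_def t_def y_def z_def)
      then have 4: "of_real x * (t * z) = u * y" using 3 by simp
      have "of_real x * s * (t * z) = (of_real x * (t * z)) * s" by (simp only: ac_simps)
      also have "\<dots> = (B p * u) * (r * s)" unfolding 4 2(1) [symmetric] by (simp only: ac_simps)
      also have "\<dots> = r * (t * z)" unfolding 1 2(2) [symmetric] by (simp only: ac_simps)
      finally show ?thesis using 3 by (metis mult_cancel_right)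
    qed
    \<comment> \<open>The entry after \<open>a\<close> is nonnegative, so the step there is
      positive; this will force \<open>x > 1\<close>.\<close>
    have A: "1 + real_of_int (th a p) < x * (real_of_int (th a p) - real_of_int (th a e))"
    proof -
      have "of_int (w (Suc a) - w a) = B a * s * (of_int (-1 - th a p) + of_real x * (of_int (th a p) - of_int (th a e)))"
        using step' [OF aI] rs th_minus [OF aI] by (simp add: algebra_simps)
      also have "B a * s = of_nat (\<mu> a)" using aI B_nonzero [OF aI] by (simp add: s_def c_def)
      finally have "complex_of_real (of_int (w (Suc a) - w a))
         = complex_of_real (of_nat (\<mu> a) * (of_int (-1 - th a p) + x * (of_int (th a p) - of_int (th a e))))" by simp
      then have eq: "real_of_int (w (Suc a) - w a)
          = real (\<mu> a) * (of_int (-1 - th a p) + x * (of_int (th a p) - of_int (th a e)))"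
        by (simp only: of_real_eq_iff)
      have "w (Suc a) \<ge> 0" using other(1) [OF an(2)] p \<open>p \<noteq> Suc a\<close> by auto
      then have "real_of_int (w (Suc a) - w a) > 0" using wa by simp
      with eq mu_pos(1) have "of_int (-1 - th a p) + x * (of_int (th a p) - of_int (th a e)) > (0::real)"
        by (metis of_nat_0_less_iff zero_less_mult_pos)
      then show ?thesis by simp
    qed
    define t where "t = th (e - 1)"
    \<comment> \<open>Symmetrically, the step into \<open>e\<close> is negative, which
      \<open>x > 1\<close> makes impossible.\<close>
    have E: "1 + real_of_int (t p) < (real_of_int (t p) - real_of_int (t a)) / x"
    proof -
      have "of_int (w e - w (e - 1)) = B (e - 1) * r * (of_int (t p + 1) + (of_int (t a) - of_int (t p)) / of_real x)"
      proof -
        have "s = r / of_real x" using rs x by simp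
        then have "of_int (w (Suc (e - 1))) - of_int (w (e - 1))
          = B (e - 1) * (r / of_real x * (of_int (t a) - of_int (t p)) + r * (of_int (t p) - of_int (t e)))"
          using step' [OF e1] by (simp only: t_def)
        moreover have "Suc (e - 1) = e" "t e = -1" using p th_minus(2) [OF e1] by (simp_all add: t_def)
        ultimately show ?thesis by (simp add: algebra_simps diff_divide_distrib)
      qed
      also have "B (e - 1) * r = of_nat (\<mu> (e - 1))" using e1 B_nonzero [OF e1] by (simp add: r_def c_def)
      finally have "complex_of_real (of_int (w e - w (e - 1)))
         = complex_of_real (of_nat (\<mu> (e - 1)) * (of_int (t p + 1) + (of_int (t a) - of_int (t p)) / x))" by simp
      then have eq: "real_of_int (w e - w (e - 1))
          = real (\<mu> (e - 1)) * (of_int (t p + 1) + (of_int (t a) - of_int (t p)) / x)"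
        by (simp only: of_real_eq_iff)
      have "w (e - 1) \<ge> 0" using other(1) [of "e - 1"] p en \<open>e \<noteq> Suc p\<close> by auto
      then have "real (\<mu> (e - 1)) * (of_int (t p + 1) + (of_int (t a) - of_int (t p)) / x) < 0"
        using eq we by simp
      then have "of_int (t p + 1) + (of_int (t a) - of_int (t p)) / x < 0"
        using mu_pos(4) by (simp add: mult_less_0_iff)
      then show ?thesis by (simp add: diff_divide_distrib)
    qed
    have nn: "th a p \<ge> 0" "th a e \<ge> 0" "t p \<ge> 0" "t a \<ge> 0"
      using th_other(1) [OF aI pn] th_other(1) [OF aI en] th_other(1) [OF e1 pn] th_other(1) [OF e1 an(1)]
        p \<open>p \<noteq> Suc a\<close> \<open>e \<noteq> Suc p\<close> by (auto simp: t_def)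
    have "x * (real_of_int (th a p) - real_of_int (th a e)) \<le> x * real_of_int (th a p)"
      using x nn by simp
    with A have "1 + real_of_int (th a p) < x * real_of_int (th a p)" by simp
    moreover have "x * real_of_int (th a p) \<le> 1 * real_of_int (th a p)" if "x \<le> 1"
      using that nn(1) by (intro mult_right_mono) auto
    ultimately have x1: "x > 1" by force
    have "(real_of_int (t p) - real_of_int (t a)) / x \<le> real_of_int (t p) / x"
      using x nn by (simp add: divide_right_mono)
    also have "\<dots> \<le> real_of_int (t p)"
    proof -
      have "real_of_int (t p) * 1 \<le> real_of_int (t p) * x"
        using x1 nn by (intro mult_left_mono) auto
      then show ?thesis using x by (simp add: pos_divide_le_eq)
    qed
    finally show False using E by simp
  qed
qed

theorem not_hochschild_contrib:
  assumes w: "w \<in> Th m" and m: "m \<ge> 2"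
    and ge: "\<And>i. i < n \<Longrightarrow> w i \<ge> -1" and card: "card {i. i < n \<and> w i = -1} \<le> 3"
  shows "\<exists>d<n. w d \<ge> 0 \<and> (\<Prod>j<n. EExp lam d j powi w j) \<noteq> 1"
proof (rule ccontr)
  assume *: "\<not> ?thesis"
  have "relevant n w" using ge sum_Theta [OF w] by (simp add: relevant_def)
  moreover have "hochschild_contrib n (EExp lam) w" using * ge by (auto simp: hochschild_contrib_def)
  ultimately have "poisson_contrib n lam w" using gen by (simp add: generic_def)
  then show False using no_poisson_contrib [OF w m ge card] by (auto simp: poisson_contrib_def)
qed

end

section \<open>Solving the overlap equations level by level\<close>

lemma epsI_SucI:
  "P \<in> epsI m \<Longrightarrow> (\<And>t. poly.coeff (coef P t) m = 0) \<Longrightarrow> P \<in> epsI (Suc m)"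
  by (auto simp: epsI_iff less_Suc_eq)

lemma sum_wt: "set v \<subseteq> {..<n} \<Longrightarrow> (\<Sum>k<n. f k * of_int (wt v k)) = (\<Sum>k\<leftarrow>v. f k :: 'a :: comm_ring_1)"
proof (induction v)
  case (Cons x v)
  have "(\<Sum>k<n. f k * of_int (wt (x # v) k)) = (\<Sum>k<n. (if x = k then f k else 0) + f k * of_int (wt v k))"
    by (intro sum.cong refl) (auto simp: algebra_simps)
  also have "\<dots> = f x + (\<Sum>k<n. f k * of_int (wt v k))"
    using Cons.prems by (simp add: sum.distrib)
  finally show ?case using Cons by simp
qed simp

lemma wt_nonneg: "wt v k \<ge> 0"
  by (simp add: wt_def)

lemma wt_pos_iff: "wt v k > 0 \<longleftrightarrow> k \<in> set v"
  by (simp add: wt_def count_list_0_iff zero_less_iff_neq_zero)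

lemma wt_remove1: "x \<in> set v \<Longrightarrow> wt (remove1 x v) k = wt v k - (if x = k then 1 else 0)"
  by (induction v) auto

lemma wt_sort [simp]: "wt (sort v) k = wt v k"
  by (simp add: wt_def flip: count_mset)

lemma length_2_sorted: "length v = 2 \<Longrightarrow> sorted v \<Longrightarrow> \<exists>k l. v = [k, l] \<and> k \<le> l"
  by (auto simp: length_Suc_conv numeral_2_eq_2)

context system_pair
begin

text \<open>Carries the orders already resolved over to the corrected constants.\<close>

lemma overlap_agree:
  assumes "a < b" "b < c" "c < n"
  shows "B.Phi (B.overlap c b a) - A.Phi (A.overlap c b a) \<in> epsI m"
proof -
  have h: "B.g y x - A.g y x \<in> epsI m" if "x < y" "y < n" for x y
    unfolding epsI_iff using that agree
    by (auto simp: lookup_minus A.coef_g B.coef_g split: list.splits)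
  have D: "B.overlap c b a - A.overlap c b a = mon [c] * (B.g b a - A.g b a)
     - [:q c b * q c a:] \<odot> ((B.g b a - A.g b a) * mon [c])
     - [:q c b:] \<odot> (mon [b] * (B.g c a - A.g c a)) + [:q b a:] \<odot> ((B.g c a - A.g c a) * mon [b])
     + [:q b a * q c a:] \<odot> (mon [a] * (B.g c b - A.g c b)) - (B.g c b - A.g c b) * mon [a]"
    by (simp add: A.overlap_def B.overlap_def algebra_simps sm_diff_right)
  have "B.overlap c b a - A.overlap c b a \<in> epsI m"
    unfolding D by (rule epsI_add epsI_diff epsI_sm epsI_mult_left epsI_mult_right h | use assms in linarith)+
  then have "A.Phi (B.overlap c b a - A.overlap c b a) \<in> epsI m" by (rule A.Phi_epsI)
  moreover have "B.Phi (B.overlap c b a) - A.Phi (B.overlap c b a) \<in> epsI m"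
    using Phi_agree [of "B.overlap c b a" 0] by simp
  ultimately have "(B.Phi (B.overlap c b a) - A.Phi (B.overlap c b a))
    + A.Phi (B.overlap c b a - A.overlap c b a) \<in> epsI m" by (intro epsI_add)
  then show ?thesis by (simp add: A.Phi_linear)
qed

end

context smoothing
begin

abbreviation q :: "nat \<Rightarrow> nat \<Rightarrow> complex" where "q \<equiv> EExp lam"

text \<open>The sum mirrors the form of the relations to be found; by \<open>Theta_unique\<close> at
  most one summand is nonzero.\<close>

definition GC :: "nat \<Rightarrow> (nat \<Rightarrow> nat \<Rightarrow> nat \<Rightarrow> nat \<Rightarrow> complex) \<Rightarrow> nat \<Rightarrow> nat \<Rightarrow> nat \<Rightarrow> nat \<Rightarrow> complex poly" where
  "GC N C b a k l = (if k \<le> l \<and> l < n then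
     (\<Sum>s\<in>{1..N}. if relw a b k l \<in> Th s then monom (C b a k l) s else 0) else 0)"

lemma coeff_GC: "poly.coeff (GC N C b a k l) s =
  (if k \<le> l \<and> l < n \<and> s \<in> {1..N} \<and> relw a b k l \<in> Th s then C b a k l else 0)"
proof -
  have "poly.coeff (\<Sum>s\<in>{1..N}. if relw a b k l \<in> Th s then monom (C b a k l) s else 0) s
     = (\<Sum>s'\<in>{1..N}. if s' = s then (if relw a b k l \<in> Th s then C b a k l else 0) else 0)"
    unfolding coeff_sum by (intro sum.cong refl) auto
  then show ?thesis by (auto simp: GC_def)
qed

lemma q_inverse: "i < n \<Longrightarrow> j < n \<Longrightarrow> q i j * q j i = 1"
proof -
  assume "i < n" "j < n"
  then have "lam j i = - lam i j" by (rule lam_antisym)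
  then show ?thesis by (simp add: EExp_def exp_minus)
qed

lemma q_refl: "i < n \<Longrightarrow> q i i = 1"
  using lam_antisym [of i i] by (simp add: EExp_def eq_neg_iff_add_eq_0 flip: mult_2)

lemma level_relw:
  assumes "a < n" "b < n" "k < n" "l < n" "relw a b k l \<in> Th s"
  shows "real s = level k + level l - level a - level b"
proof -
  have "real s = (\<Sum>j<n. level j * of_int (relw a b k l j))" using level_Theta [OF assms(5)] by simp
  also have "\<dots> = (\<Sum>j<n. level j * of_int (wt [k, l] j)) - (\<Sum>j<n. level j * of_int (wt [a, b] j))"
    by (simp only: relw_wt of_int_diff right_diff_distrib sum_subtractf)
  also have "\<dots> = level k + level l - level a - level b"
    using assms sum_wt [of "[k, l]" n level] sum_wt [of "[a, b]" n level]
    by (simp del: wt_simps)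
  finally show ?thesis .
qed

lemma graded_system_GC: "graded_system n level q (GC N C) Th"
proof
  show "q i j * q j i = 1" if "i < n" "j < n" for i j using that by (rule q_inverse)
  show "q i i = 1" if "i < n" for i using that by (rule q_refl)
  show "k \<le> l \<and> l < n \<and> level a + level b < level k + level l"
    if ab: "a < b" "b < n" and G: "GC N C b a k l \<noteq> 0" for a b k l
  proof -
    obtain s where "poly.coeff (GC N C b a k l) s \<noteq> 0"
      using G by (metis coeff_0 poly_eqI)
    then have s: "k \<le> l" "l < n" "s \<ge> 1" "relw a b k l \<in> Th s"
      by (auto simp: coeff_GC split: if_splits)
    then show ?thesis using level_relw [of a b k l s] ab by auto
  qed
qed (auto simp: coeff_GC Theta_0 Theta_add split: if_splits)

lemma prod_list_exp:
  "set v \<subseteq> {..<n} \<Longrightarrow> prod_list (map (q d) v) = exp (\<Sum>j<n. lam d j * of_int (wt v j))"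
  unfolding sum_wt by (induction v) (auto simp: EExp_def exp_add)

lemma prod_list_eq_iff:
  assumes "set v \<subseteq> {..<n}" "set s \<subseteq> {..<n}" "\<And>k. w k = wt v k - wt s k"
  shows "prod_list (map (q d) v) = prod_list (map (q d) s) \<longleftrightarrow> exp (\<Sum>j<n. lam d j * of_int (w j)) = 1"
proof -
  have "(\<Sum>j<n. lam d j * of_int (w j)) = (\<Sum>j<n. lam d j * of_int (wt v j)) - (\<Sum>j<n. lam d j * of_int (wt s j))"
    by (simp only: assms(3) of_int_diff right_diff_distrib sum_subtractf)
  then show ?thesis using assms(1,2) by (simp add: prod_list_exp exp_diff)
qed

definition regular_at :: "nat \<Rightarrow> (nat \<Rightarrow> int) \<Rightarrow> bool" where
  "regular_at d w \<longleftrightarrow> d < n \<and> w d \<ge> 0 \<and> exp (\<Sum>j<n. lam d j * of_int (w j)) \<noteq> 1"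

text \<open>Subtracting distinct letters from the weight of a word creates entries -1 only at these
  letters. Sets of three serve the overlaps, sets of two the relations.\<close>

lemma regular_index_exists:
  assumes "w \<in> Th m" "m \<ge> 2" "finite S" "card S \<le> 3" "\<And>k. w k = wt v k - (if k \<in> S then 1 else 0)"
  shows "\<exists>d. regular_at d w"
proof -
  have "w k \<ge> -1" for k using assms(5) [of k] wt_nonneg [of v k] by auto
  moreover have "k \<in> S" if "w k = -1" for k
    using that assms(5) [of k] wt_nonneg [of v k] by (auto split: if_splits)
  then have "{i. i < n \<and> w i = -1} \<subseteq> S" by auto
  then have "card {i. i < n \<and> w i = -1} \<le> 3"
    using assms(3,4) card_mono le_trans by blast
  ultimately obtain d where "d < n" "w d \<ge> 0" "(\<Prod>j<n. q d j powi w j) \<noteq> 1"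
    using not_hochschild_contrib [OF assms(1,2)] by blast
  then show ?thesis by (auto simp: regular_at_def prod_EExp)
qed

lemma length_of_weight:
  assumes "set t \<subseteq> {..<n}" "set s \<subseteq> {..<n}" "(\<lambda>k. wt t k - wt s k) \<in> Th m"
  shows "length t = length s"
proof -
  have 1: "(\<Sum>k<n. wt v k) = int (length v)" if "set v \<subseteq> {..<n}" for v
    using sum_wt [OF that, of "\<lambda>_. 1 :: int"] by (simp add: sum_list_triv)
  show ?thesis using sum_Theta [OF assms(3)] 1 assms(1,2) by (simp add: sum_subtractf)
qed

text \<open>The two entries -1 of \<open>th i\<close> can only come from \<open>y\<close> and
  \<open>z\<close>, so \<open>x\<close> is no endpoint of the edge and \<open>lam_th\<close> gives 0
  there.\<close>

lemma first_order_term: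
  assumes "{x, y, z} \<subseteq> {..<n}" "x \<noteq> y" "x \<noteq> z" "y \<noteq> z" "relw y z k l \<in> Th (Suc 0)" "k < n" "l < n"
  shows "prod_list (map (q x) [k, l]) = q x z * q x y"
proof -
  obtain i where i: "i \<in> I" "relw y z k l = th i" using Theta_1 [OF assms(5)] by blast
  have "j \<in> {y, z}" if j: "th i j = -1" for j
  proof (rule ccontr)
    assume "j \<notin> {y, z}"
    then have "wt [y, z] j = 0" by simp
    moreover have "wt [k, l] j - wt [y, z] j = -1"
      using j unfolding i(2) [symmetric] relw_wt .
    ultimately show False using wt_nonneg [of "[k, l]" j] by linarith
  qed
  from this [OF th_minus(1) [OF i(1)]] this [OF th_minus(2) [OF i(1)]]
  have "x \<noteq> i" "x \<noteq> Suc i" using assms by auto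
  then have "(\<Sum>j<n. lam x j * of_int (th i j)) = 0" using lam_th [OF i(1)] assms(1) by simp
  then have "prod_list (map (q x) [k, l]) = prod_list (map (q x) [y, z])"
    using prod_list_eq_iff [of "[k, l]" "[y, z]" "th i" x] assms i(2) [symmetric] by (simp add: relw_wt)
  then show ?thesis by (simp add: mult.commute)
qed

definition all_overlaps :: "nat \<Rightarrow> (nat \<Rightarrow> nat \<Rightarrow> nat \<Rightarrow> nat \<Rightarrow> complex) \<Rightarrow> nat \<Rightarrow> bool" where
  "all_overlaps N C m \<longleftrightarrow> (\<forall>a b c. a < b \<and> b < c \<and> c < n \<longrightarrow>
     reduction_system.Phi n q (GC N C) (reduction_system.overlap n q (GC N C) c b a) \<in> epsI m)"

text \<open>Measured against the undeformed algebra, the first-order overlap is a sum of brackets;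
  in each, either the word has a weight outside the first level or its factor \<open>bfac\<close> is
  0.\<close>

lemma stage_1:
  assumes "\<And>a b k l. relw a b k l \<in> Th (Suc 0) \<Longrightarrow> C b a k l = 1"
  shows "all_overlaps (Suc 0) C (Suc (Suc 0))"
  unfolding all_overlaps_def
proof (intro allI impI)
  fix a b c assume abc: "a < b \<and> b < c \<and> c < n"
  \<comment> \<open>Truncation at 0 is the undeformed algebra, whose overlaps are 0.\<close>
  interpret A: graded_system n level q "GC 0 C" Th by (rule graded_system_GC)
  interpret B: graded_system n level q "GC (Suc 0) C" Th by (rule graded_system_GC)
  interpret P: system_pair n level q "GC 0 C" "GC (Suc 0) C" "Suc 0"
    by unfold_locales (auto simp: coeff_GC)
  have G0: "GC 0 C y x k l = 0" for y x k l by (simp add: GC_def)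
  have A0: "A.overlap c b a = 0" by (simp add: A.overlap_def A.g_def G0)
  have zero: "A.bfac x (q x z * q x y) t * (poly.coeff (coef (B.g z y) (remove1 x t)) (Suc 0)
      - poly.coeff (coef (A.g z y) (remove1 x t)) (Suc 0)) = 0"
    if "{x, y, z} \<subseteq> {..<n}" "x \<noteq> y" "x \<noteq> z" "y \<noteq> z" for x y z t
  proof (cases "\<exists>k l. remove1 x t = [k, l] \<and> k < n \<and> l < n \<and> relw y z k l \<in> Th (Suc 0)")
    case True
    then obtain k l where "remove1 x t = [k, l]" "k < n" "l < n" "relw y z k l \<in> Th (Suc 0)" by blast
    then have "A.bfac x (q x z * q x y) t = 0"
      using first_order_term [of x y z k l] that by (simp add: A.bfac_def)
    then show ?thesis by simp
  next
    case False
    then have "poly.coeff (coef (B.g z y) (remove1 x t)) (Suc 0) = 0"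
      by (auto simp: B.coef_g coeff_GC split: list.splits)
    moreover have "coef (A.g z y) (remove1 x t) = 0"
      by (auto simp: A.coef_g G0 split: list.splits)
    ultimately show ?thesis by simp
  qed
  have "poly.coeff (coef (B.Phi (B.overlap c b a)) t) (Suc 0) = 0" for t
  proof (cases "sorted t")
    case True
    have lt: "a < b" "b < c" "c < n" using abc by auto
    note z = zero [of c a b t] zero [of b a c t] zero [of a b c t]
    show ?thesis
      unfolding P.obstruction_change [OF lt True]
      using abc by (simp only: z A0) (simp add: z A.Phi_linear)
  next
    case False
    then have "t \<notin> Poly_Mapping.keys (B.Phi (B.overlap c b a))" using B.Phi_keys by blast
    then show ?thesis by (simp add: in_keys_iff)
  qed
  moreover have "B.Phi (B.overlap c b a) \<in> epsI (Suc 0)"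
    using abc B.overlap_epsI by (intro B.Phi_epsI) auto
  ultimately show "B.Phi (B.overlap c b a) \<in> epsI (Suc (Suc 0))"
    using epsI_SucI by blast
qed

text \<open>Depends on the weight alone: overlaps of the same weight must be treated with the same
  letter, as the cocycle with this letter relates them.\<close>

definition pick :: "(nat \<Rightarrow> int) \<Rightarrow> nat" where
  "pick w = (SOME d. regular_at d w)"

lemma pick_regular:
  assumes "a < b" "b < c" "(\<lambda>k. wt t k - wt [a, b, c] k) \<in> Th m" "m \<ge> 2"
  shows "regular_at (pick (\<lambda>k. wt t k - wt [a, b, c] k)) (\<lambda>k. wt t k - wt [a, b, c] k)"
  unfolding pick_def
proof (rule someI_ex, rule regular_index_exists [OF assms(3,4)])
  show "card {a, b, c} \<le> 3" using card_insert_le_m1 [of 3] by (simp add: card_insert_if)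
qed (use assms in auto)

text \<open>Since \<open>kappa\<close> never vanishes, \<open>bfac\<close> could be 0 only if x_d
  passed the remaining word and \<open>s\<close> with the same scalar, which regularity rules
  out.\<close>

lemma bfac_nonzero:
  assumes "regular_at d w" "set t \<subseteq> {..<n}" "d \<in> set t" "set s \<subseteq> {..<n}"
    "\<And>k. w k = wt (remove1 d t) k - wt s k"
  shows "reduction_system.bfac n q (GC N C) d (prod_list (map (q d) s)) t \<noteq> 0"
proof -
  interpret A: graded_system n level q "GC N C" Th by (rule graded_system_GC)
  have sub: "set (remove1 d t) \<subseteq> {..<n}" using assms(2) set_remove1_subset by fast
  have "prod_list (map (q d) (remove1 d t)) \<noteq> prod_list (map (q d) s)"
    using prod_list_eq_iff [OF sub assms(4,5)] assms(1) by (simp add: regular_at_def)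
  moreover have "A.kappa (remove1 d t @ [d]) \<noteq> 0"
    using sub assms(1) by (intro A.kappa) (auto simp: regular_at_def)
  ultimately show ?thesis using assms(3) by (simp add: A.bfac_def)
qed

text \<open>Only constants with weight in \<open>Th (Suc m)\<close> are overwritten, so lower levels
  keep their values and their resolved overlaps.\<close>

lemma stage_step:
  assumes ov: "all_overlaps m C (Suc m)" and m: "m \<ge> 1"
  obtains C' where "all_overlaps (Suc m) C' (Suc (Suc m))"
    "\<And>a b k l. relw a b k l \<notin> Th (Suc m) \<Longrightarrow> C' b a k l = C b a k l"
proof -
  define M where "M = Suc m"
  have M: "M \<ge> 2" using m by (simp add: M_def)
  interpret A: graded_system n level q "GC m C" Th by (rule graded_system_GC)
  define ob where "ob c b a v = poly.coeff (coef (A.Phi (A.overlap c b a)) v) M" for c b a v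
  define bf where "bf d b a t = A.bfac d (q d b * q d a) t" for d b a t
  \<comment> \<open>Each case solves \<open>obstruction_change\<close> for the overlap of
    \<open>a\<close>, \<open>b\<close>, \<open>d\<close>, according to the place of \<open>d\<close>
    in the order. If \<open>d\<close> is \<open>a\<close> or \<open>b\<close>, no such overlap
    exists and the correction is 0.\<close>
  define cor where "cor b a d t =
    (if d > b then - ob d b a t / bf d b a t
     else if a < d \<and> d < b then ob b d a t / (q b d * bf d b a t)
     else if d < a then - ob b a d t / (q a d * q b d * bf d b a t) else 0)" for b a d t
  \<comment> \<open>Putting \<open>d\<close> back recovers the word at which the obstruction is read
    off.\<close>
  define st where "st k l d = sort [k, l, d]" for k l d :: nat
  define C' where "C' b a k l = (if relw a b k l \<in> Th M
    then cor b a (pick (relw a b k l)) (st k l (pick (relw a b k l))) else C b a k l)" for b a k l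
  interpret B: graded_system n level q "GC M C'" Th by (rule graded_system_GC)
  interpret P: system_pair n level q "GC m C" "GC M C'" M
  proof
    fix a b j k l assume "a < b" "b < n" "j < M"
    then show "poly.coeff (GC M C' b a k l) j = poly.coeff (GC m C b a k l) j"
      using Theta_unique [of "relw a b k l" j M] by (auto simp: coeff_GC C'_def M_def)
  qed
  define ob' where "ob' c b a v = poly.coeff (coef (B.Phi (B.overlap c b a)) v) M" for c b a v
  define dl where "dl b a v = poly.coeff (coef (B.g b a) v) M - poly.coeff (coef (A.g b a) v) M" for b a v
  have change: "ob' c b a t = ob c b a t + bf c b a t * dl b a (remove1 c t)
     - q c b * (bf b c a t * dl c a (remove1 b t)) + q b a * q c a * (bf a c b t * dl c b (remove1 a t))"
    if "a < b" "b < c" "c < n" "sorted t" for a b c t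
    unfolding ob'_def ob_def bf_def dl_def using that by (rule P.obstruction_change)
  have q_nz: "q i j \<noteq> 0" for i j by (simp add: EExp_def)
  have ov_B: "B.Phi (B.overlap c b a) \<in> epsI M" if "a < b" "b < c" "c < n" for a b c
  proof -
    have "A.Phi (A.overlap c b a) \<in> epsI M" using ov that by (simp add: all_overlaps_def M_def)
    from epsI_add [OF P.overlap_agree [OF that] this] show ?thesis by simp
  qed
  have "M \<le> m \<longleftrightarrow> False" "Suc 0 \<le> M" by (auto simp: M_def)
  then have dl: "dl z y [k, l] = cor z y (pick (relw y z k l)) (st k l (pick (relw y z k l)))"
    if "k \<le> l" "l < n" "relw y z k l \<in> Th M" for y z k l
    using that by (simp add: dl_def A.coef_g B.coef_g coeff_GC C'_def)
  \<comment> \<open>For overlaps containing \<open>d\<close>, only the bracket with \<open>d\<close>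
    contributes to the change, and \<open>cor\<close> was chosen to make it cancel the
    obstruction.\<close>
  have zero_in: "ob' c b a t = 0"
    if abc: "a < b" "b < c" "c < n" and t: "sorted t" "set t \<subseteq> {..<n}"
      and w: "w = (\<lambda>k. wt t k - wt [a, b, c] k)" "w \<in> Th M" and D: "d = pick w" "d \<in> {a, b, c}"
    for a b c t w d
  proof -
    have reg: "regular_at d w" unfolding D(1) w(1) using abc M w by (intro pick_regular) auto
    have wt3: "wt [a, b, c] d = 1" using D(2) abc by auto
    have "w d \<ge> 0" "d < n" using reg by (auto simp: regular_at_def)
    then have dt: "d \<in> set t" using w(1) wt3 wt_pos_iff [of t d] by (simp del: wt_simps)
    have len: "length t = 3" using length_of_weight [OF t(2), of "[a, b, c]" M] w abc by auto
    have pair: "\<exists>k l. remove1 x t = [k, l] \<and> k \<le> l \<and> k < n \<and> l < n \<and> relw y z k l = w \<and> st k l x = t"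
      if x: "x \<in> set t" and xyz: "\<And>k. wt [a, b, c] k = wt [x, y, z] k" for x y z
    proof -
      have "length (remove1 x t) = 2" using x len by (simp add: length_remove1)
      then obtain k l where kl: "remove1 x t = [k, l]" "k \<le> l"
        using length_2_sorted [of "remove1 x t"] t(1) by (auto simp: sorted_remove1)
      have "set [k, l] \<subseteq> {..<n}" unfolding kl(1) [symmetric] using t(2) set_remove1_subset by fast
      moreover have "relw y z k l = w"
      proof
        fix j
        have "wt [k, l] j = wt t j - (if x = j then 1 else 0)"
          unfolding kl(1) [symmetric] using x by (rule wt_remove1)
        moreover have "wt [x, y, z] j = (if x = j then 1 else 0) + wt [y, z] j" by (rule wt_simps(2))
        ultimately show "relw y z k l j = w j" unfolding relw_wt w(1) xyz by linarith
      qed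
      moreover have "st k l x = t"
        unfolding st_def
      proof (rule properties_for_sort)
        have "mset t = add_mset x (mset (remove1 x t))" using x by simp
        then show "mset t = mset [k, l, x]" unfolding kl(1) by simp
      qed (fact t(1))
      ultimately show ?thesis using kl by auto
    qed
    \<comment> \<open>The pair left behind contains \<open>d\<close>, and \<open>cor\<close> is 0
      there.\<close>
    have other: "bf x z y t * dl z y (remove1 x t) = 0"
      if xyz: "\<And>k. wt [a, b, c] k = wt [x, y, z] k" "y < z" "d = y \<or> d = z" for x y z
    proof (cases "x \<in> set t")
      case True
      from pair [OF True xyz(1)] obtain k l where
        "remove1 x t = [k, l]" "k \<le> l" "l < n" "relw y z k l = w" by blast
      moreover have "cor z y d s = 0" for s using xyz(2,3) by (auto simp: cor_def)
      ultimately show ?thesis using dl [of k l y z] w(2) D(1) by simp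
    next
      case False
      then show ?thesis by (simp add: bf_def A.bfac_def)
    qed
    have main: "bf d z y t \<noteq> 0 \<and> dl z y (remove1 d t) = cor z y d t"
      if yz: "\<And>k. wt [a, b, c] k = wt [d, y, z] k" "y < n" "z < n" for y z
    proof -
      from pair [OF dt yz(1)] obtain k l where kl: "remove1 d t = [k, l]" "k \<le> l" "l < n"
        "relw y z k l = w" "st k l d = t" by blast
      have "A.bfac d (prod_list (map (q d) [z, y])) t \<noteq> 0"
      proof (rule bfac_nonzero [OF reg t(2) dt])
        show "w j = wt (remove1 d t) j - wt [z, y] j" for j
          unfolding kl(1,4) [symmetric] relw_wt by simp
      qed (use yz in auto)
      moreover have "dl z y (remove1 d t) = cor z y d t"
        using dl [OF kl(2,3), of y z] kl w(2) D(1) by simp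
      ultimately show ?thesis by (simp add: bf_def)
    qed
    consider "d = c" | "d = b" | "d = a" using D(2) by blast
    then show ?thesis
    proof cases
      case 1
      have z: "bf b c a t * dl c a (remove1 b t) = 0" "bf a c b t * dl c b (remove1 a t) = 0"
        using abc 1 by (intro other; auto)+
      have "bf c b a t \<noteq> 0 \<and> dl b a (remove1 c t) = cor b a c t"
        unfolding 1 [symmetric] using abc by (intro main) (auto simp: 1)
      then show ?thesis unfolding change [OF abc t(1)] z using abc by (simp add: cor_def)
    next
      case 2
      have z: "bf c b a t * dl b a (remove1 c t) = 0" "bf a c b t * dl c b (remove1 a t) = 0"
        using abc 2 by (intro other; auto)+
      have "bf b c a t \<noteq> 0 \<and> dl c a (remove1 b t) = cor c a b t"
        unfolding 2 [symmetric] using abc by (intro main) (auto simp: 2)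
      then show ?thesis unfolding change [OF abc t(1)] z using abc q_nz [of c b] by (simp add: cor_def)
    next
      case 3
      have z: "bf c b a t * dl b a (remove1 c t) = 0" "bf b c a t * dl c a (remove1 b t) = 0"
        using abc 3 by (intro other; auto)+
      have "bf a c b t \<noteq> 0 \<and> dl c b (remove1 a t) = cor c b a t"
        unfolding 3 [symmetric] using abc by (intro main) (auto simp: 3)
      then show ?thesis unfolding change [OF abc t(1)] z using abc q_nz [of b a] q_nz [of c a] by (simp add: cor_def)
    qed
  qed
  have zero: "ob' c b a t = 0" if abc: "a < b" "b < c" "c < n" for a b c t
  proof (rule ccontr)
    assume nz: "ob' c b a t \<noteq> 0"
    then have "t \<in> Poly_Mapping.keys (B.Phi (B.overlap c b a))"
      by (auto simp: ob'_def in_keys_iff)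
    then have t: "sorted t" "set t \<subseteq> {..<n}" by (rule B.Phi_keys)+
    define w where "w = (\<lambda>k. wt t k - wt [a, b, c] k)"
    have w: "w \<in> Th M" unfolding w_def using abc nz by (intro B.overlap_wt) (auto simp: ob'_def)
    define d where "d = pick w"
    have reg: "regular_at d w" unfolding d_def w_def using abc M w by (intro pick_regular) (auto simp: w_def)
    then have dn: "d < n" by (simp add: regular_at_def)
    have d_notin: "d \<notin> {a, b, c}" using zero_in [OF abc t w_def w d_def] nz by blast
    \<comment> \<open>With \<open>d\<close> added to both the letters and the word, the other three
      overlaps of the cocycle contain \<open>d\<close> and have the same weight, so
      \<open>zero_in\<close> disposes of them.\<close>
    define T where "T = sort (t @ [d])"
    have T: "sorted T" "set T \<subseteq> {..<n}" "d \<in> set T" using t dn by (auto simp: T_def)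
    have rT: "remove1 d T = t" using sort_snoc_eq_iff [OF t(1), of T d] T by (simp add: T_def)
    have wT: "wt T k = wt t k + (if d = k then 1 else 0)" for k by (simp add: T_def)
    have bfd: "B.bfac d (prod_list (map (q d) [c, b, a])) T \<noteq> 0"
      by (rule bfac_nonzero [OF reg T(2,3)]) (use abc rT in \<open>auto simp: w_def\<close>)
    have other: "B.bfac x \<chi> T * ob' z y y' (remove1 x T) = 0"
      if "y' < y" "y < z" "z < n" "\<And>k. wt [x, y', y, z] k = wt [d, a, b, c] k" "d \<in> {y', y, z}" for x \<chi> y y' z
    proof (cases "x \<in> set T")
      case True
      have "w = (\<lambda>k. wt (remove1 x T) k - wt [y', y, z] k)"
      proof
        fix k
        have "wt [x, y', y, z] k = (if x = k then 1 else 0) + wt [y', y, z] k"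
          "wt [d, a, b, c] k = (if d = k then 1 else 0) + wt [a, b, c] k" by (rule wt_simps(2))+
        then show "w k = wt (remove1 x T) k - wt [y', y, z] k"
          unfolding w_def wt_remove1 [OF True] wT using that(4) [of k] by linarith
      qed
      moreover have "sorted (remove1 x T)" "set (remove1 x T) \<subseteq> {..<n}"
        using T set_remove1_subset by (auto simp: sorted_remove1 dest: notin_set_remove1)
      ultimately have "ob' z y y' (remove1 x T) = 0"
        using that w by (intro zero_in [OF _ _ _ _ _ _ _ d_def]) auto
      then show ?thesis by simp
    next
      case False
      then show ?thesis by (simp add: B.bfac_def)
    qed
    have cocycle: "B.bfac w4 (q w4 w3 * q w4 w2 * q w4 w1) T * ob' w3 w2 w1 (remove1 w4 T)
      - q w4 w3 * (B.bfac w3 (q w3 w4 * q w3 w2 * q w3 w1) T * ob' w4 w2 w1 (remove1 w3 T))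
      + q w3 w2 * q w4 w2 * (B.bfac w2 (q w2 w4 * q w2 w3 * q w2 w1) T * ob' w4 w3 w1 (remove1 w2 T))
      - q w2 w1 * q w3 w1 * q w4 w1 * (B.bfac w1 (q w1 w4 * q w1 w3 * q w1 w2) T * ob' w4 w3 w2 (remove1 w1 T)) = 0"
      if "w1 < w2" "w2 < w3" "w3 < w4" "w4 < n" for w1 w2 w3 w4
      unfolding ob'_def using ov_B that T(1) by (rule B.obstruction_cocycle)
    have bfd': "B.bfac d (q d c * q d b * q d a) T \<noteq> 0" using bfd by (simp add: mult.assoc)
    consider "d < a" | "a < d" "d < b" | "b < d" "d < c" | "c < d" using d_notin by fastforce
    then have "ob' c b a (remove1 d T) = 0"
    proof cases
      case 1
      have z: "B.bfac c \<chi> T * ob' b a d (remove1 c T) = 0" "B.bfac b \<chi> T * ob' c a d (remove1 b T) = 0"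
        "B.bfac a \<chi> T * ob' c b d (remove1 a T) = 0" for \<chi>
        using abc 1 by (intro other; auto)+
      show ?thesis using cocycle [OF 1 abc] bfd' q_nz unfolding z by simp
    next
      case 2
      have z: "B.bfac c \<chi> T * ob' b d a (remove1 c T) = 0" "B.bfac b \<chi> T * ob' c d a (remove1 b T) = 0"
        "B.bfac a \<chi> T * ob' c b d (remove1 a T) = 0" for \<chi>
        using abc 2 by (intro other; auto)+
      show ?thesis using cocycle [OF 2 abc(2,3)] bfd' q_nz unfolding z by simp
    next
      case 3
      have z: "B.bfac c \<chi> T * ob' d b a (remove1 c T) = 0" "B.bfac b \<chi> T * ob' c d a (remove1 b T) = 0"
        "B.bfac a \<chi> T * ob' c d b (remove1 a T) = 0" for \<chi>
        using abc 3 by (intro other; auto)+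
      show ?thesis using cocycle [OF abc(1) 3 abc(3)] bfd' q_nz unfolding z by simp
    next
      case 4
      have z: "B.bfac c \<chi> T * ob' d b a (remove1 c T) = 0" "B.bfac b \<chi> T * ob' d c a (remove1 b T) = 0"
        "B.bfac a \<chi> T * ob' d c b (remove1 a T) = 0" for \<chi>
        using abc 4 dn by (intro other; auto)+
      show ?thesis using cocycle [OF abc(1,2) 4 dn] bfd' q_nz unfolding z by simp
    qed
    with nz rT show False by simp
  qed
  have "all_overlaps M C' (Suc M)"
    unfolding all_overlaps_def
    using ov_B zero by (auto simp: ob'_def intro!: epsI_SucI)
  then show thesis by (intro that [of C']) (auto simp: M_def C'_def)
qed

end

section \<open>Flatness and resolvability of overlaps\<close>

lemma coef_zero: "coef 0 = 0" and coef_add: "coef (P + Q) = coef P + coef Q"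
  and coef_diff: "coef (P - Q) = coef P - coef Q"
  by (auto simp: fun_eq_iff lookup_add lookup_minus)

lemma coef_mon_eq: "coef (p \<odot> mon w) = ncmon w p"
  by (auto simp: fun_eq_iff coef_mon ncmon_def)

lemma coef_mon_1: "coef (mon w) = ncmon w 1"
  by (auto simp: fun_eq_iff coef_mon ncmon_def)

lemma ncmul_add_left: "ncmul (P + P') Q = ncmul P Q + ncmul P' Q"
  and ncmul_add_right: "ncmul P (Q + Q') = ncmul P Q + ncmul P Q'"
  by (auto simp: ncmul_def fun_eq_iff distrib_right distrib_left sum.distrib)

lemma ncmul_zero [simp]: "ncmul 0 Q = 0" "ncmul P 0 = 0"
  by (auto simp: ncmul_def fun_eq_iff)

lemma ncmul_ncmon: "ncmul (ncmon u p) (ncmon v r) = ncmon (u @ v) (p * r)"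
proof
  fix w
  have "ncmul (ncmon u p) (ncmon v r) w
      = (\<Sum>i\<le>length w. if i = length u then (if w = u @ v then p * r else 0) else 0)"
    unfolding ncmul_def
  proof (intro sum.cong refl)
    fix i assume i: "i \<in> {..length w}"
    show "ncmon u p (take i w) * ncmon v r (drop i w)
        = (if i = length u then (if w = u @ v then p * r else 0) else 0)"
    proof (cases "take i w = u \<and> drop i w = v")
      case True
      then have "w = u @ v" using append_take_drop_id [of i w] by simp
      moreover have "i = length u" using True i by auto
      ultimately show ?thesis by (simp add: ncmon_def)
    next
      case False
      then have "\<not> (i = length u \<and> w = u @ v)" by auto
      with False show ?thesis by (auto simp: ncmon_def)
    qed
  qed
  also have "\<dots> = (if w = u @ v then p * r else 0)" by auto
  finally show "ncmul (ncmon u p) (ncmon v r) w = ncmon (u @ v) (p * r) w" by (simp add: ncmon_def)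
qed

lemma coef_mult: "coef (P * Q) = ncmul (coef P) (coef Q)"
proof (induction P rule: fpoly_induct)
  case zero
  show ?case by (simp only: mult_zero_left coef_zero ncmul_zero)
next
  case (add P P')
  then show ?case by (simp only: distrib_right coef_add ncmul_add_left)
next
  case (mon p u)
  show ?case
  proof (induction Q rule: fpoly_induct)
    case zero
    show ?case by (simp only: mult_zero_right coef_zero ncmul_zero)
  next
    case (add Q Q')
    then show ?case by (simp only: distrib_left coef_add ncmul_add_right)
  next
    case (mon r v)
    show ?case
      by (simp only: sm_mult_left sm_mult_right sm_sm mon_mult coef_mon_eq ncmul_ncmon mult.commute [of r])
  qed
qed

lemma ncR_coef:
  assumes "x \<in> ncR n"
  obtains X where "x = coef X"
proof -
  have "coef (Abs_poly_mapping x) = x" using assms by (simp add: ncR_def)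
  then show thesis using that by metis
qed

lemma coef_in_ncR_iff: "coef X \<in> ncR n \<longleftrightarrow> (\<forall>w\<in>Poly_Mapping.keys X. set w \<subseteq> {..<n})"
  by (auto simp: ncR_def in_keys_iff)

lemma ncR_mon [simp]: "set w \<subseteq> {..<n} \<Longrightarrow> coef (mon w) \<in> ncR n"
  by (simp add: coef_in_ncR_iff mon_def)

lemma ncR_1 [simp]: "coef 1 \<in> ncR n"
  by (simp add: coef_in_ncR_iff zero_list_def)

lemma ncR_mult: "coef X \<in> ncR n \<Longrightarrow> coef Y \<in> ncR n \<Longrightarrow> coef (X * Y) \<in> ncR n"
  using keys_mult [of X Y] by (fastforce simp: coef_in_ncR_iff plus_list_def)

lemma ncR_add: "coef X \<in> ncR n \<Longrightarrow> coef Y \<in> ncR n \<Longrightarrow> coef (X + Y) \<in> ncR n"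
  using keys_add [of X Y] by (fastforce simp: coef_in_ncR_iff)

lemma ncR_diff: "coef X \<in> ncR n \<Longrightarrow> coef Y \<in> ncR n \<Longrightarrow> coef (X - Y) \<in> ncR n"
  using keys_diff [of X Y] by (fastforce simp: coef_in_ncR_iff)

lemma ncR_sm: "coef X \<in> ncR n \<Longrightarrow> coef (p \<odot> X) \<in> ncR n"
  using keys_sm [of p X] by (auto simp: coef_in_ncR_iff)

section \<open>Two-sided ideals of the free algebra\<close>

definition ideal :: "nat \<Rightarrow> (nat list \<Rightarrow> complex poly) set \<Rightarrow> fpoly set" where
  "ideal n R = {P. coef P \<in> nc_ideal n R}"

lemma ideal_0 [simp]: "0 \<in> ideal n R"
  by (simp add: ideal_def coef_zero nc_ideal.zero)

lemma ideal_add: "P \<in> ideal n R \<Longrightarrow> Q \<in> ideal n R \<Longrightarrow> P + Q \<in> ideal n R"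
  by (simp add: ideal_def coef_add nc_ideal.add)

lemma ideal_gen:
  assumes "coef P \<in> R" "coef X \<in> ncR n" "coef Y \<in> ncR n"
  shows "X * P * Y \<in> ideal n R"
  using nc_ideal.gen [OF assms(1-3)] by (simp add: ideal_def coef_mult)

lemma ideal_gen1: "coef P \<in> R \<Longrightarrow> P \<in> ideal n R"
  using ideal_gen [of P R 1 n 1] by simp

lemma nc_ideal_in_ncR:
  assumes "R \<subseteq> ncR n" "P \<in> nc_ideal n R"
  shows "\<exists>Q. P = coef Q \<and> Q \<in> ideal n R \<and> coef Q \<in> ncR n"
  using assms(2)
proof induction
  case zero
  show ?case by (intro exI [of _ 0]) (auto simp: coef_zero coef_in_ncR_iff ncR_def)
next
  case (gen g x y)
  obtain g' x' y' where e: "g = coef g'" "x = coef x'" "y = coef y'"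
    using gen assms(1) ncR_coef by (metis subsetD)
  have "coef g' \<in> ncR n" using gen assms(1) e by auto
  then show ?case using gen unfolding e
    by (intro exI [of _ "x' * g' * y'"]) (auto simp: coef_mult [symmetric] intro!: ideal_gen ncR_mult)
next
  case (add P Q)
  then show ?case by (metis coef_add ideal_add ncR_add)
qed

text \<open>The inductive definition lives on plain functions; this rule moves it to
  \<open>fpoly\<close>, where the ring laws are available.\<close>

lemma ideal_induct [consumes 2, case_names zero gen add]:
  assumes "P \<in> ideal n R" "R \<subseteq> ncR n"
    and "\<Phi> 0"
    and "\<And>g X Y. coef g \<in> R \<Longrightarrow> coef X \<in> ncR n \<Longrightarrow> coef Y \<in> ncR n \<Longrightarrow> \<Phi> (X * g * Y)"
    and "\<And>P Q. P \<in> ideal n R \<Longrightarrow> Q \<in> ideal n R \<Longrightarrow> \<Phi> P \<Longrightarrow> \<Phi> Q \<Longrightarrow> \<Phi> (P + Q)"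
  shows "\<Phi> P"
proof -
  have "\<exists>Q. P' = coef Q \<and> Q \<in> ideal n R \<and> \<Phi> Q" if "P' \<in> nc_ideal n R" for P'
    using that
  proof induction
    case zero
    show ?case by (intro exI [of _ 0]) (simp add: coef_zero assms(3))
  next
    case (gen g x y)
    obtain g' x' y' where e: "g = coef g'" "x = coef x'" "y = coef y'"
      using gen assms(2) ncR_coef by (metis subsetD)
    show ?case using gen unfolding e
      by (intro exI [of _ "x' * g' * y'"]) (simp add: coef_mult [symmetric] ideal_gen assms(4))
  next
    case (add P Q)
    then obtain P' Q' where "P = coef P'" "P' \<in> ideal n R" "\<Phi> P'" "Q = coef Q'" "Q' \<in> ideal n R" "\<Phi> Q'"
      by blast
    then show ?case by (intro exI [of _ "P' + Q'"]) (simp add: coef_add ideal_add assms(5))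
  qed
  from this [of "coef P"] assms(1) show ?thesis
    by (auto simp: ideal_def poly_mapping_eq_iff [symmetric])
qed

lemma ideal_mult:
  assumes "P \<in> ideal n R" "R \<subseteq> ncR n" "coef X \<in> ncR n" "coef Y \<in> ncR n"
  shows "X * P * Y \<in> ideal n R"
  using assms(1,2)
proof (induction rule: ideal_induct)
  case (gen g X' Y')
  have "X * (X' * g * Y') * Y = (X * X') * g * (Y' * Y)" by (simp only: mult.assoc)
  then show ?case using gen assms by (auto intro!: ideal_gen ncR_mult)
next
  case (add P Q)
  then show ?case by (simp add: distrib_left distrib_right ideal_add)
qed simp

lemma ideal_sm:
  assumes "P \<in> ideal n R" "R \<subseteq> ncR n"
  shows "p \<odot> P \<in> ideal n R"
proof -
  have "coef (p \<odot> 1) \<in> ncR n" using ncR_sm [of 1 n p] by simp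
  from ideal_mult [OF assms this, of 1] show ?thesis by simp
qed

lemma ideal_minus: "P \<in> ideal n R \<Longrightarrow> R \<subseteq> ncR n \<Longrightarrow> - P \<in> ideal n R"
  using ideal_sm [of P n R "-1"] by (simp add: sm_minus_left)

lemma ideal_diff: "P \<in> ideal n R \<Longrightarrow> Q \<in> ideal n R \<Longrightarrow> R \<subseteq> ncR n \<Longrightarrow> P - Q \<in> ideal n R"
  using ideal_add [of P n R "- Q"] ideal_minus by simp

lemma ideal_sum: "(\<And>i. i \<in> A \<Longrightarrow> f i \<in> ideal n R) \<Longrightarrow> (\<Sum>i\<in>A. f i) \<in> ideal n R"
  by (induction A rule: infinite_finite_induct) (auto intro: ideal_add)

lemma ideal_subset:
  assumes "\<And>P. coef P \<in> R \<Longrightarrow> P \<in> ideal n S" "R \<subseteq> ncR n" "S \<subseteq> ncR n"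
  shows "nc_ideal n R \<subseteq> nc_ideal n S"
proof
  fix P' assume "P' \<in> nc_ideal n R"
  then obtain P where P: "P' = coef P" "P \<in> ideal n R" using nc_ideal_in_ncR [OF assms(2)] by blast
  have "P \<in> ideal n S" using P(2) assms(2)
  proof (induction rule: ideal_induct)
    case (gen g X Y)
    then show ?case by (intro ideal_mult assms)
  qed (auto intro: ideal_add)
  then show "P' \<in> nc_ideal n S" by (simp add: P(1) ideal_def)
qed

lemma coef_pscale: "pscale p (coef P) = coef (p \<odot> P)"
  by (simp add: pscale_def fun_eq_iff)

lemma coef_sum: "coef (\<Sum>i\<in>A. f i) = (\<Sum>i\<in>A. coef (f i))"
  by (induction A rule: infinite_finite_induct) (auto simp: coef_zero coef_add)

section \<open>Sorted words as a basis, and reduction at parameter zero\<close>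

context reduction_system
begin

definition gens :: "(nat list \<Rightarrow> complex poly) set" where
  "gens = {coef (rel b a) | a b. a < b \<and> b < n}"

definition q_gens :: "(nat list \<Rightarrow> complex poly) set" where
  "q_gens = {qrel (const_q q) i j | i j. i < n \<and> j < n}"

definition eps :: fpoly where "eps = [:0, 1:] \<odot> mon []"

lemma eps_eq: "coef eps = ncmon [] [:0, 1:]"
  unfolding eps_def by (rule coef_mon_eq)

lemma eps_mult: "eps * Q = [:0, 1:] \<odot> Q"
  by (simp add: eps_def)

lemma monom_1: "monom 1 1 = [:0, 1 :: complex:]"
  by (simp add: monom_Suc monom_0)

lemma ncR_eps: "coef eps \<in> ncR n"
  unfolding eps_def by (rule ncR_sm) simp

lemma ncR_g: "a < b \<Longrightarrow> b < n \<Longrightarrow> coef (g b a) \<in> ncR n"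
  by (auto simp: coef_in_ncR_iff elim!: keys_g)

lemma ncR_rel: "a < b \<Longrightarrow> b < n \<Longrightarrow> coef (rel b a) \<in> ncR n"
  using ncR_g [of a b] ncR_sm [of "mon [b, a]" n "-1"] unfolding rel_def
  by (intro ncR_add ncR_sm) (auto simp: sm_minus_left)

lemma gens_ncR: "gens \<subseteq> ncR n"
  using ncR_rel by (auto simp: gens_def)

lemma qrel_coef: "qrel (const_q q) i j = coef (mon [i, j] - [:q i j:] \<odot> mon [j, i])"
  by (simp only: coef_diff coef_mon_eq coef_mon_1 qrel_def const_q_def)

lemma q_gens_ncR: "q_gens \<subseteq> ncR n"
proof -
  have "coef (mon [i, j] - [:q i j:] \<odot> mon [j, i]) \<in> ncR n" if "i < n" "j < n" for i j
    using that by (intro ncR_diff ncR_sm ncR_mon) auto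
  then show ?thesis by (auto simp: q_gens_def qrel_coef)
qed

lemma ideal_rel: "a < b \<Longrightarrow> b < n \<Longrightarrow> rel b a \<in> ideal n gens"
  by (rule ideal_gen1) (auto simp: gens_def)

lemma minus_nf_in_ideal:
  assumes "set w \<subseteq> {..<n}"
  shows "mon w - nf w \<in> ideal n gens"
  using assms
proof (induction w rule: reduction_induct)
  case (sorted w)
  then show ?case by (simp add: nf_sorted)
next
  case (step u b a v)
  have ab: "a < b" "b < n" "a < n" using step.hyps by auto
  have "mon (u @ b # a # v) - nf (u @ b # a # v)
     = - (mon u * rel b a * mon v) + (\<Sum>k<n. \<Sum>l<n. F b a k l \<odot> (mon (u @ [k, l] @ v) - nf (u @ [k, l] @ v)))"
    using step.hyps ab by (simp add: nf_step' rel_altdef sm_diff_right sum_subtractf algebra_simps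
      sum_distrib_left sum_distrib_right)
  also have "\<dots> \<in> ideal n gens"
  proof (intro ideal_add ideal_minus ideal_sum gens_ncR)
    show "mon u * rel b a * mon v \<in> ideal n gens"
      using step.hyps ab by (intro ideal_mult ideal_rel gens_ncR) auto
    fix k l assume kl: "k \<in> {..<n}" "l \<in> {..<n}"
    show "F b a k l \<odot> (mon (u @ [k, l] @ v) - nf (u @ [k, l] @ v)) \<in> ideal n gens"
    proof (cases "F b a k l = 0")
      case False
      then show ?thesis
        using step.IH [of k l] kl prec_F [OF ab(1,2) False, of u v]
        by (intro ideal_sm gens_ncR) auto
    qed auto
  qed
  finally show ?case .
qed

lemma minus_Phi_in_ideal:
  assumes "coef P \<in> ncR n"
  shows "P - Phi P \<in> ideal n gens"
proof -
  have "P - Phi P = (\<Sum>w\<in>Poly_Mapping.keys P. coef P w \<odot> (mon w - nf w))"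
    unfolding Phi_def lin_def sm_diff_right sum_subtractf
    by (subst (1) fpoly_expand [of "Poly_Mapping.keys P" P]) auto
  also have "\<dots> \<in> ideal n gens"
    using assms by (intro ideal_sum ideal_sm minus_nf_in_ideal gens_ncR) (auto simp: coef_in_ncR_iff)
  finally show ?thesis .
qed

definition normal :: "nat list set" where
  "normal = {w. sorted w \<and> set w \<subseteq> {..<n}}"

lemma Phi_normal:
  assumes "Poly_Mapping.keys P \<subseteq> normal"
  shows "Phi P = P"
proof -
  have "Phi P = (\<Sum>w\<in>Poly_Mapping.keys P. coef P w \<odot> mon w)"
    unfolding Phi_def lin_def using assms by (intro sum.cong refl) (auto simp: normal_def nf_sorted)
  then show ?thesis using fpoly_expand [of "Poly_Mapping.keys P" P] by simp
qed

lemma Phi_ideal_eq_0: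
  assumes ov: "\<And>a b c. a < b \<Longrightarrow> b < c \<Longrightarrow> c < n \<Longrightarrow> Phi (overlap c b a) = 0"
    and "P \<in> ideal n gens"
  shows "Phi P = 0"
  using assms(2) gens_ncR
proof (induction rule: ideal_induct)
  case (gen r X Y)
  then obtain a b where ab: "a < b" "b < n" "r = rel b a"
    by (auto simp: gens_def poly_mapping_eq_iff [symmetric])
  show ?case
  proof (rule epsI_all_zero)
    show "Phi (X * r * Y) \<in> epsI m" for m
      unfolding ab(3) by (rule Phi_ideal_epsI) (use ov ab in auto)
  qed
qed (auto simp: Phi_linear)

text \<open>Sorted words span because \<open>P - Phi P\<close> lies in the ideal, and are
  independent because \<open>Phi\<close> fixes them and kills the ideal.\<close>

theorem free_quotient_if:
  assumes ov: "\<And>a b c. a < b \<Longrightarrow> b < c \<Longrightarrow> c < n \<Longrightarrow> Phi (overlap c b a) = 0"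
  shows "free_quotient n (nc_ideal n gens)"
proof -
  define f where "f w = coef (mon w)" for w
  have inj: "inj f"
  proof (rule injI)
    fix v w assume "f v = f w"
    then have "coef (mon v) v = coef (mon w) v" by (simp add: f_def)
    then show "v = w" by (simp add: coef_mon split: if_splits)
  qed
  have sum_f: "(\<Sum>v\<in>f ` A. pscale (c v) v) = coef (\<Sum>w\<in>A. c (f w) \<odot> mon w)" for A c
  proof -
    have "(\<Sum>v\<in>f ` A. pscale (c v) v) = (\<Sum>w\<in>A. pscale (c (f w)) (f w))"
      by (subst sum.reindex [OF inj_on_subset [OF inj]]) (simp_all add: o_def)
    also have "\<dots> = coef (\<Sum>w\<in>A. c (f w) \<odot> mon w)"
      unfolding coef_sum by (intro sum.cong refl) (simp only: f_def coef_pscale)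
    finally show ?thesis .
  qed
  have support: "{v \<in> f ` normal. c v \<noteq> 0} = f ` {w \<in> normal. c (f w) \<noteq> 0}" for c :: "_ \<Rightarrow> complex poly"
    by auto
  show ?thesis
    unfolding free_quotient_def
  proof (intro exI [of _ "f ` normal"] conjI ballI allI impI)
    show "f ` normal \<subseteq> ncR n" by (auto simp: f_def normal_def)
  next
    fix P' :: "nat list \<Rightarrow> complex poly" assume P': "P' \<in> ncR n"
    then obtain P where P: "P' = coef P" by (rule ncR_coef)
    \<comment> \<open>Coefficients are indexed by basis elements rather than by words, whence the
      inverse of \<open>f\<close>.\<close>
    define c where "c v = coef (Phi P) (inv_into UNIV f v)" for v
    have c: "c (f w) = coef (Phi P) w" for w by (simp add: c_def inv_into_f_f [OF inj])
    have "{w \<in> normal. c (f w) \<noteq> 0} = Poly_Mapping.keys (Phi P)"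
      using Phi_keys [of _ P] by (auto simp: normal_def c in_keys_iff)
    moreover have "(\<Sum>w\<in>Poly_Mapping.keys (Phi P). c (f w) \<odot> mon w) = Phi P"
      unfolding c by (rule fpoly_expand [symmetric]) auto
    moreover have "coef (P - Phi P) \<in> nc_ideal n gens"
      using minus_Phi_in_ideal [of P] P P' by (simp add: ideal_def)
    ultimately show "\<exists>c. finite {v \<in> f ` normal. c v \<noteq> 0} \<and>
        P' - (\<Sum>v\<in>{v \<in> f ` normal. c v \<noteq> 0}. pscale (c v) v) \<in> nc_ideal n gens"
      by (intro exI [of _ c]) (simp add: support sum_f coef_diff P)
  next
    fix c v
    assume c: "finite {v \<in> f ` normal. c v \<noteq> 0} \<and>
      (\<Sum>v\<in>{v \<in> f ` normal. c v \<noteq> 0}. pscale (c v) v) \<in> nc_ideal n gens" and v: "v \<in> f ` normal"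
    define A where "A = {w \<in> normal. c (f w) \<noteq> 0}"
    define Q where "Q = (\<Sum>w\<in>A. c (f w) \<odot> mon w)"
    have fin: "finite A"
      using c unfolding support A_def [symmetric] by (auto dest: finite_imageD intro: inj_on_subset [OF inj])
    have cQ: "coef Q w = (if w \<in> A then c (f w) else 0)" for w
      using fin by (simp add: Q_def lookup_sum coef_mon if_distrib cong: if_cong)
    have "Q \<in> ideal n gens"
      using c unfolding support A_def [symmetric] sum_f by (simp add: ideal_def Q_def)
    then have "Phi Q = 0" using Phi_ideal_eq_0 [of Q] ov by blast
    moreover have "Phi Q = Q" by (rule Phi_normal) (auto simp: in_keys_iff cQ A_def split: if_splits)
    ultimately have Q: "Q = 0" by simp
    obtain w where w: "w \<in> normal" "v = f w" using v by blast
    show "c v = 0"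
      using cQ [of w] w unfolding Q by (auto simp: A_def split: if_splits)
  qed
qed

lemma g_divisible:
  assumes "a < b" "b < n"
  obtains Q where "g b a = eps * Q" "coef Q \<in> ncR n"
proof -
  obtain Q where Q: "g b a = [:0, 1:] \<odot> Q"
    using g_epsI [OF assms] unfolding epsI_def monom_1 by auto
  have "coef Q w \<noteq> 0 \<Longrightarrow> coef (g b a) w \<noteq> 0" for w by (simp add: Q)
  then have "coef Q \<in> ncR n"
    using ncR_g [OF assms] by (auto simp: coef_in_ncR_iff in_keys_iff)
  then show thesis using that [of Q] by (simp add: Q eps_mult)
qed

text \<open>Confluence plays no part here: up to sign \<open>rel b a\<close> differs from the
  undeformed relation by \<open>g b a\<close>, a multiple of \<epsilon>, and reversing a pair
  multiplies its relation by a unit.\<close>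

lemma reduction_mod_eps:
  "nc_ideal n (gens \<union> {ncmon [] [:0, 1:]}) = nc_ideal n (q_gens \<union> {ncmon [] [:0, 1:]})"
proof -
  let ?A = "gens \<union> {ncmon [] [:0, 1:]}" and ?B = "q_gens \<union> {ncmon [] [:0, 1:]}"
  have A: "?A \<subseteq> ncR n" and B: "?B \<subseteq> ncR n"
    using gens_ncR q_gens_ncR ncR_eps by (auto simp flip: eps_eq)
  have eps: "eps \<in> ideal n ?A" "eps \<in> ideal n ?B"
    by (rule ideal_gen1, simp add: eps_eq)+
  have one: "coef 1 \<in> ncR n" by simp
  have g: "g b a \<in> ideal n ?A" "g b a \<in> ideal n ?B" if ab: "a < b" "b < n" for a b
  proof -
    obtain Q where Q: "g b a = eps * Q" "coef Q \<in> ncR n" by (rule g_divisible [OF ab])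
    show "g b a \<in> ideal n ?A" "g b a \<in> ideal n ?B"
      using ideal_mult [OF eps(1) A one Q(2)] ideal_mult [OF eps(2) B one Q(2)] by (simp_all add: Q(1))
  qed
  have "nc_ideal n ?A \<subseteq> nc_ideal n ?B"
  proof (rule ideal_subset [OF _ A B])
    fix P assume "coef P \<in> ?A"
    then consider "P = eps" | a b where "a < b" "b < n" "P = rel b a"
      by (auto simp: gens_def eps_eq [symmetric] poly_mapping_eq_iff [symmetric])
    then show "P \<in> ideal n ?B"
    proof cases
      case 1
      then show ?thesis using eps by simp
    next
      case (2 a b)
      have "mon [b, a] - [:q b a:] \<odot> mon [a, b] \<in> ideal n ?B"
      proof (rule ideal_gen1)
        have "qrel (const_q q) b a \<in> q_gens"
          unfolding q_gens_def using 2 by (intro CollectI exI [of _ b] exI [of _ a]) auto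
        then show "coef (mon [b, a] - [:q b a:] \<odot> mon [a, b]) \<in> ?B" by (simp add: qrel_coef)
      qed
      then have "g b a - (mon [b, a] - [:q b a:] \<odot> mon [a, b]) \<in> ideal n ?B"
        using ideal_diff [OF g(2) _ B] 2 by blast
      then show ?thesis by (simp add: 2 rel_def algebra_simps)
    qed
  qed
  moreover have "nc_ideal n ?B \<subseteq> nc_ideal n ?A"
  proof (rule ideal_subset [OF _ B A])
    fix P assume "coef P \<in> ?B"
    then consider "P = eps" | i j where "i < n" "j < n" "P = mon [i, j] - [:q i j:] \<odot> mon [j, i]"
      by (auto simp: q_gens_def qrel_coef eps_eq [symmetric] poly_mapping_eq_iff [symmetric])
    then show "P \<in> ideal n ?A"
    proof cases
      case 1
      then show ?thesis using eps by simp
    next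
      case (2 i j)
      have main: "mon [b, a] - [:q b a:] \<odot> mon [a, b] \<in> ideal n ?A" if "a < b" "b < n" for a b
      proof -
        have "rel b a \<in> ideal n ?A" using that by (intro ideal_gen1) (auto simp: gens_def)
        then have "g b a - rel b a \<in> ideal n ?A"
          using ideal_diff [OF g(1) _ A] that by blast
        then show ?thesis by (simp add: rel_def)
      qed
      consider "j < i" | "i = j" | "i < j" by linarith
      then show ?thesis
      proof cases
        case 1
        then show ?thesis using main [of j i] 2 by simp
      next
        case eq: 2
        then show ?thesis using 2 q_refl [of i] by (simp add: one_pCons [symmetric])
      next
        case 3
        have "mon [i, j] - [:q i j:] \<odot> mon [j, i] = - ([:q i j:] \<odot> (mon [j, i] - [:q j i:] \<odot> mon [i, j]))"
          using q_inv [of j i] 2 by (simp add: sm_diff_right one_pCons [symmetric])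
        then show ?thesis using 2(3) main [OF 3 2(2)] A by (simp add: ideal_minus ideal_sm)
      qed
    qed
  qed
  ultimately show ?thesis by (rule equalityI)
qed

text \<open>Sorted words stay independent in the undeformed quotient; in this form the fact lets a
  normal form be divided by \<epsilon>.\<close>

lemma Phi_q_ideal:
  assumes "P \<in> ideal n (q_gens \<union> {ncmon [] [:0, 1:]})"
  shows "Phi P \<in> epsI 1"
proof -
  have sub: "q_gens \<union> {ncmon [] [:0, 1:]} \<subseteq> ncR n"
    using q_gens_ncR ncR_eps by (auto simp flip: eps_eq)
  have main: "Phi (X * (mon [b, a] - [:q b a:] \<odot> mon [a, b]) * Y) \<in> epsI 1"
    if ab: "a < b" "b < n" for a b X Y
  proof -
    have "X * (mon [b, a] - [:q b a:] \<odot> mon [a, b]) * Y = X * g b a * Y - X * rel b a * Y"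
      by (simp add: rel_def algebra_simps)
    moreover have "Phi (X * g b a * Y) \<in> epsI 1"
      by (rule Phi_epsI, rule epsI_mult_right, rule epsI_mult_left, rule g_epsI) (use ab in auto)
    ultimately show ?thesis
      using Phi_ideal_epsI_1 [OF ab, of X Y] by (simp only: Phi_linear epsI_diff)
  qed
  show ?thesis
    using assms sub
  proof (induction rule: ideal_induct)
    case (gen r X Y)
    then consider "r = eps" | i j where "i < n" "j < n" "r = mon [i, j] - [:q i j:] \<odot> mon [j, i]"
      by (auto simp: q_gens_def qrel_coef eps_eq [symmetric] poly_mapping_eq_iff [symmetric])
    then show ?case
    proof cases
      case 1
      have "X * eps * Y = monom 1 1 \<odot> (X * Y)" by (simp add: eps_def monom_1 del: One_nat_def)
      then show ?thesis unfolding 1 by (simp only: Phi_linear epsI_sm_monom)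
    next
      case (2 i j)
      consider "j < i" | "i = j" | "i < j" by linarith
      then show ?thesis
      proof cases
        case 1
        then show ?thesis unfolding 2(3) using 2 by (intro main) auto
      next
        case eq: 2
        then have "r = 0" using 2 q_refl [of i] by (simp add: one_pCons [symmetric])
        then show ?thesis by (simp add: Phi_linear)
      next
        case 3
        have "r = [:- q i j:] \<odot> (mon [j, i] - [:q j i:] \<odot> mon [i, j])"
        proof -
          have "[:- q i j:] = - [:q i j:]" by simp
          then show ?thesis
            unfolding 2(3) using q_inv [of j i] 2
            by (simp only: sm_minus_left) (simp add: sm_diff_right one_pCons [symmetric])
        qed
        then have "Phi (X * r * Y) = [:- q i j:] \<odot> Phi (X * (mon [j, i] - [:q j i:] \<odot> mon [i, j]) * Y)"
          by (simp only: sm_mult_left sm_mult_right Phi_linear)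
        then show ?thesis using main [OF 3 2(2)] by (simp only: epsI_sm)
      qed
    qed
  next
    case (add P Q)
    then show ?case by (simp only: Phi_linear epsI_add)
  qed (simp add: Phi_linear)
qed

text \<open>Multiplication by \<epsilon> is injective on a free module: expand \<open>P\<close> in
  the basis and multiply the coefficients.\<close>

lemma free_quotient_torsion_free:
  assumes "free_quotient n (nc_ideal n gens)" "[:0, 1:] \<odot> P \<in> ideal n gens" "coef P \<in> ncR n"
  shows "P \<in> ideal n gens"
proof -
  obtain S where S: "S \<subseteq> ncR n"
    and span: "\<forall>P\<in>ncR n. \<exists>c. finite {v \<in> S. c v \<noteq> 0} \<and> P - (\<Sum>v\<in>{v \<in> S. c v \<noteq> 0}. pscale (c v) v) \<in> nc_ideal n gens"
    and ind: "\<forall>c. finite {v \<in> S. c v \<noteq> 0} \<and> (\<Sum>v\<in>{v \<in> S. c v \<noteq> 0}. pscale (c v) v) \<in> nc_ideal n gens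
      \<longrightarrow> (\<forall>v\<in>S. c v = 0)"
    using assms(1) unfolding free_quotient_def by blast
  obtain c where c: "finite {v \<in> S. c v \<noteq> 0}"
    "coef P - (\<Sum>v\<in>{v \<in> S. c v \<noteq> 0}. pscale (c v) v) \<in> nc_ideal n gens"
    using span assms(3) by blast
  let ?V = "{v \<in> S. c v \<noteq> 0}"
  define R where "R = (\<Sum>v\<in>?V. c v \<odot> Abs_poly_mapping v)"
  have R: "coef (p \<odot> R) = (\<Sum>v\<in>?V. pscale (p * c v) v)" for p
  proof -
    have "pscale (p * c v) v = coef ((p * c v) \<odot> Abs_poly_mapping v)" if "v \<in> S" for v
    proof -
      have "coef (Abs_poly_mapping v) = v" using S that by (auto simp: ncR_def)
      then show ?thesis using coef_pscale [of "p * c v" "Abs_poly_mapping v"] by simp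
    qed
    then have "(\<Sum>v\<in>?V. pscale (p * c v) v) = coef (\<Sum>v\<in>?V. (p * c v) \<odot> Abs_poly_mapping v)"
      unfolding coef_sum by (intro sum.cong refl) auto
    then show ?thesis unfolding R_def sm_sum sm_sm by (rule sym)
  qed
  have R1: "coef R = (\<Sum>v\<in>?V. pscale (c v) v)"
    using R [of 1] by simp
  note Re = R [of "[:0, 1:]"]
  have PR: "P - R \<in> ideal n gens" using c(2) by (simp add: ideal_def coef_diff R1)
  have "[:0, 1:] \<odot> P - [:0, 1:] \<odot> (P - R) \<in> ideal n gens"
    by (rule ideal_diff [OF assms(2) ideal_sm [OF PR gens_ncR] gens_ncR])
  then have "[:0, 1:] \<odot> R \<in> ideal n gens" by (simp add: sm_diff_right)
  then have "(\<Sum>v\<in>?V. pscale ([:0, 1:] * c v) v) \<in> nc_ideal n gens"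
    unfolding ideal_def mem_Collect_eq Re .
  moreover have eq: "{v \<in> S. [:0, 1:] * c v \<noteq> 0} = ?V" by auto
  ultimately have "finite {v \<in> S. [:0, 1:] * c v \<noteq> 0} \<and>
      (\<Sum>v\<in>{v \<in> S. [:0, 1:] * c v \<noteq> 0}. pscale ([:0, 1:] * c v) v) \<in> nc_ideal n gens"
    unfolding eq using c(1) by blast
  then have "\<forall>v\<in>S. [:0, 1:] * c v = 0" using ind [rule_format, of "\<lambda>v. [:0, 1:] * c v"] by blast
  then have "?V = {}" by auto
  then have "coef R = 0" unfolding R1 by (simp only: sum.empty)
  then have "R = 0" by (simp add: poly_mapping_eq_iff coef_zero)
  then show ?thesis using PR by simp
qed

text \<open>The normal form of an overlap lies in the ideal. If it is \<epsilon>^m times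
  \<open>P\<close>, torsion-freeness puts \<open>P\<close> into the ideal, and reduction at
  \<epsilon> = 0 makes \<open>P\<close>, a combination of sorted words, divisible by \<epsilon>.
  Hence it is divisible by every power.\<close>

theorem overlaps_if_flat:
  assumes flat: "flat_deformation n q gens" and abc: "a < b" "b < c" "c < n"
  shows "Phi (overlap c b a) = 0"
proof (rule epsI_all_zero)
  have free: "free_quotient n (nc_ideal n gens)" using flat by (simp add: flat_deformation_def)
  let ?O = "Phi (overlap c b a)"
  have r: "rel b a \<in> ideal n gens" "rel c a \<in> ideal n gens" "rel c b \<in> ideal n gens"
    using abc by (auto intro!: ideal_rel)
  have xr: "mon [x] * R \<in> ideal n gens" "R * mon [x] \<in> ideal n gens"
    if "R \<in> ideal n gens" "x < n" for x R
    using ideal_mult [OF that(1) gens_ncR, of "mon [x]" 1] ideal_mult [OF that(1) gens_ncR, of 1 "mon [x]"] that(2)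
    by simp_all
  have ov: "overlap c b a \<in> ideal n gens"
    unfolding overlap_eq_rel
    by (rule ideal_add ideal_diff ideal_sm xr r gens_ncR | use abc in linarith)+
  have "coef (overlap c b a) \<in> ncR n"
    using keys_overlap(1) [OF abc] by (auto simp: coef_in_ncR_iff)
  then have "overlap c b a - (overlap c b a - ?O) \<in> ideal n gens"
    by (intro ideal_diff [OF ov _ gens_ncR] minus_Phi_in_ideal)
  then have O: "?O \<in> ideal n gens" by simp
  have torsion: "P \<in> ideal n gens" if "monom 1 m \<odot> P \<in> ideal n gens" "coef P \<in> ncR n" for m P
    using that(1)
  proof (induction m)
    case (Suc m)
    have "monom 1 (Suc m) \<odot> P = [:0, 1:] \<odot> (monom 1 m \<odot> P)" by (simp add: monom_Suc)
    with Suc.prems have "monom 1 m \<odot> P \<in> ideal n gens"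
      using free_quotient_torsion_free [OF free] ncR_sm [OF that(2)] by metis
    then show ?case by (rule Suc.IH)
  qed simp
  show "?O \<in> epsI m" for m
  proof (induction m)
    case (Suc m)
    then obtain P where P: "?O = monom 1 m \<odot> P" unfolding epsI_def by auto
    have keys: "Poly_Mapping.keys P \<subseteq> normal"
    proof
      fix w assume "w \<in> Poly_Mapping.keys P"
      then have "w \<in> Poly_Mapping.keys ?O" by (simp add: P in_keys_iff)
      then show "w \<in> normal" using Phi_keys by (auto simp: normal_def)
    qed
    then have "coef P \<in> ncR n" by (auto simp: coef_in_ncR_iff normal_def)
    then have "P \<in> ideal n gens" using torsion [of m P] O by (simp add: P)
    moreover have "nc_ideal n gens \<subseteq> nc_ideal n (gens \<union> {ncmon [] [:0, 1:]})"
      using gens_ncR ncR_eps by (intro ideal_subset ideal_gen1) (auto simp flip: eps_eq)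
    ultimately have "P \<in> ideal n (q_gens \<union> {ncmon [] [:0, 1:]})"
      unfolding reduction_mod_eps by (auto simp: ideal_def)
    then have "Phi P \<in> epsI 1" by (rule Phi_q_ideal)
    then have "P \<in> epsI 1" by (simp add: Phi_normal [OF keys])
    then show ?case unfolding P using epsI_sm_epsI [of P 1 1 m] by simp
  qed simp
qed

theorem flat_if_overlaps:
  assumes "\<And>a b c. a < b \<Longrightarrow> b < c \<Longrightarrow> c < n \<Longrightarrow> Phi (overlap c b a) = 0"
  shows "flat_deformation n q gens"
  using free_quotient_if [OF assms] gens_ncR reduction_mod_eps
  by (simp add: flat_deformation_def q_gens_def)

end

section \<open>The torus action\<close>

lemma complex_exp_surj:
  assumes "c \<noteq> (0 :: complex)"
  shows "\<exists>z. exp z = c"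
proof -
  have "c = of_real (exp (ln (cmod c))) * exp (\<i> * of_real (Arg c))"
    using rcis_cmod_Arg [of c] assms by (simp add: rcis_def cis_conv_exp)
  also have "\<dots> = exp (of_real (ln (cmod c)) + \<i> * of_real (Arg c))"
    by (simp only: exp_add exp_of_real)
  finally show ?thesis by (intro exI) (rule sym)
qed

text \<open>Scaling the letters is an algebra endomorphism, as the scalar of a word is
  multiplicative under concatenation.\<close>

lemma nc_ideal_scale:
  fixes G G' :: "(nat list \<Rightarrow> complex) set"
  assumes "P \<in> nc_ideal n G"
    and "\<And>g. g \<in> G \<Longrightarrow> \<exists>g'\<in>G'. \<exists>s. (\<lambda>w. g w * prod_list (map u w)) = (\<lambda>w. s * g' w)"
  shows "(\<lambda>w. P w * prod_list (map u w)) \<in> nc_ideal n G'"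
  using assms(1)
proof induction
  case zero
  have "(\<lambda>w. (0 :: nat list \<Rightarrow> complex) w * prod_list (map u w)) = 0" by (auto simp: fun_eq_iff)
  then show ?case by (simp only: nc_ideal.zero)
next
  case (gen g x y)
  obtain g' s where g': "g' \<in> G'" "(\<lambda>w. g w * prod_list (map u w)) = (\<lambda>w. s * g' w)"
    using assms(2) [OF gen(1)] by blast
  have mult: "(\<lambda>w. ncmul A B w * prod_list (map u w))
     = ncmul (\<lambda>w. A w * prod_list (map u w)) (\<lambda>w. B w * prod_list (map u w))" for A B
  proof
    fix w
    show "ncmul A B w * prod_list (map u w)
      = ncmul (\<lambda>w. A w * prod_list (map u w)) (\<lambda>w. B w * prod_list (map u w)) w"
      unfolding ncmul_def sum_distrib_right
    proof (intro sum.cong refl)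
      fix i
      have "prod_list (map u w) = prod_list (map u (take i w @ drop i w))" by simp
      also have "\<dots> = prod_list (map u (take i w)) * prod_list (map u (drop i w))"
        by (simp only: map_append prod_list.append)
      finally show "A (take i w) * B (drop i w) * prod_list (map u w)
        = A (take i w) * prod_list (map u (take i w)) * (B (drop i w) * prod_list (map u (drop i w)))"
        by simp
    qed
  qed
  have scale: "ncmul A (\<lambda>w. s * B w) = ncmul (\<lambda>w. A w * s) B" for A B :: "nat list \<Rightarrow> complex"
    by (simp add: ncmul_def mult.assoc)
  have "(\<lambda>w. x w * prod_list (map u w) * s) \<in> ncR n" "(\<lambda>w. y w * prod_list (map u w)) \<in> ncR n"
    using gen(2,3) unfolding ncR_def by (auto elim: finite_subset [rotated])
  then have "ncmul (ncmul (\<lambda>w. x w * prod_list (map u w) * s) g') (\<lambda>w. y w * prod_list (map u w)) \<in> nc_ideal n G'"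
    by (rule nc_ideal.gen [OF g'(1)])
  then show ?case unfolding mult g'(2) scale .
next
  case (add P Q)
  have "(\<lambda>w. (P + Q) w * prod_list (map u w))
     = (\<lambda>w. P w * prod_list (map u w)) + (\<lambda>w. Q w * prod_list (map u w))"
    by (auto simp: fun_eq_iff algebra_simps)
  then show ?case using nc_ideal.add [OF add.IH] by (simp only:)
qed

lemma ncmul_in_ncR:
  fixes P Q :: "nat list \<Rightarrow> complex"
  assumes "P \<in> ncR n" "Q \<in> ncR n"
  shows "ncmul P Q \<in> ncR n"
proof -
  have sub: "{w. ncmul P Q w \<noteq> 0} \<subseteq> (\<lambda>(u, v). u @ v) ` ({u. P u \<noteq> 0} \<times> {v. Q v \<noteq> 0})"
  proof
    fix w assume "w \<in> {w. ncmul P Q w \<noteq> 0}"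
    then have "(\<Sum>i\<le>length w. P (take i w) * Q (drop i w)) \<noteq> 0" by (simp add: ncmul_def)
    then obtain i where "P (take i w) * Q (drop i w) \<noteq> 0"
      by (rule sum.not_neutral_contains_not_neutral)
    then have "(take i w, drop i w) \<in> {u. P u \<noteq> 0} \<times> {v. Q v \<noteq> 0}" by auto
    then have "(\<lambda>(u, v). u @ v) (take i w, drop i w) \<in> (\<lambda>(u, v). u @ v) ` ({u. P u \<noteq> 0} \<times> {v. Q v \<noteq> 0})"
      by (rule imageI)
    then show "w \<in> (\<lambda>(u, v). u @ v) ` ({u. P u \<noteq> 0} \<times> {v. Q v \<noteq> 0})" by simp
  qed
  moreover have "finite ((\<lambda>(u, v). u @ v) ` ({u. P u \<noteq> 0} \<times> {v. Q v \<noteq> 0}))"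
    using assms by (intro finite_imageI finite_cartesian_product) (simp_all add: ncR_def)
  ultimately have "finite {w. ncmul P Q w \<noteq> 0}" by (rule finite_subset)
  moreover have "set w \<subseteq> {..<n}" if "ncmul P Q w \<noteq> 0" for w
  proof -
    have "w \<in> (\<lambda>(u, v). u @ v) ` ({u. P u \<noteq> 0} \<times> {v. Q v \<noteq> 0})"
      by (rule subsetD [OF sub]) (simp add: that)
    then obtain u v where w: "w = u @ v" "P u \<noteq> 0" "Q v \<noteq> 0" by auto
    have "set u \<subseteq> {..<n}" "set v \<subseteq> {..<n}"
      using assms w(2,3) unfolding ncR_def by blast+
    then show ?thesis by (simp add: w(1))
  qed
  ultimately show ?thesis by (simp add: ncR_def)
qed

lemma nc_ideal_subset_ncR:
  fixes G :: "(nat list \<Rightarrow> complex) set"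
  assumes "G \<subseteq> ncR n" "P \<in> nc_ideal n G"
  shows "P \<in> ncR n"
  using assms(2)
proof induction
  case zero
  then show ?case by (simp add: ncR_def)
next
  case (gen g x y)
  then show ?case using assms(1) by (intro ncmul_in_ncR) auto
next
  case (add P Q)
  have "finite ({w. P w \<noteq> 0} \<union> {w. Q w \<noteq> 0})" using add.IH by (simp add: ncR_def)
  then have "finite {w. (P + Q) w \<noteq> 0}" by (rule rev_finite_subset) auto
  moreover have "set w \<subseteq> {..<n}" if "(P + Q) w \<noteq> 0" for w
  proof -
    have "P w \<noteq> 0 \<or> Q w \<noteq> 0" using that by auto
    then show ?thesis using add.IH unfolding ncR_def by blast
  qed
  ultimately show ?case by (simp add: ncR_def)
qed

lemma ncsubst_diagonal:
  assumes "P \<in> ncR n"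
  shows "ncsubst n (\<lambda>i j. if i = j \<and> i < n then u i else 0) P = (\<lambda>w. P w * prod_list (map u w))"
proof
  fix v
  let ?M = "\<lambda>i j. if i = j \<and> i < n then u i else 0"
  have prod: "(\<Prod>t<length w. ?M (v ! t) (w ! t)) = (if v = w then prod_list (map u w) else 0)"
    if "length v = length w" "P w \<noteq> 0" for w
  proof (cases "v = w")
    case True
    have "set w \<subseteq> {..<n}" using assms that by (auto simp: ncR_def)
    then have "(\<Prod>t<length w. ?M (w ! t) (w ! t)) = (\<Prod>t<length w. map u w ! t)"
    proof (intro prod.cong refl)
      fix t assume "t \<in> {..<length w}"
      then have "t < length w" "w ! t \<in> set w" by auto
      with \<open>set w \<subseteq> {..<n}\<close> show "?M (w ! t) (w ! t) = map u w ! t" by (simp add: subset_iff)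
    qed
    also have "\<dots> = prod_list (map u w)"
      by (simp add: prod.list_conv_set_nth lessThan_atLeast0)
    finally have "(\<Prod>t<length w. ?M (w ! t) (w ! t)) = prod_list (map u w)" .
    then show ?thesis unfolding True by simp
  next
    case False
    have "\<exists>t<length w. v ! t \<noteq> w ! t"
    proof (rule ccontr)
      assume "\<not> ?thesis"
      then have "v = w" using that(1) by (intro nth_equalityI) simp_all
      with False show False by simp
    qed
    then obtain t where t: "t < length w" "v ! t \<noteq> w ! t" by blast
    have "(\<Prod>t<length w. ?M (v ! t) (w ! t)) = 0"
      by (rule prod_zero) (use t in \<open>auto intro!: bexI [of _ t]\<close>)
    then show ?thesis using False by simp
  qed
  have "ncsubst n ?M P v = (\<Sum>w\<in>{w. P w \<noteq> 0}. if v = w then P v * prod_list (map u v) else 0)"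
    unfolding ncsubst_def
  proof (intro sum.cong refl)
    fix w assume "w \<in> {w. P w \<noteq> 0}"
    then have w: "P w \<noteq> 0" by simp
    show "(if length v = length w then P w * (\<Prod>t<length w. ?M (v ! t) (w ! t)) else 0)
      = (if v = w then P v * prod_list (map u v) else 0)"
    proof (cases "length v = length w")
      case True
      show ?thesis unfolding prod [OF True w] using True by simp
    next
      case False
      then show ?thesis by auto
    qed
  qed
  also have "\<dots> = P v * prod_list (map u v)"
    using assms by (auto simp: ncR_def)
  finally show "ncsubst n ?M P v = P v * prod_list (map u v)" .
qed

lemma ncsubst_diagonal_ideal:
  fixes G G' :: "(nat list \<Rightarrow> complex) set"
  assumes G: "G \<subseteq> ncR n" and u: "\<And>i. u i \<noteq> 0"
    and 1: "\<And>g. g \<in> G \<Longrightarrow> \<exists>g'\<in>G'. \<exists>s. (\<lambda>w. g w * prod_list (map u w)) = (\<lambda>w. s * g' w)"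
    and 2: "\<And>g. g \<in> G' \<Longrightarrow> \<exists>g'\<in>G. \<exists>s. (\<lambda>w. g w * prod_list (map (\<lambda>i. inverse (u i)) w)) = (\<lambda>w. s * g' w)"
  shows "ncsubst n (\<lambda>i j. if i = j \<and> i < n then u i else 0) ` nc_ideal n G = nc_ideal n G'"
proof (intro equalityI subsetI)
  fix P assume "P \<in> ncsubst n (\<lambda>i j. if i = j \<and> i < n then u i else 0) ` nc_ideal n G"
  then obtain Q where Q: "Q \<in> nc_ideal n G" "P = ncsubst n (\<lambda>i j. if i = j \<and> i < n then u i else 0) Q" by blast
  have "P = (\<lambda>w. Q w * prod_list (map u w))"
    unfolding Q(2) by (intro ncsubst_diagonal nc_ideal_subset_ncR [OF G Q(1)])
  then show "P \<in> nc_ideal n G'" using nc_ideal_scale [OF Q(1) 1] by simp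
next
  fix P assume "P \<in> nc_ideal n G'"
  then have Q: "(\<lambda>w. P w * prod_list (map (\<lambda>i. inverse (u i)) w)) \<in> nc_ideal n G" (is "?Q \<in> _")
    by (rule nc_ideal_scale [OF _ 2])
  have inv: "prod_list (map (\<lambda>i. inverse (u i)) w) * prod_list (map u w) = 1" for w
    using u by (induction w) (auto simp: field_simps)
  have "ncsubst n (\<lambda>i j. if i = j \<and> i < n then u i else 0) ?Q = (\<lambda>w. ?Q w * prod_list (map u w))"
    by (intro ncsubst_diagonal nc_ideal_subset_ncR [OF G Q])
  also have "\<dots> = P" by (simp add: mult.assoc inv)
  finally show "P \<in> ncsubst n (\<lambda>i j. if i = j \<and> i < n then u i else 0) ` nc_ideal n G"
    by (intro image_eqI [OF _ Q]) (rule sym)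
qed

text \<open>A diagonal matrix respects any filtration spanned by generators.\<close>

lemma filtered_aut_diagonal:
  assumes "\<And>i. u i \<noteq> 0"
  shows "filtered_aut n b I (\<lambda>i j. if i = j \<and> i < n then u i else 0)"
proof -
  have "\<forall>i<n. \<forall>j<n.
    (\<Sum>k<n. (if i = k \<and> i < n then u i else 0) * (if k = j then inverse (u k) else 0)) = (if i = j then 1 else 0) \<and>
    (\<Sum>k<n. (if i = k then inverse (u i) else 0) * (if k = j \<and> k < n then u k else 0)) = (if i = j then 1 else 0)"
  proof (intro allI impI conjI)
    fix i j assume ij: "i < n" "j < n"
    have "(\<Sum>k<n. (if i = k \<and> i < n then u i else 0) * (if k = j then inverse (u k) else 0))
       = (\<Sum>k<n. if k = i then (if i = j then 1 else 0) else 0)"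
      using ij assms by (intro sum.cong refl) auto
    then show "(\<Sum>k<n. (if i = k \<and> i < n then u i else 0) * (if k = j then inverse (u k) else 0)) = (if i = j then 1 else 0)"
      using ij by simp
    have "(\<Sum>k<n. (if i = k then inverse (u i) else 0) * (if k = j \<and> k < n then u k else 0))
       = (\<Sum>k<n. if k = i then (if i = j then 1 else 0) else 0)"
      using ij assms by (intro sum.cong refl) auto
    then show "(\<Sum>k<n. (if i = k then inverse (u i) else 0) * (if k = j \<and> k < n then u k else 0)) = (if i = j then 1 else 0)"
      using ij by simp
  qed
  then have "\<exists>M'. \<forall>i<n. \<forall>j<n.
    (\<Sum>k<n. (if i = k \<and> i < n then u i else 0) * M' k j) = (if i = j then 1 else 0) \<and>
    (\<Sum>k<n. M' i k * (if k = j \<and> k < n then u k else 0)) = (if i = j then 1 else 0)"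
    by (intro exI [of _ "\<lambda>i j. if i = j then inverse (u i) else 0"])
  then show ?thesis by (auto simp: filtered_aut_def)
qed

context smoothing
begin

lemma stage_exists:
  "m \<ge> 1 \<Longrightarrow> \<exists>C. all_overlaps m C (Suc m) \<and> (\<forall>a b k l. relw a b k l \<in> Th (Suc 0) \<longrightarrow> C b a k l = 1)"
proof (induction m rule: nat_induct_at_least)
  case base
  show ?case using stage_1 [of "\<lambda>_ _ _ _. 1"] by (intro exI [of _ "\<lambda>_ _ _ _. 1"]) simp
next
  case (Suc m)
  then obtain C where C: "all_overlaps m C (Suc m)" "\<And>a b k l. relw a b k l \<in> Th (Suc 0) \<Longrightarrow> C b a k l = 1"
    by blast
  obtain C' where C': "all_overlaps (Suc m) C' (Suc (Suc m))"
    "\<And>a b k l. relw a b k l \<notin> Th (Suc m) \<Longrightarrow> C' b a k l = C b a k l"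
    using stage_step [OF C(1) Suc.hyps] by blast
  have "C' b a k l = 1" if "relw a b k l \<in> Th (Suc 0)" for a b k l
  proof -
    have "relw a b k l \<notin> Th (Suc m)"
      using Theta_unique [OF that, of "Suc m"] Suc.hyps by auto
    then show ?thesis using C(2) [OF that] C'(2) by simp
  qed
  with C'(1) show ?case by blast
qed

text \<open>Reduction preserves length, so the level of an overlap term is the sum of
  \<open>level\<close> over three letters minus that over three others.\<close>

lemma obstruction_bound:
  assumes "a < b" "b < c" "c < n"
    and nz: "poly.coeff (coef (reduction_system.Phi n q (GC N C) (reduction_system.overlap n q (GC N C) c b a)) v) s \<noteq> 0"
  shows "real s \<le> 6 * (\<Sum>k<n. \<bar>level k\<bar>)"
proof -
  interpret A: graded_system n level q "GC N C" Th by (rule graded_system_GC)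
  have w: "(\<lambda>k. wt v k - wt [a, b, c] k) \<in> Th s"
    by (rule A.overlap_wt [OF assms])
  have "v \<in> Poly_Mapping.keys (A.Phi (A.overlap c b a))" using nz by (auto simp: in_keys_iff)
  then have v: "set v \<subseteq> {..<n}" by (rule A.Phi_keys)
  have abc: "set [a, b, c] \<subseteq> {..<n}" using assms by auto
  have "length v = length [a, b, c]" using length_of_weight [OF v abc w] .
  then obtain x y z where xyz: "v = [x, y, z]" by (auto simp: length_Suc_conv)
  have bound: "\<bar>level k\<bar> \<le> (\<Sum>k<n. \<bar>level k\<bar>)" if "k < n" for k
    using that by (intro member_le_sum) auto
  have "real s = (\<Sum>k<n. level k * of_int (wt v k)) - (\<Sum>k<n. level k * of_int (wt [a, b, c] k))"
    using level_Theta [OF w] by (simp only: of_int_diff right_diff_distrib sum_subtractf)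
  also have "\<dots> = level x + level y + level z - (level a + level b + level c)"
    unfolding sum_wt [OF v] sum_wt [OF abc] by (simp add: xyz)
  also have "\<dots> \<le> 6 * (\<Sum>k<n. \<bar>level k\<bar>)"
    using bound [of x] bound [of y] bound [of z] bound [of a] bound [of b] bound [of c] v assms
    by (simp add: xyz)
  finally show ?thesis .
qed

theorem overlap_free_exists:
  obtains N C where "1 \<le> N" "\<And>a b k l. relw a b k l \<in> Th (Suc 0) \<Longrightarrow> C b a k l = 1"
    "\<And>a b c. a < b \<Longrightarrow> b < c \<Longrightarrow> c < n \<Longrightarrow>
       reduction_system.Phi n q (GC N C) (reduction_system.overlap n q (GC N C) c b a) = 0"
proof -
  \<comment> \<open>Beyond this order no overlap has a term, so resolving the orders up to
    \<open>N\<close> resolves all of them.\<close>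
  define N where "N = Suc (nat \<lceil>6 * (\<Sum>k<n. \<bar>level k\<bar>)\<rceil>)"
  have N: "6 * (\<Sum>k<n. \<bar>level k\<bar>) < real N" unfolding N_def by linarith
  obtain C where C: "all_overlaps N C (Suc N)" "\<And>a b k l. relw a b k l \<in> Th (Suc 0) \<Longrightarrow> C b a k l = 1"
    using stage_exists [of N] by (auto simp: N_def)
  have "reduction_system.Phi n q (GC N C) (reduction_system.overlap n q (GC N C) c b a) = 0" (is "?O = 0")
    if abc: "a < b" "b < c" "c < n" for a b c
  proof (intro poly_mapping_eqI poly_eqI)
    fix v s
    have "poly.coeff (coef ?O v) s = 0"
    proof (cases "s < Suc N")
      case True
      have "?O \<in> epsI (Suc N)" using C(1) abc by (simp add: all_overlaps_def)
      then show ?thesis using True by (simp add: epsI_iff)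
    next
      case False
      then show ?thesis using obstruction_bound [OF abc, of N C v s] N by force
    qed
    then show "poly.coeff (coef ?O v) s = poly.coeff (coef 0 v) s" by simp
  qed
  then show thesis using that [of N C] C(2) by (simp add: N_def)
qed

lemma GC_scaled:
  "GC N (\<lambda>b a k l. C b a k l * r b a k l) b a k l = [:r b a k l:] * GC N C b a k l"
  by (rule poly_eqI) (simp add: coeff_GC)

text \<open>Scaling the letters conjugates the two sets of rules, so the coefficient of
  \<open>v\<close> in the normal form of \<open>w\<close> is multiplied by
  \<open>\<tau> v / \<tau> w\<close>.\<close>

lemma torus_overlaps:
  assumes t: "\<And>i. t i \<noteq> (0 :: complex)"
    and ov: "\<And>a b c. a < b \<Longrightarrow> b < c \<Longrightarrow> c < n \<Longrightarrow>
      reduction_system.Phi n q (GC N C) (reduction_system.overlap n q (GC N C) c b a) = 0"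
    and abc: "a < b" "b < c" "c < n"
  defines "C' \<equiv> \<lambda>b a k l. C b a k l * (t k * t l / (t a * t b))"
  shows "reduction_system.Phi n q (GC N C') (reduction_system.overlap n q (GC N C') c b a) = 0"
proof -
  interpret A: graded_system n level q "GC N C" Th by (rule graded_system_GC)
  interpret B: graded_system n level q "GC N C'" Th by (rule graded_system_GC)
  define \<tau> where "\<tau> w = prod_list (map t w)" for w
  have \<tau>_nz: "\<tau> w \<noteq> 0" for w using t by (induction w) (auto simp: \<tau>_def)
  have F: "B.F b a k l = [:t k * t l / (t a * t b):] * A.F b a k l" for b a k l
  proof -
    have "GC N C' b a k l = [:t k * t l / (t a * t b):] * GC N C b a k l"
      unfolding C'_def by (rule GC_scaled [where r = "\<lambda>b a k l. t k * t l / (t a * t b)"])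
    then show ?thesis using t [of a] t [of b] by (simp add: A.F_def B.F_def)
  qed
  have const: "[:x:] * [:y:] = [:x * y:]" for x y :: complex by simp
  have nf: "coef (B.nf w) v = [:\<tau> v / \<tau> w:] * coef (A.nf w) v" if "set w \<subseteq> {..<n}" for w v
    using that
  proof (induction w rule: A.reduction_induct)
    case (sorted w)
    then show ?case using \<tau>_nz [of v] by (simp add: A.nf_sorted B.nf_sorted coef_mon one_pCons [symmetric])
  next
    case (step u b a z)
    have ab: "a < b" "b < n" using step.hyps by auto
    have eq: "B.F b a k l * coef (B.nf (u @ [k, l] @ z)) v
        = [:\<tau> v / \<tau> (u @ b # a # z):] * (A.F b a k l * coef (A.nf (u @ [k, l] @ z)) v)"
      if kl: "k < n" "l < n" for k l
    proof (cases "A.F b a k l = 0")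
      case True
      then show ?thesis by (simp add: F)
    next
      case False
      have IH: "coef (B.nf (u @ [k, l] @ z)) v = [:\<tau> v / \<tau> (u @ [k, l] @ z):] * coef (A.nf (u @ [k, l] @ z)) v"
        using step.IH [OF False kl] A.prec_F [OF ab False, of u z] by simp
      have "t k * t l / (t a * t b) * (\<tau> v / \<tau> (u @ [k, l] @ z)) = \<tau> v / \<tau> (u @ b # a # z)"
        using t \<tau>_nz [of u] \<tau>_nz [of z] by (simp add: \<tau>_def)
      then have E: "[:t k * t l / (t a * t b):] * [:\<tau> v / \<tau> (u @ [k, l] @ z):] = [:\<tau> v / \<tau> (u @ b # a # z):]"
        by (simp only: const)
      show ?thesis unfolding F IH E [symmetric] by (simp only: ac_simps)
    qed
    show ?case
      unfolding A.nf_step' [OF step.hyps(1-3)] B.nf_step' [OF step.hyps(1-3)] lookup_sum coef_sm sum_distrib_left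
      by (intro sum.cong refl eq) simp_all
  qed
  have lt: "a < n" "b < n" using abc by auto
  show ?thesis
  proof (rule poly_mapping_eqI)
    fix v
    have "coef (B.Phi (B.overlap c b a)) v
       = coef (B.nf [c, b, a]) v - (\<Sum>k<n. \<Sum>l<n. B.F c b k l * coef (B.nf [k, l, a]) v)"
      using abc by (simp add: B.Phi_overlap_nf lookup_minus lookup_sum)
    also have "(\<Sum>k<n. \<Sum>l<n. B.F c b k l * coef (B.nf [k, l, a]) v)
       = (\<Sum>k<n. \<Sum>l<n. [:\<tau> v / \<tau> [c, b, a]:] * (A.F c b k l * coef (A.nf [k, l, a]) v))"
    proof (intro sum.cong refl)
      fix k l assume "k \<in> {..<n}" "l \<in> {..<n}"
      then have e: "coef (B.nf [k, l, a]) v = [:\<tau> v / \<tau> [k, l, a]:] * coef (A.nf [k, l, a]) v"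
        using lt by (intro nf) auto
      have "t k * t l / (t b * t c) * (\<tau> v / \<tau> [k, l, a]) = \<tau> v / \<tau> [c, b, a]"
        using t by (simp add: \<tau>_def)
      then have E: "[:t k * t l / (t b * t c):] * [:\<tau> v / \<tau> [k, l, a]:] = [:\<tau> v / \<tau> [c, b, a]:]"
        by (simp only: const)
      show "B.F c b k l * coef (B.nf [k, l, a]) v
         = [:\<tau> v / \<tau> [c, b, a]:] * (A.F c b k l * coef (A.nf [k, l, a]) v)"
        unfolding F e E [symmetric] by (simp only: ac_simps)
    qed
    also have "coef (B.nf [c, b, a]) v = [:\<tau> v / \<tau> [c, b, a]:] * coef (A.nf [c, b, a]) v"
      using lt abc by (intro nf) auto
    also have "[:\<tau> v / \<tau> [c, b, a]:] * coef (A.nf [c, b, a]) v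
        - (\<Sum>k<n. \<Sum>l<n. [:\<tau> v / \<tau> [c, b, a]:] * (A.F c b k l * coef (A.nf [k, l, a]) v))
        = [:\<tau> v / \<tau> [c, b, a]:] * coef (A.Phi (A.overlap c b a)) v"
      using abc by (simp only: A.Phi_overlap_nf lookup_minus lookup_sum coef_sm right_diff_distrib sum_distrib_left)
    also have "\<dots> = 0" using ov [OF abc] by simp
    finally show "coef (B.Phi (B.overlap c b a)) v = coef 0 v" by simp
  qed
qed

lemma defrel_eq_GC: "defrel n q Th N C a b = (\<lambda>w. (if w = [b, a] then -1 else 0)
    + (if w = [a, b] then [:q b a:] else 0) + (case w of [k, l] \<Rightarrow> GC N C b a k l | _ \<Rightarrow> 0))"
  unfolding defrel_def GC_def ..

lemma defrel_eq_rel: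
  assumes "a < b" "b < n"
  shows "defrel n q Th N C a b = coef (reduction_system.rel n q (GC N C) b a)"
proof -
  interpret A: graded_system n level q "GC N C" Th by (rule graded_system_GC)
  have f: "(if k < n \<and> l < n then GC N C b a k l else 0) = GC N C b a k l" for k l
    by (simp add: GC_def)
  have g: "coef (A.g b a) w = (case w of [k, l] \<Rightarrow> GC N C b a k l | _ \<Rightarrow> 0)" for w
    unfolding A.coef_g f ..
  have sum: "x = x' \<Longrightarrow> y = y' \<Longrightarrow> x + y + z = x' + y' + z" for x x' y y' z :: "complex poly"
    by simp
  show ?thesis
  proof
    fix w
    show "defrel n q Th N C a b w = coef (A.rel b a) w"
      unfolding defrel_eq_GC A.rel_def lookup_add g lookup_uminus coef_sm coef_mon
      by (rule sum) auto
  qed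
qed

lemma defgens_eq_gens: "defgens n q Th N C = reduction_system.gens n q (GC N C)"
proof -
  interpret A: graded_system n level q "GC N C" Th by (rule graded_system_GC)
  show ?thesis
    unfolding defgens_def A.gens_def
  proof (intro Collect_cong ex_cong1)
    fix x a b
    show "(x = defrel n q Th N C a b \<and> a < b \<and> b < n) = (x = coef (A.rel b a) \<and> a < b \<and> b < n)"
      using defrel_eq_rel [of a b N C] by (cases "a < b"; cases "b < n") simp_all
  qed
qed

lemma flat_iff_overlaps:
  "flat_deformation n q (defgens n q Th N C) \<longleftrightarrow> (\<forall>a b c. a < b \<and> b < c \<and> c < n \<longrightarrow>
     reduction_system.Phi n q (GC N C) (reduction_system.overlap n q (GC N C) c b a) = 0)"
proof -
  interpret A: graded_system n level q "GC N C" Th by (rule graded_system_GC)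
  show ?thesis
    unfolding defgens_eq_gens
  proof (intro iffI allI impI)
    fix a b c assume "flat_deformation n q A.gens" "a < b \<and> b < c \<and> c < n"
    then show "A.Phi (A.overlap c b a) = 0" by (elim conjE) (rule A.overlaps_if_flat)
  next
    assume "\<forall>a b c. a < b \<and> b < c \<and> c < n \<longrightarrow> A.Phi (A.overlap c b a) = 0"
    then show "flat_deformation n q A.gens" by (intro A.flat_if_overlaps) simp
  qed
qed

text \<open>The torus point whose value on the weight \<open>th i\<close> is exp (z_i), available
  because the functionals \<open>dual\<close> are dual to the \<open>th i\<close>.\<close>

definition character :: "(nat \<Rightarrow> complex) \<Rightarrow> nat \<Rightarrow> complex" where
  "character z k = exp (\<Sum>i\<in>I. z i * dual i k)"

lemma character_nonzero: "character z k \<noteq> 0"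
  by (simp add: character_def)

lemma character_th:
  assumes "i \<in> I"
  shows "(\<Sum>k<n. (\<Sum>i'\<in>I. z i' * dual i' k) * of_int (th i k)) = z i"
proof -
  have "(\<Sum>k<n. (\<Sum>i'\<in>I. z i' * dual i' k) * of_int (th i k))
      = (\<Sum>k<n. \<Sum>i'\<in>I. z i' * (dual i' k * of_int (th i k)))"
    by (intro sum.cong refl) (simp only: sum_distrib_right mult.assoc)
  also have "\<dots> = (\<Sum>i'\<in>I. \<Sum>k<n. z i' * (dual i' k * of_int (th i k)))" by (rule sum.swap)
  also have "\<dots> = (\<Sum>i'\<in>I. if i' = i then z i else 0)"
  proof (intro sum.cong refl)
    fix i' assume "i' \<in> I"
    then have d: "(\<Sum>k<n. dual i' k * of_int (th i k)) = (if i' = i then 1 else 0)"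
      using assms by (rule dual_th)
    have "(\<Sum>k<n. z i' * (dual i' k * of_int (th i k))) = z i' * (\<Sum>k<n. dual i' k * of_int (th i k))"
      by (rule sum_distrib_left [symmetric])
    also have "\<dots> = (if i' = i then z i else 0)" unfolding d by simp
    finally show "(\<Sum>k<n. z i' * (dual i' k * of_int (th i k))) = (if i' = i then z i else 0)" .
  qed
  also have "\<dots> = z i" using assms finite_I by simp
  finally show ?thesis .
qed

text \<open>Equal parameters give a one-parameter subgroup acting on weights in \<open>Th m\<close>
  by an \<open>m\<close>-th power; it absorbs a change of \<epsilon>.\<close>

lemma character_Theta:
  assumes "w \<in> Th m"
  shows "(\<Sum>k<n. (\<Sum>i'\<in>I. z * dual i' k) * of_int (w k)) = of_nat m * z"
proof -
  obtain f where f: "\<forall>t<m. f t \<in> I" "w = (\<lambda>k. \<Sum>t<m. th (f t) k)"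
    using assms by (auto simp: Theta_def)
  have "(\<Sum>k<n. (\<Sum>i'\<in>I. z * dual i' k) * of_int (w k))
     = (\<Sum>k<n. \<Sum>t<m. (\<Sum>i'\<in>I. z * dual i' k) * of_int (th (f t) k))"
    unfolding f(2) of_int_sum sum_distrib_left ..
  also have "\<dots> = (\<Sum>t<m. \<Sum>k<n. (\<Sum>i'\<in>I. z * dual i' k) * of_int (th (f t) k))" by (rule sum.swap)
  also have "\<dots> = (\<Sum>t<m. z)"
    using f(1) by (intro sum.cong refl character_th [where z = "\<lambda>_. z"]) auto
  finally show ?thesis by simp
qed

lemma character_relw:
  assumes "a < n" "b < n" "k < n" "l < n"
  shows "character z k * character z l / (character z a * character z b)
    = exp (\<Sum>j<n. (\<Sum>i\<in>I. z i * dual i j) * of_int (relw a b k l j))"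
proof -
  let ?s = "\<lambda>j. \<Sum>i\<in>I. z i * dual i j"
  have "(\<Sum>j<n. ?s j * of_int (relw a b k l j))
      = (\<Sum>j<n. ?s j * of_int (wt [k, l] j)) - (\<Sum>j<n. ?s j * of_int (wt [a, b] j))"
    by (simp only: relw_wt of_int_diff right_diff_distrib sum_subtractf)
  also have "\<dots> = (?s k + ?s l) - (?s a + ?s b)"
    using sum_wt [of "[k, l]" n ?s] sum_wt [of "[a, b]" n ?s] assms by (simp del: wt_simps)
  finally show ?thesis by (simp add: character_def exp_add exp_diff)
qed

definition log_of :: "complex \<Rightarrow> complex" where
  "log_of c = (SOME z. exp z = c)"

lemma exp_log_of: "c \<noteq> 0 \<Longrightarrow> exp (log_of c) = c"
  unfolding log_of_def by (rule someI_ex) (rule complex_exp_surj)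

text \<open>Moves the constants \<open>C\<close> by the torus point which, for nonzero
  \<open>\<gamma>\<close>, takes the value \<open>\<gamma> i\<close> on \<open>th i\<close>.\<close>

definition twisted :: "(nat \<Rightarrow> nat \<Rightarrow> nat \<Rightarrow> nat \<Rightarrow> complex) \<Rightarrow> (nat \<Rightarrow> complex)
    \<Rightarrow> nat \<Rightarrow> nat \<Rightarrow> nat \<Rightarrow> nat \<Rightarrow> complex" where
  "twisted C \<gamma> b a k l = C b a k l * (character (\<lambda>i. log_of (\<gamma> i)) k * character (\<lambda>i. log_of (\<gamma> i)) l
     / (character (\<lambda>i. log_of (\<gamma> i)) a * character (\<lambda>i. log_of (\<gamma> i)) b))"

lemma twisted_first_order:
  assumes C: "\<And>a b k l. relw a b k l \<in> Th (Suc 0) \<Longrightarrow> C b a k l = 1"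
    and i: "i \<in> I" "relw a b k l = th i" "\<gamma> i \<noteq> 0" and lt: "a < n" "b < n" "k < n" "l < n"
  shows "twisted C \<gamma> b a k l = \<gamma> i"
proof -
  have "C b a k l = 1" by (rule C) (unfold i(2), rule th_in_Theta [OF i(1)])
  then show ?thesis
    using character_relw [OF lt] character_th [OF i(1)] i by (simp add: twisted_def exp_log_of)
qed

lemma twisted_flat:
  assumes "\<And>a b c. a < b \<Longrightarrow> b < c \<Longrightarrow> c < n \<Longrightarrow>
    reduction_system.Phi n q (GC N C) (reduction_system.overlap n q (GC N C) c b a) = 0"
  shows "flat_deformation n q (defgens n q Th N (twisted C \<gamma>))"
  unfolding flat_iff_overlaps
proof (intro allI impI)
  fix a b c assume abc: "a < b \<and> b < c \<and> c < n"
  have tw: "twisted C \<gamma> = (\<lambda>b a k l. C b a k l * (character (\<lambda>i. log_of (\<gamma> i)) k * character (\<lambda>i. log_of (\<gamma> i)) l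
     / (character (\<lambda>i. log_of (\<gamma> i)) a * character (\<lambda>i. log_of (\<gamma> i)) b)))"
    by (simp add: twisted_def fun_eq_iff)
  show "reduction_system.Phi n q (GC N (twisted C \<gamma>)) (reduction_system.overlap n q (GC N (twisted C \<gamma>)) c b a) = 0"
    unfolding tw
  proof (rule torus_overlaps [where t = "character (\<lambda>i. log_of (\<gamma> i))" and C = C and N = N])
    show "character (\<lambda>i. log_of (\<gamma> i)) i \<noteq> 0" for i by (rule character_nonzero)
    show "reduction_system.Phi n q (GC N C) (reduction_system.overlap n q (GC N C) c b a) = 0"
      if "a < b" "b < c" "c < n" for a b c using that by (rule assms)
  qed (use abc in simp_all)
qed

text \<open>The scaling \<open>u\<close> undoes the twist by \<open>\<gamma>\<close>, applies the
  one by \<open>\<gamma>'\<close> and multiplies weights in \<open>Th s\<close> by the power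
  \<open>(c' / c) ^ s\<close>. The undeformed terms see only the common factor
  \<open>u a * u b\<close>.\<close>

lemma twisted_spec:
  fixes \<gamma> \<gamma>' :: "nat \<Rightarrow> complex"
  assumes c: "c \<noteq> 0" "c' \<noteq> 0" and lt: "a < n" "b < n"
  defines "u \<equiv> \<lambda>k. character (\<lambda>i. log_of (\<gamma>' i)) k * character (\<lambda>_. log_of (c' / c)) k / character (\<lambda>i. log_of (\<gamma> i)) k"
  shows "(\<lambda>w. spec c (defrel n q Th N (twisted C \<gamma>) a b) w * prod_list (map u w))
     = (\<lambda>w. u a * u b * spec c' (defrel n q Th N (twisted C \<gamma>') a b) w)"
proof
  fix w
  define x y z where "x = character (\<lambda>i. log_of (\<gamma>' i))" and "y = character (\<lambda>_. log_of (c' / c))"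
    and "z = character (\<lambda>i. log_of (\<gamma> i))"
  have nz: "x k \<noteq> 0" "y k \<noteq> 0" "z k \<noteq> 0" for k by (simp_all add: x_def y_def z_def character_nonzero)
  have u: "u k = x k * y k / z k" for k by (simp add: u_def x_def y_def z_def)
  have yw: "y k * y l / (y a * y b) = (c' / c) ^ s" if "relw a b k l \<in> Th s" "k < n" "l < n" for k l s
    using character_relw [OF lt that(2,3), of "\<lambda>_. log_of (c' / c)"] character_Theta [OF that(1)] c
    by (simp add: y_def exp_of_nat_mult exp_log_of)
  have main: "poly (GC N (twisted C \<gamma>) b a k l) c * (u k * u l) = u a * u b * poly (GC N (twisted C \<gamma>') b a k l) c'"
    for k l
  proof (cases "k \<le> l \<and> l < n")
    case True
    have p: "poly (GC N D b a k l) e = (\<Sum>s\<in>{1..N}. if relw a b k l \<in> Th s then D b a k l * e ^ s else 0)" for D e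
      using True by (simp add: GC_def poly_sum poly_monom if_distrib [of "\<lambda>p. poly p e"] cong: if_cong)
    show ?thesis
      unfolding p sum_distrib_left sum_distrib_right
    proof (intro sum.cong refl)
      fix s
      show "(if relw a b k l \<in> Th s then twisted C \<gamma> b a k l * c ^ s else 0) * (u k * u l)
         = u a * u b * (if relw a b k l \<in> Th s then twisted C \<gamma>' b a k l * c' ^ s else 0)"
      proof (cases "relw a b k l \<in> Th s")
        case rw: True
        have "y k * y l = y a * y b * (c' / c) ^ s"
        proof -
          have "k < n" "l < n" using True by auto
          note yw [OF rw this]
          moreover have "y k * y l = y k * y l / (y a * y b) * (y a * y b)" using nz by simp
          ultimately show ?thesis by (simp only: mult.commute)
        qed
        then have "y k * y l * c ^ s = y a * y b * c' ^ s"
        proof -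
          have "(c' / c) ^ s * c ^ s = c' ^ s" using c by (simp add: power_divide)
          then show ?thesis by (simp only: \<open>y k * y l = _\<close> mult.assoc)
        qed
        moreover have "twisted C \<gamma> b a k l = C b a k l * (z k * z l / (z a * z b))"
          "twisted C \<gamma>' b a k l = C b a k l * (x k * x l / (x a * x b))"
          by (simp_all add: twisted_def x_def z_def)
        moreover have "C b a k l * (z k * z l / (z a * z b)) * c ^ s * (u k * u l)
            = C b a k l * (x k * x l) / (z a * z b) * (y k * y l * c ^ s)"
        proof -
          have zu: "z j * u j = x j * y j" for j using nz by (simp add: u)
          have "C b a k l * (z k * z l / (z a * z b)) * c ^ s * (u k * u l)
            = C b a k l / (z a * z b) * c ^ s * ((z k * u k) * (z l * u l))" by simp
          also have "\<dots> = C b a k l * (x k * x l) / (z a * z b) * (y k * y l * c ^ s)"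
            unfolding zu by simp
          finally show ?thesis .
        qed
        moreover have "u a * u b * (C b a k l * (x k * x l / (x a * x b)) * c' ^ s)
            = C b a k l * (x k * x l) / (z a * z b) * (y a * y b * c' ^ s)"
        proof -
          have ux: "u j / x j = y j / z j" for j using nz by (simp add: u)
          have "u a * u b * (C b a k l * (x k * x l / (x a * x b)) * c' ^ s)
            = C b a k l * (x k * x l) * c' ^ s * ((u a / x a) * (u b / x b))" by simp
          then show ?thesis unfolding ux by simp
        qed
        ultimately show ?thesis using rw by simp
      qed simp
    qed
  next
    case False
    have "GC N D b a k l = 0" for D using False by (auto simp: GC_def)
    then show ?thesis by simp
  qed
  show "spec c (defrel n q Th N (twisted C \<gamma>) a b) w * prod_list (map u w)
     = u a * u b * spec c' (defrel n q Th N (twisted C \<gamma>') a b) w"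
  proof (cases "\<exists>k l. w = [k, l]")
    case True
    then obtain k l where w: "w = [k, l]" by blast
    have "poly (if [k, l] = [b, a] then -1 else 0) c * (u k * u l)
        = u a * u b * poly (if [k, l] = [b, a] then -1 else 0) c'" by auto
    moreover have "poly (if [k, l] = [a, b] then [:q b a:] else 0) c * (u k * u l)
        = u a * u b * poly (if [k, l] = [a, b] then [:q b a:] else 0) c'" by auto
    ultimately show ?thesis
      using main [of k l] unfolding defrel_eq_GC spec_def w
      by (simp only: poly_add distrib_left distrib_right list.case list.map prod_list.Cons prod_list.Nil mult_1_right)
  next
    case False
    then have "defrel n q Th N D a b w = 0" for D
      unfolding defrel_eq_GC by (auto split: list.splits)
    then show ?thesis by (simp add: spec_def)
  qed
qed

section \<open>Uniqueness and independence of the constants\<close>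

text \<open>At the lowest order of difference, consider the overlap of \<open>a\<close>,
  \<open>b\<close> and a regular letter \<open>d\<close> at the sorted word with letters
  \<open>k\<close>, \<open>l\<close>, \<open>d\<close>. Excluding linear weights keeps
  \<open>a\<close> and \<open>b\<close> out of this word, so two of the three brackets vanish and
  the third has a nonzero factor.\<close>

lemma deformation_unique:
  assumes no_linear: "\<forall>m\<ge>1. \<forall>a<n. \<forall>a'<n. a \<noteq> a' \<longrightarrow> (\<lambda>k. unitw a k - unitw a' k) \<notin> Th m"
    and N: "1 \<le> N" "1 \<le> N'"
    and C: "\<And>a b k l i. a < b \<Longrightarrow> b < n \<Longrightarrow> k \<le> l \<Longrightarrow> l < n \<Longrightarrow> i \<in> I \<Longrightarrow> relw a b k l = th i \<Longrightarrow> C b a k l = \<gamma> i"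
    and C': "\<And>a b k l i. a < b \<Longrightarrow> b < n \<Longrightarrow> k \<le> l \<Longrightarrow> l < n \<Longrightarrow> i \<in> I \<Longrightarrow> relw a b k l = th i \<Longrightarrow> C' b a k l = \<gamma> i"
    and flat: "flat_deformation n q (defgens n q Th N C)" "flat_deformation n q (defgens n q Th N' C')"
    and ab: "a < b" "b < n"
  shows "GC N C b a k l = GC N' C' b a k l"
proof (rule ccontr)
  define P where "P s \<longleftrightarrow> (\<exists>a b k l. a < b \<and> b < n \<and>
    poly.coeff (GC N C b a k l) s \<noteq> poly.coeff (GC N' C' b a k l) s)" for s
  assume "GC N C b a k l \<noteq> GC N' C' b a k l"
  then obtain s where "poly.coeff (GC N C b a k l) s \<noteq> poly.coeff (GC N' C' b a k l) s"
    by (metis poly_eqI)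
  then have "P s" using ab unfolding P_def by blast
  define m where "m = (LEAST s. P s)"
  have "P m" unfolding m_def using \<open>P s\<close> by (rule LeastI)
  have least: "\<not> P j" if "j < m" for j using that not_less_Least unfolding m_def by blast
  obtain a b k l where ab: "a < b" "b < n"
    and ne: "poly.coeff (GC N C b a k l) m \<noteq> poly.coeff (GC N' C' b a k l) m"
    using \<open>P m\<close> unfolding P_def by blast
  define w where "w = relw a b k l"
  have kl: "k \<le> l" "l < n" "k < n" and w: "w \<in> Th m" and m1: "1 \<le> m"
    using ne by (auto simp: coeff_GC w_def split: if_splits)
  \<comment> \<open>At order 1 both constants are prescribed by \<open>\<gamma>\<close>.\<close>
  have m: "m \<ge> 2"
  proof (rule ccontr)
    assume "\<not> m \<ge> 2"
    then have "m = Suc 0" using m1 by simp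
    with w have "w \<in> Th (Suc 0)" by simp
    then obtain i where i: "i \<in> I" "w = th i" using Theta_1 by blast
    have "C b a k l = \<gamma> i" "C' b a k l = \<gamma> i"
      by (rule C [OF ab kl(1,2) i(1) i(2) [unfolded w_def]], rule C' [OF ab kl(1,2) i(1) i(2) [unfolded w_def]])
    then have "C b a k l = C' b a k l" by simp
    with ne \<open>m = Suc 0\<close> N show False by (auto simp: coeff_GC split: if_splits)
  qed
  have w_nonzero: "w \<noteq> (\<lambda>_. 0)"
    using Theta_unique [of w m 0] w Theta_0 m by auto
  have w_eq: "w = (\<lambda>j. unitw k j + unitw l j - unitw a j - unitw b j)"
    by (simp add: w_def relw_def fun_eq_iff)
  have linear: False if "x < n" "y < n" "w = (\<lambda>j. unitw x j - unitw y j)" for x y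
  proof (cases "x = y")
    case True
    then show False using that(3) w_nonzero by simp
  next
    case False
    have "(\<lambda>k. unitw x k - unitw y k) \<notin> Th m"
      by (rule no_linear [rule_format, OF m1 that(1,2) False])
    then show False using w unfolding that(3) by (rule notE)
  qed
  have a: "a < n" using ab by simp
  \<comment> \<open>A common letter would leave a weight e_x - e_y, excluded by hypothesis for
    distinct letters and by its level if it is 0.\<close>
  have notin: "k \<noteq> a" "k \<noteq> b" "l \<noteq> a" "l \<noteq> b"
  proof -
    show "k \<noteq> a" by (rule notI, rule linear [OF kl(2) ab(2)]) (simp only: w_eq, simp)
    show "k \<noteq> b" by (rule notI, rule linear [OF kl(2) a]) (simp only: w_eq, simp)
    show "l \<noteq> a" by (rule notI, rule linear [OF kl(3) ab(2)]) (simp only: w_eq, simp)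
    show "l \<noteq> b" by (rule notI, rule linear [OF kl(3) a]) (simp only: w_eq, simp)
  qed
  have wS: "w j = wt [k, l] j - (if j \<in> {a, b} then 1 else 0)" for j
    using ab(1) by (auto simp: w_def relw_wt)
  obtain d where reg: "regular_at d w"
    using regular_index_exists [OF w m _ _ wS] card_insert_le_m1 [of 2 "{b}" a] by (auto simp: card_insert_if)
  \<comment> \<open>The weight is -1 at \<open>a\<close> and \<open>b\<close>, whereas its entry at
    a regular index is nonnegative.\<close>
  have d: "d < n" "d \<noteq> a" "d \<noteq> b"
    using reg wS [of a] wS [of b] notin by (auto simp: regular_at_def)
  define t where "t = sort ([k, l] @ [d])"
  have t: "sorted t" "set t \<subseteq> {..<n}" "d \<in> set t" "a \<notin> set t" "b \<notin> set t"
    using kl d notin by (auto simp: t_def)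
  have "sorted [k, l]" using kl(1) by simp
  from iffD1 [OF sort_snoc_eq_iff [OF this t(1)] t_def [symmetric]]
  have rt: "remove1 d t = [k, l]" by (rule conjunct2 [THEN sym])
  interpret A: graded_system n level q "GC N C" Th by (rule graded_system_GC)
  interpret B: graded_system n level q "GC N' C'" Th by (rule graded_system_GC)
  interpret P: system_pair n level q "GC N C" "GC N' C'" m
  proof
    fix a b j k l assume "a < b" "b < n" "j < m"
    show "poly.coeff (GC N' C' b a k l) j = poly.coeff (GC N C b a k l) j"
    proof (rule ccontr)
      assume ne: "poly.coeff (GC N' C' b a k l) j \<noteq> poly.coeff (GC N C b a k l) j"
      have "P j" unfolding P_def
        by (rule exI [of _ a], rule exI [of _ b], rule exI [of _ k], rule exI [of _ l])
          (intro conjI \<open>a < b\<close> \<open>b < n\<close> not_sym [OF ne])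
      with least [OF \<open>j < m\<close>] show False by (rule notE)
    qed
  qed
  have ov: "A.Phi (A.overlap z y x) = 0" "B.Phi (B.overlap z y x) = 0" if "x < y" "y < z" "z < n" for x y z
  proof -
    have xyz: "x < y \<and> y < z \<and> z < n" using that by (intro conjI)
    show "A.Phi (A.overlap z y x) = 0"
      by (rule flat(1) [unfolded flat_iff_overlaps, rule_format, OF xyz])
    show "B.Phi (B.overlap z y x) = 0"
      by (rule flat(2) [unfolded flat_iff_overlaps, rule_format, OF xyz])
  qed
  define \<delta> where "\<delta> b a v = poly.coeff (coef (B.g b a) v) m - poly.coeff (coef (A.g b a) v) m" for b a v
  have change: "A.bfac z (q z y * q z x) t * \<delta> y x (remove1 z t)
     - q z y * (A.bfac y (q y z * q y x) t * \<delta> z x (remove1 y t))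
     + q y x * q z x * (A.bfac x (q x z * q x y) t * \<delta> z y (remove1 x t)) = 0"
    if xyz: "x < y" "y < z" "z < n" for x y z
    using P.obstruction_change [OF xyz t(1)] unfolding ov [OF xyz] \<delta>_def by simp
  have out: "A.bfac x \<chi> t = 0" if "x \<in> {a, b}" for x \<chi>
    using that t(4,5) by (auto simp: A.bfac_def)
  have "A.bfac d (prod_list (map (q d) [b, a])) t \<noteq> 0"
  proof (rule bfac_nonzero [OF reg t(2,3)])
    show "w j = wt (remove1 d t) j - wt [b, a] j" for j
      unfolding rt w_def relw_wt by simp
  qed (use ab in auto)
  then have nz: "A.bfac d (q d b * q d a) t \<noteq> 0" by simp
  have \<delta>: "\<delta> b a (remove1 d t) \<noteq> 0"
    unfolding rt \<delta>_def A.coef_g B.coef_g using ne kl by simp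
  have q_nz: "q i j \<noteq> 0" for i j by (simp add: EExp_def)
  consider "b < d" | "a < d" "d < b" | "d < a" using d by linarith
  then show False
  proof cases
    case 1
    show False using change [OF ab(1) 1 d(1)] nz \<delta> by (simp add: out)
  next
    case 2
    show False using change [OF 2 ab(2)] nz \<delta> q_nz by (simp add: out)
  next
    case 3
    show False using change [OF 3 ab] nz \<delta> q_nz by (simp add: out)
  qed
qed

lemma spec_defgens_ncR: "spec c ` defgens n q Th N C \<subseteq> ncR n"
proof
  fix x assume "x \<in> spec c ` defgens n q Th N C"
  then obtain y where y: "y \<in> defgens n q Th N C" "x = spec c y" by blast
  interpret A: graded_system n level q "GC N C" Th by (rule graded_system_GC)
  have "y \<in> ncR n" using y(1) A.gens_ncR unfolding defgens_eq_gens by blast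
  then have fin: "finite {w. y w \<noteq> 0}" and set: "\<And>w. y w \<noteq> 0 \<Longrightarrow> set w \<subseteq> {..<n}"
    unfolding ncR_def by simp_all
  have nz: "y w \<noteq> 0" if "x w \<noteq> 0" for w
    using that unfolding y(2) spec_def by (metis poly_0)
  have "finite {w. x w \<noteq> 0}" by (rule finite_subset [OF _ fin]) (use nz in blast)
  moreover have "set w \<subseteq> {..<n}" if "x w \<noteq> 0" for w by (rule set) (rule nz [OF that])
  ultimately show "x \<in> ncR n" unfolding ncR_def by blast
qed

lemma specializations_isomorphic:
  assumes c: "c \<noteq> 0" "c' \<noteq> 0"
  shows "\<exists>M. filtered_aut n br I M \<and>
    ncsubst n M ` nc_ideal n (spec c ` defgens n q Th N (twisted C \<gamma>))
      = nc_ideal n (spec c' ` defgens n q Th N (twisted C \<gamma>'))"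
proof -
  define u where "u = (\<lambda>k. character (\<lambda>i. log_of (\<gamma>' i)) k * character (\<lambda>_. log_of (c' / c)) k
     / character (\<lambda>i. log_of (\<gamma> i)) k)"
  have u: "u k \<noteq> 0" for k by (simp add: u_def character_nonzero)
  let ?R = "\<lambda>\<gamma>. defrel n q Th N (twisted C \<gamma>)"
  have eq: "spec c (?R \<gamma> a b) w * prod_list (map u w) = u a * u b * spec c' (?R \<gamma>' a b) w"
    if "a < b" "b < n" for a b w
  proof -
    have "a < n" using that by simp
    show ?thesis
      unfolding u_def by (rule fun_cong [OF twisted_spec [OF c \<open>a < n\<close> that(2), of N C \<gamma> \<gamma>'], of w])
  qed
  have inv: "prod_list (map u w) * prod_list (map (\<lambda>i. inverse (u i)) w) = 1" for w
  proof (induction w)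
    case (Cons i w)
    have "prod_list (map u (i # w)) * prod_list (map (\<lambda>i. inverse (u i)) (i # w))
        = u i * inverse (u i) * (prod_list (map u w) * prod_list (map (\<lambda>i. inverse (u i)) w))"
      by (simp only: list.map prod_list.Cons mult_ac)
    also have "\<dots> = 1" by (simp only: Cons.IH right_inverse [OF u] mult_1_right)
    finally show ?case .
  qed simp
  have "ncsubst n (\<lambda>i j. if i = j \<and> i < n then u i else 0) ` nc_ideal n (spec c ` defgens n q Th N (twisted C \<gamma>))
      = nc_ideal n (spec c' ` defgens n q Th N (twisted C \<gamma>'))"
  proof (rule ncsubst_diagonal_ideal [OF spec_defgens_ncR u])
    fix x assume "x \<in> spec c ` defgens n q Th N (twisted C \<gamma>)"
    then obtain a b where ab: "a < b" "b < n" "x = spec c (?R \<gamma> a b)" by (auto simp: defgens_def)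
    have "spec c' (?R \<gamma>' a b) \<in> spec c' ` defgens n q Th N (twisted C \<gamma>')"
      using ab by (auto simp: defgens_def)
    moreover have "(\<lambda>w. x w * prod_list (map u w)) = (\<lambda>w. u a * u b * spec c' (?R \<gamma>' a b) w)"
      unfolding ab(3) by (rule ext) (rule eq [OF ab(1,2)])
    ultimately show "\<exists>g'\<in>spec c' ` defgens n q Th N (twisted C \<gamma>'). \<exists>s.
      (\<lambda>w. x w * prod_list (map u w)) = (\<lambda>w. s * g' w)"
      by - (rule bexI, rule exI)
  next
    fix x assume "x \<in> spec c' ` defgens n q Th N (twisted C \<gamma>')"
    then obtain a b where ab: "a < b" "b < n" "x = spec c' (?R \<gamma>' a b)" by (auto simp: defgens_def)
    have "spec c (?R \<gamma> a b) \<in> spec c ` defgens n q Th N (twisted C \<gamma>)"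
      using ab by (auto simp: defgens_def)
    moreover have "(\<lambda>w. x w * prod_list (map (\<lambda>i. inverse (u i)) w))
      = (\<lambda>w. inverse (u a * u b) * spec c (?R \<gamma> a b) w)"
    proof
      fix w
      let ?V = "prod_list (map (\<lambda>i. inverse (u i)) w)"
      have x: "x w = spec c' (?R \<gamma>' a b) w" by (rule fun_cong [OF ab(3)])
      have "u a * u b * (x w * ?V) = u a * u b * spec c' (?R \<gamma>' a b) w * ?V"
        unfolding x by (rule mult.assoc [symmetric])
      also have "\<dots> = spec c (?R \<gamma> a b) w * prod_list (map u w) * ?V"
        by (rule subst [OF eq [OF ab(1,2)], of "\<lambda>z. z * ?V = _"]) (rule refl)
      also have "\<dots> = spec c (?R \<gamma> a b) w" unfolding mult.assoc inv by (rule mult_1_right)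
      finally have *: "u a * u b * (x w * ?V) = spec c (?R \<gamma> a b) w" .
      have "inverse (u a * u b) * (u a * u b * y) = y" for y using u [of a] u [of b] by (simp add: field_simps)
      from this [of "x w * ?V"] show "x w * ?V = inverse (u a * u b) * spec c (?R \<gamma> a b) w"
        unfolding * by (rule sym)
    qed
    ultimately show "\<exists>g'\<in>spec c ` defgens n q Th N (twisted C \<gamma>). \<exists>s.
      (\<lambda>w. x w * prod_list (map (\<lambda>i. inverse (u i)) w)) = (\<lambda>w. s * g' w)"
      by - (rule bexI, rule exI)
  qed
  then show ?thesis using filtered_aut_diagonal [OF u] by (intro exI conjI)
qed

end

theorem theorem5p4:
  fixes n :: nat and lam q b :: "nat \<Rightarrow> nat \<Rightarrow> complex" and I :: "nat set"
  assumes alt: "add_alt n lam"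
    and norm: "normalized n lam"
    and gen: "generic n lam"
    and q_def: "q = EExp lam"
    and b_def: "b = biresidue n lam"
    and I_sub: "I \<subseteq> {i. Suc i < n}"
    and smooth: "\<forall>i\<in>I. smoothable_edge n b i (Suc i)"
  shows
    "(\<exists>(N :: (nat \<Rightarrow> complex) \<Rightarrow> nat) (C :: (nat \<Rightarrow> complex) \<Rightarrow> nat \<Rightarrow> nat \<Rightarrow> nat \<Rightarrow> nat \<Rightarrow> complex).
        (\<forall>\<gamma>. (\<forall>i\<in>I. \<gamma> i \<noteq> 0) \<longrightarrow>
           1 \<le> N \<gamma> \<and>
           (\<forall>a bb k l i. a < bb \<and> bb < n \<and> k \<le> l \<and> l < n \<and> i \<in> I \<and> relw a bb k l = theta n b i
               \<longrightarrow> C \<gamma> bb a k l = \<gamma> i) \<and>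
           flat_deformation n q (defgens n q (Theta n b I) (N \<gamma>) (C \<gamma>))) \<and>
        (\<forall>\<gamma> \<gamma>' c c'. (\<forall>i\<in>I. \<gamma> i \<noteq> 0) \<and> (\<forall>i\<in>I. \<gamma>' i \<noteq> 0) \<and> c \<noteq> 0 \<and> c' \<noteq> 0 \<longrightarrow>
           (\<exists>M. filtered_aut n b I M \<and>
              ncsubst n M ` nc_ideal n (spec c ` defgens n q (Theta n b I) (N \<gamma>) (C \<gamma>))
                = nc_ideal n (spec c' ` defgens n q (Theta n b I) (N \<gamma>') (C \<gamma>'))))) \<and>
     ((\<forall>m\<ge>1. \<forall>a<n. \<forall>a'<n. a \<noteq> a' \<longrightarrow> (\<lambda>k. unitw a k - unitw a' k) \<notin> Theta n b I m) \<longrightarrow>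
       (\<forall>\<gamma> N C N' C'.
          (\<forall>i\<in>I. \<gamma> i \<noteq> 0) \<and>
          1 \<le> N \<and>
          (\<forall>a bb k l i. a < bb \<and> bb < n \<and> k \<le> l \<and> l < n \<and> i \<in> I \<and> relw a bb k l = theta n b i
               \<longrightarrow> C bb a k l = \<gamma> i) \<and>
          flat_deformation n q (defgens n q (Theta n b I) N C) \<and>
          1 \<le> N' \<and>
          (\<forall>a bb k l i. a < bb \<and> bb < n \<and> k \<le> l \<and> l < n \<and> i \<in> I \<and> relw a bb k l = theta n b i
               \<longrightarrow> C' bb a k l = \<gamma> i) \<and>
          flat_deformation n q (defgens n q (Theta n b I) N' C')
          \<longrightarrow> (\<forall>a bb. a < bb \<and> bb < n \<longrightarrow>
                 defrel n q (Theta n b I) N C a bb = defrel n q (Theta n b I) N' C' a bb)))"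
    (is "?existence \<and> ?uniqueness")
proof
  interpret smoothing n lam b I
    by (rule smoothing.intro [OF alt norm gen b_def I_sub smooth])
  \<comment> \<open>This base point has all first-level constants equal to 1; every other choice
    arises from it by twisting, with the same \<open>N\<close>.\<close>
  obtain N C where N: "1 \<le> N" and C: "\<And>x y k l. relw x y k l \<in> Theta n b I (Suc 0) \<Longrightarrow> C y x k l = 1"
    and ov: "\<And>x y z. x < y \<Longrightarrow> y < z \<Longrightarrow> z < n \<Longrightarrow>
       reduction_system.Phi n (EExp lam) (GC N C) (reduction_system.overlap n (EExp lam) (GC N C) z y x) = 0"
    by (rule overlap_free_exists) (rule that)
  show ?existence
    unfolding q_def
  proof (rule exI [where x = "\<lambda>_. N"], rule exI [of _ "twisted C"], intro conjI allI impI)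
    show "1 \<le> N" by (rule N)
    show "twisted C \<gamma> bb a k l = \<gamma> i"
      if "\<forall>i\<in>I. \<gamma> i \<noteq> 0" "a < bb \<and> bb < n \<and> k \<le> l \<and> l < n \<and> i \<in> I \<and> relw a bb k l = theta n b i" for \<gamma> a bb k l i
      using that by (intro twisted_first_order C) auto
    show "flat_deformation n (EExp lam) (defgens n (EExp lam) (Theta n b I) N (twisted C \<gamma>))" for \<gamma>
      by (rule twisted_flat) (rule ov)
    show "\<exists>M. filtered_aut n b I M \<and>
        ncsubst n M ` nc_ideal n (spec c ` defgens n (EExp lam) (Theta n b I) N (twisted C \<gamma>))
          = nc_ideal n (spec c' ` defgens n (EExp lam) (Theta n b I) N (twisted C \<gamma>'))"
      if "(\<forall>i\<in>I. \<gamma> i \<noteq> 0) \<and> (\<forall>i\<in>I. \<gamma>' i \<noteq> 0) \<and> c \<noteq> 0 \<and> c' \<noteq> 0" for \<gamma> \<gamma>' c c'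
      using that by (intro specializations_isomorphic) auto
  qed
  show ?uniqueness
    unfolding q_def
  proof (intro allI impI, elim conjE)
    fix \<gamma> :: "nat \<Rightarrow> complex" and N C N' C' a bb
    assume no_linear: "\<forall>m\<ge>1. \<forall>a<n. \<forall>a'<n. a \<noteq> a' \<longrightarrow> (\<lambda>k. unitw a k - unitw a' k) \<notin> Theta n b I m"
      and N: "1 \<le> N" "1 \<le> N'"
      and C: "\<forall>a bb k l i. a < bb \<and> bb < n \<and> k \<le> l \<and> l < n \<and> i \<in> I \<and> relw a bb k l = theta n b i
               \<longrightarrow> C bb a k l = \<gamma> i"
      and C': "\<forall>a bb k l i. a < bb \<and> bb < n \<and> k \<le> l \<and> l < n \<and> i \<in> I \<and> relw a bb k l = theta n b i
               \<longrightarrow> C' bb a k l = \<gamma> i"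
      and flat: "flat_deformation n (EExp lam) (defgens n (EExp lam) (Theta n b I) N C)"
        "flat_deformation n (EExp lam) (defgens n (EExp lam) (Theta n b I) N' C')"
      and ab: "a < bb" "bb < n"
    have "GC N C bb a k l = GC N' C' bb a k l" for k l
    proof (rule deformation_unique [OF no_linear N _ _ flat ab, where \<gamma> = \<gamma>])
      fix x y k l i assume "x < y" "y < n" "k \<le> l" "l < n" "i \<in> I" "relw x y k l = theta n b i"
      then have "x < y \<and> y < n \<and> k \<le> l \<and> l < n \<and> i \<in> I \<and> relw x y k l = theta n b i"
        by (intro conjI)
      then show "C y x k l = \<gamma> i" "C' y x k l = \<gamma> i"
        by (rule C [rule_format], rule C' [rule_format])
    qed
    then show "defrel n (EExp lam) (Theta n b I) N C a bb = defrel n (EExp lam) (Theta n b I) N' C' a bb"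
      unfolding defrel_eq_GC by (simp only:)
  qed
qed

end
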